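(* Let $T\colon R^{p,0}_\omega\to R^{p,0}_\omega$ be a bounded linear operator with $\inf_{(n,I)\in\mathcal D_\omega}\big||I|^{-1}\langle h^n_I,Th^n_I\rangle\big|\ge\delta>0$. Then for every $0<\epsilon<1$, $T$ is a $\frac{2(p^*-1)^4}{\delta(1-\epsilon)}\big(\frac{p^*}{2}\big)^{3/2}$-factor of the identity on $R^{p,0}_\omega$, i.e. there exist bounded operators $A,B$ on $R^{p,0}_\omega$ with $ATB=I$ and $\|A\|\|B\|\le\frac{2(p^*-1)^4}{\delta(1-\epsilon)}\big(\frac{p^*}{2}\big)^{3/2}$.
   Context: Fix $1<p<\infty$, $q=p/(p-1)$, $p^*=\max\{p,q\}$. All $L_r$ spaces are over $[0,1]$ with Lebesgue measure and $\langle g,f\rangle=\int_0^1gf$. A dyadic interval is $[(i-1)2^{-n},i2^{-n})$, $n\ge0$, $1\le i\le2^n$; $\mathcal D^n$ is the set of those of length $2^{-n}$ and $\mathcal D_n=\bigcup_{k=0}^n\mathcal D^k$. For a dyadic interval $I$, $I^+,I^-$ are its left and right halves and $h_I=\chi_{I^+}-\chi_{I^-}$. For each $n\in\mathbb N$ a family $(h^n_I)_{I\in\mathcal D_{n-1}}$ in $L_p$ is fixed with the same joint distribution as $(h_I)_{I\in\mathcal D_{n-1}}$, such that the $\sigma$-algebras $\sigma(h^n_I:I\in\mathcal D_{n-1})$, $n\in\mathbb N$, are independent. Let $\mathcal D_\omega=\{(n,I):n\in\mathbb N,I\in\mathcal D_{n-1}\}$. $R^{p,0}_\omega$ is the closed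 linear span of $\{h^n_I:(n,I)\in\mathcal D_\omega\}$ in $L_p$ (a distributional copy of the mean-zero hyperplane of the Bourgain–Rosenthal–Schechtman space $R^p_\omega$); $(h^n_I)$ is an unconditional basis of it. *)

theory Defs
  imports "HOL-Probability.Probability"
begin

abbreviation LM :: "real measure" where "LM \<equiv> lebesgue_on {0..1}"

text \<open>Dyadic interval (k,i): [(i-1)2^-k, i 2^-k), k \<ge> 0, 1 \<le> i \<le> 2^k.\<close>
definition dyadic :: "nat \<Rightarrow> (nat \<times> nat) set" where
  "dyadic k = {(k', i). k' = k \<and> 1 \<le> i \<and> i \<le> 2 ^ k}"

definition dyadic_upto :: "nat \<Rightarrow> (nat \<times> nat) set" where
  "dyadic_upto n = (\<Union>k\<le>n. dyadic k)"

definition dy_len :: "nat \<times> nat \<Rightarrow> real" where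
  "dy_len I = 1 / 2 ^ fst I"

definition dy_left :: "nat \<times> nat \<Rightarrow> real set" where
  "dy_left I = {(real (snd I) - 1) / 2 ^ fst I ..< (2 * real (snd I) - 1) / 2 ^ (fst I + 1)}"

definition dy_right :: "nat \<times> nat \<Rightarrow> real set" where
  "dy_right I = {(2 * real (snd I) - 1) / 2 ^ (fst I + 1) ..< real (snd I) / 2 ^ fst I}"

definition haar :: "nat \<times> nat \<Rightarrow> real \<Rightarrow> real" where
  "haar I x = indicator (dy_left I) x - indicator (dy_right I) x"

definition D_omega :: "(nat \<times> (nat \<times> nat)) set" where
  "D_omega = {(n, I). 1 \<le> n \<and> I \<in> dyadic_upto (n - 1)}"

definition in_Lp :: "real \<Rightarrow> (real \<Rightarrow> real) \<Rightarrow> bool" where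
  "in_Lp p f \<longleftrightarrow> f \<in> borel_measurable LM \<and> integrable LM (\<lambda>x. \<bar>f x\<bar> powr p)"

definition Lp_norm :: "real \<Rightarrow> (real \<Rightarrow> real) \<Rightarrow> real" where
  "Lp_norm p f = (\<integral>x. \<bar>f x\<bar> powr p \<partial>LM) powr (1 / p)"

definition inner_L :: "(real \<Rightarrow> real) \<Rightarrow> (real \<Rightarrow> real) \<Rightarrow> real" where
  "inner_L g f = (\<integral>x. g x * f x \<partial>LM)"

definition haar_copy_family :: "(nat \<Rightarrow> nat \<times> nat \<Rightarrow> real \<Rightarrow> real) \<Rightarrow> bool" where
  "haar_copy_family h \<longleftrightarrow>
     (\<forall>n I. (n, I) \<in> D_omega \<longrightarrow> h n I \<in> borel_measurable LM) \<and>
     (\<forall>n\<ge>1. distr LM (PiM (dyadic_upto (n - 1)) (\<lambda>_. borel))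
                 (\<lambda>x. \<lambda>I\<in>dyadic_upto (n - 1). h n I x)
           = distr LM (PiM (dyadic_upto (n - 1)) (\<lambda>_. borel))
                 (\<lambda>x. \<lambda>I\<in>dyadic_upto (n - 1). haar I x)) \<and>
     prob_space.indep_vars LM (\<lambda>n. PiM (dyadic_upto (n - 1)) (\<lambda>_. borel :: real measure))
        (\<lambda>n x. \<lambda>I\<in>dyadic_upto (n - 1). h n I x) {1..}"

definition R_space :: "real \<Rightarrow> (nat \<Rightarrow> nat \<times> nat \<Rightarrow> real \<Rightarrow> real) \<Rightarrow> (real \<Rightarrow> real) set" where
  "R_space p h = {f. in_Lp p f \<and>
     (\<forall>e>0. \<exists>F c. finite F \<and> F \<subseteq> D_omega \<and>
        Lp_norm p (\<lambda>x. f x - (\<Sum>(n, I)\<in>F. c (n, I) * h n I x)) < e)}"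

definition bounded_op_on :: "real \<Rightarrow> (real \<Rightarrow> real) set \<Rightarrow> ((real \<Rightarrow> real) \<Rightarrow> (real \<Rightarrow> real)) \<Rightarrow> real \<Rightarrow> bool" where
  "bounded_op_on p V T C \<longleftrightarrow>
     (\<forall>f\<in>V. T f \<in> V) \<and>
     (\<forall>f\<in>V. \<forall>g\<in>V. \<forall>a b::real. AE x in LM. T (\<lambda>y. a * f y + b * g y) x = a * T f x + b * T g x) \<and>
     (\<forall>f\<in>V. Lp_norm p (T f) \<le> C * Lp_norm p (f))"

end

theory Submission
  imports Defs
begin

text \<open>
  Block \<open>n\<close> is a function of a uniformly distributed leaf of a dyadic tree of depth \<open>n\<close>, and leaves of
  different blocks are independent. If each block \<open>n\<close> is linked to a deeper block \<open>N n\<close> by a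
  doubly stochastic kernel, then the product of the kernels and its transpose are \<open>L\<^sub>p\<close>-contractions \<open>B\<close>
  and \<open>A\<close>, by Jensen's inequality. The kernels are built from martingale differences \<open>w\<^sub>i\<close> with values
  in \<open>{-1, 0, 1}\<close>: \<open>w\<^sub>i\<close> is a random sign combination of the Haar functions of those nodes of positive
  diagonal entry that have exactly \<open>\<rho>\<^sub>i\<close> ancestors of positive diagonal entry.

  Every leaf has many ancestors with positive or many with negative diagonal entry, so for one of the
  two signs these nodes cover at least half of the leaves. Random signs remove the off-diagonal entries
  within a block and make the diagonal entries depend only on \<open>i\<close>; a pigeonhole choice of the ranks
  \<open>\<rho>\<^sub>i\<close> and compactness make them nearly equal to one scalar \<open>c\<close> with \<open>\<bar>c\<bar> \<ge> \<delta> / 2\<close>. Entries between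
  different blocks vanish along a sparse choice of \<open>N\<close>. Hence \<open>A T B\<close> is a small perturbation of \<open>c I\<close> and
  can be inverted at cost \<open>2 / (\<delta> (1 - \<epsilon>))\<close>, which is at most the stated constant since \<open>p\<^sup>* \<ge> 2\<close>.
\<close>

section \<open>Lebesgue spaces on the unit interval\<close>

text \<open>Diagonal entries of opposite sign can cancel: if they are |J| for the nodes in the left
  half of the tree and -|J| for those in the right half, any sign combination of disjoint nodes
  below the root that covers all leaves can have diagonal entry 0. So the Haar system cannot in
  general be copied onto fully supported functions with the diagonal kept away from 0. The waves
  therefore live on nodes of one sign only and vanish elsewhere. Where a wave is 0 the kernel tosses
  a fair coin, and so it stays doubly stochastic although the waves are not distributed like Haar
  functions. The price is the factor 1/2 in the bound for |c|. Equal ranks serve two purposes. On a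
  node of rank \<open>\<rho> k\<close> all earlier waves are constant signs, so the kernels are
  indicators there. And a large rank forces a short interval, which makes the entries between such
  nodes small in the square mean, so that random signs can remove them.\<close>

lemma prob_space_LM: "prob_space LM"
  by (rule prob_spaceI) (simp add: emeasure_restrict_space)

interpretation LM: prob_space LM
  by (rule prob_space_LM)

lemma abs_powr_convex_comb:
  fixes p :: real
  assumes p: "1 \<le> p" and uv: "0 \<le> u" "0 \<le> v" "u + v = 1"
  shows "\<bar>u * x + v * y\<bar> powr p \<le> u * \<bar>x\<bar> powr p + v * \<bar>y\<bar> powr p"
proof -
  \<comment> \<open>Used when one of the two points is 0: on [0, 1] the power with exponent p \<ge>
    1 lies below the identity.\<close>
  have z: "(v * y) powr p \<le> v * y powr p" if "0 \<le> v" "v \<le> 1" "0 \<le> y" for v y :: real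
  proof (cases "v = 0")
    case False
    then have "v powr p \<le> v powr 1" using that p by (intro powr_mono') auto
    then show ?thesis using that False by (simp add: powr_mult mult_right_mono)
  qed simp
  have "\<bar>u * x + v * y\<bar> powr p \<le> (u * \<bar>x\<bar> + v * \<bar>y\<bar>) powr p"
    using uv p by (intro powr_mono2) (auto simp: abs_mult intro!: order_trans[OF abs_triangle_ineq])
  also have "\<dots> \<le> u * \<bar>x\<bar> powr p + v * \<bar>y\<bar> powr p"
  proof (cases "x = 0 \<or> y = 0")
    case True
    then show ?thesis using z[of v "\<bar>y\<bar>"] z[of u "\<bar>x\<bar>"] uv p by auto
  next
    case False
    then have "(u *\<^sub>R \<bar>x\<bar> + v *\<^sub>R \<bar>y\<bar>) powr p \<le> u * \<bar>x\<bar> powr p + v * \<bar>y\<bar> powr p"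
      using powr_convex[OF p] uv unfolding convex_on_def by simp
    then show ?thesis by simp
  qed
  finally show ?thesis .
qed

lemma convex_on_abs_powr:
  fixes p :: real
  assumes "1 \<le> p"
  shows "convex_on UNIV (\<lambda>x::real. \<bar>x\<bar> powr p)"
  unfolding convex_on_def using abs_powr_convex_comb[OF assms] by simp

lemma Lp_norm_nonneg: "0 \<le> Lp_norm p f"
  by (simp add: Lp_norm_def)

lemma in_Lp_measurable: "in_Lp p f \<Longrightarrow> f \<in> borel_measurable LM"
  by (simp add: in_Lp_def)

lemma integral_powr_le:
  assumes "1 \<le> p" "Lp_norm p f \<le> a"
  shows "(\<integral>x. \<bar>f x\<bar> powr p \<partial>LM) \<le> a powr p"
proof -
  have "Lp_norm p f powr p \<le> a powr p"
    using assms Lp_norm_nonneg by (intro powr_mono2) auto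
  then show ?thesis using assms by (simp add: Lp_norm_def powr_powr)
qed

lemma Lp_norm_leI:
  assumes "1 \<le> p" "0 \<le> a" "(\<integral>x. \<bar>f x\<bar> powr p \<partial>LM) \<le> a powr p"
  shows "Lp_norm p f \<le> a"
proof -
  have "Lp_norm p f \<le> (a powr p) powr (1/p)"
    unfolding Lp_norm_def using assms by (intro powr_mono2) auto
  then show ?thesis using assms by (simp add: powr_powr)
qed

lemma Lp_norm_cong:
  assumes "AE x in LM. f x = g x" "f \<in> borel_measurable LM" "g \<in> borel_measurable LM"
  shows "Lp_norm p f = Lp_norm p g"
proof -
  have "(\<integral>x. \<bar>f x\<bar> powr p \<partial>LM) = (\<integral>x. \<bar>g x\<bar> powr p \<partial>LM)"
    using assms by (intro integral_cong_AE) auto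
  then show ?thesis by (simp add: Lp_norm_def)
qed

lemma in_Lp_cong:
  assumes "AE x in LM. f x = g x" "in_Lp p f" "g \<in> borel_measurable LM"
  shows "in_Lp p g"
proof -
  have "integrable LM (\<lambda>x. \<bar>g x\<bar> powr p)"
    using assms unfolding in_Lp_def
    by (subst integrable_cong_AE[where g = "\<lambda>x. \<bar>f x\<bar> powr p"]) auto
  with assms show ?thesis by (simp add: in_Lp_def)
qed

lemma
  assumes "1 \<le> p" "in_Lp p f"
  shows in_Lp_scale: "in_Lp p (\<lambda>x. c * f x)"
    and Lp_norm_scale: "Lp_norm p (\<lambda>x. c * f x) = \<bar>c\<bar> * Lp_norm p f"
proof -
  show "in_Lp p (\<lambda>x. c * f x)"
    using assms by (auto simp: in_Lp_def abs_mult powr_mult)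
  show "Lp_norm p (\<lambda>x. c * f x) = \<bar>c\<bar> * Lp_norm p f"
    using assms by (simp add: Lp_norm_def abs_mult powr_mult powr_powr)
qed

text \<open>Minkowski's inequality by convexity: f + g is (a + b) times a convex combination of f /
  a and g / b, with a and b close to the two norms. The choice a = b = 1 yields
  integrability.\<close>

lemma
  assumes p: "1 \<le> p" and f: "in_Lp p f" and g: "in_Lp p g"
  shows in_Lp_add: "in_Lp p (\<lambda>x. f x + g x)"
    and Lp_norm_triangle: "Lp_norm p (\<lambda>x. f x + g x) \<le> Lp_norm p f + Lp_norm p g"
proof -
  note [measurable] = in_Lp_measurable[OF f] in_Lp_measurable[OF g]
  have intf: "integrable LM (\<lambda>x. \<bar>f x\<bar> powr p)" and intg: "integrable LM (\<lambda>x. \<bar>g x\<bar> powr p)"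
    using f g by (auto simp: in_Lp_def)
  have pw: "\<bar>f x + g x\<bar> powr p \<le> (a + b) powr (p - 1) * (a powr (1 - p) * \<bar>f x\<bar> powr p + b powr (1 - p) * \<bar>g x\<bar> powr p)"
    if "a > 0" "b > 0" for a b x
  proof -
    have "\<bar>(a / (a+b)) * (f x / a) + (b / (a + b)) * (g x / b)\<bar> powr p
      \<le> (a / (a+b)) * \<bar>f x / a\<bar> powr p + (b / (a+b)) * \<bar>g x / b\<bar> powr p"
      using that by (intro abs_powr_convex_comb p) (auto simp flip: add_divide_distrib)
    also have "(a / (a+b)) * (f x / a) + (b / (a + b)) * (g x / b) = (f x + g x) / (a + b)"
      using that by (simp add: add_divide_distrib)
    finally have "\<bar>f x + g x\<bar> powr p / (a + b) powr p \<le>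
       (a / (a+b)) * \<bar>f x / a\<bar> powr p + (b / (a+b)) * \<bar>g x / b\<bar> powr p"
      using that by (simp add: abs_divide powr_divide)
    also have "\<dots> = (a powr (1 - p) * \<bar>f x\<bar> powr p + b powr (1 - p) * \<bar>g x\<bar> powr p) / (a + b)"
      using that by (simp add: abs_divide powr_divide powr_diff add_divide_distrib mult.commute)
    finally have "\<bar>f x + g x\<bar> powr p \<le> (a powr (1 - p) * \<bar>f x\<bar> powr p + b powr (1 - p) * \<bar>g x\<bar> powr p) / (a + b) * (a + b) powr p"
      using that by (simp add: pos_divide_le_eq)
    then show ?thesis using that by (simp add: powr_diff field_simps)
  qed
  have int: "integrable LM (\<lambda>x. \<bar>f x + g x\<bar> powr p)"
    by (rule Bochner_Integration.integrable_bound[where f = "\<lambda>x. 2 powr (p - 1) * (\<bar>f x\<bar> powr p + \<bar>g x\<bar> powr p)"])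
       (use pw[of 1 1] intf intg in auto)
  then show "in_Lp p (\<lambda>x. f x + g x)"
    by (auto simp: in_Lp_def)
  show "Lp_norm p (\<lambda>x. f x + g x) \<le> Lp_norm p f + Lp_norm p g"
  proof (rule field_le_epsilon)
    fix e :: real assume e: "e > 0"
    \<comment> \<open>The summand e / 2 keeps both weights positive when a norm is 0.\<close>
    define a b where "a = Lp_norm p f + e / 2" and "b = Lp_norm p g + e/2"
    have ab: "a > 0" "b > 0" using e Lp_norm_nonneg[of p f] Lp_norm_nonneg[of p g] by (auto simp: a_def b_def)
    have "(\<integral>x. \<bar>f x + g x\<bar> powr p \<partial>LM) \<le>
      (\<integral>x. (a + b) powr (p - 1) * (a powr (1 - p) * \<bar>f x\<bar> powr p + b powr (1 - p) * \<bar>g x\<bar> powr p) \<partial>LM)"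
      by (rule integral_mono[OF int]) (use pw[OF ab] intf intg in auto)
    also have "\<dots> = (a + b) powr (p - 1) * (a powr (1 - p) * (\<integral>x. \<bar>f x\<bar> powr p \<partial>LM) + b powr (1 - p) * (\<integral>x. \<bar>g x\<bar> powr p \<partial>LM))"
      using intf intg by simp
    also have "\<dots> \<le> (a + b) powr (p - 1) * (a powr (1 - p) * a powr p + b powr (1 - p) * b powr p)"
      using e by (intro mult_left_mono add_mono integral_powr_le p) (auto simp: a_def b_def)
    also have "\<dots> = (a + b) powr p"
      using ab by (simp flip: powr_add) (simp add: powr_diff)
    finally have "Lp_norm p (\<lambda>x. f x + g x) \<le> a + b"
      using ab p by (intro Lp_norm_leI) auto
    then show "Lp_norm p (\<lambda>x. f x + g x) \<le> Lp_norm p f + Lp_norm p g + e"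
      by (simp add: a_def b_def)
  qed
qed

lemma
  assumes p: "1 \<le> p" and f: "in_Lp p f" and g: "in_Lp p g"
  shows in_Lp_lin: "in_Lp p (\<lambda>x. a * f x + b * g x)"
    and in_Lp_diff: "in_Lp p (\<lambda>x. f x - g x)"
    and Lp_norm_diff_triangle: "Lp_norm p (\<lambda>x. f x - g x) \<le> Lp_norm p f + Lp_norm p g"
  using in_Lp_add[OF p in_Lp_scale[OF p f, of a] in_Lp_scale[OF p g, of b]]
    in_Lp_add[OF p f in_Lp_scale[OF p g, of "-1"]]
    Lp_norm_triangle[OF p f in_Lp_scale[OF p g, of "-1"]] Lp_norm_scale[OF p g, of "-1"]
  by auto

lemma Lp_norm_minus_commute: "Lp_norm p (\<lambda>x. f x - g x) = Lp_norm p (\<lambda>x. g x - f x)"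
  by (simp add: Lp_norm_def abs_minus_commute)

lemma Lp_norm_dist_triangle:
  assumes p: "1 \<le> p" and "in_Lp p f" "in_Lp p g" "in_Lp p k"
  shows "Lp_norm p (\<lambda>x. f x - k x) \<le> Lp_norm p (\<lambda>x. f x - g x) + Lp_norm p (\<lambda>x. g x - k x)"
  using Lp_norm_triangle[OF p in_Lp_diff[OF p assms(2,3)] in_Lp_diff[OF p assms(3,4)]] by simp

lemma in_Lp_zero: "in_Lp p (\<lambda>x. 0)" and Lp_norm_zero: "Lp_norm p (\<lambda>x. 0) = 0"
  by (auto simp: in_Lp_def Lp_norm_def)

lemma
  assumes p: "1 \<le> p" and "finite S" and "\<And>i. i \<in> S \<Longrightarrow> in_Lp p (f i)"
  shows in_Lp_sum: "in_Lp p (\<lambda>x. \<Sum>i\<in>S. f i x)"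
    and Lp_norm_sum: "Lp_norm p (\<lambda>x. \<Sum>i\<in>S. f i x) \<le> (\<Sum>i\<in>S. Lp_norm p (f i))"
proof -
  have "in_Lp p (\<lambda>x. \<Sum>i\<in>S. f i x) \<and> Lp_norm p (\<lambda>x. \<Sum>i\<in>S. f i x) \<le> (\<Sum>i\<in>S. Lp_norm p (f i))"
    using assms(2,3)
  proof (induction S rule: finite_induct)
    case empty
    then show ?case by (simp add: in_Lp_zero Lp_norm_zero)
  next
    case (insert a S)
    then have *: "in_Lp p (f a)" "in_Lp p (\<lambda>x. \<Sum>i\<in>S. f i x)" "Lp_norm p (\<lambda>x. \<Sum>i\<in>S. f i x) \<le> (\<Sum>i\<in>S. Lp_norm p (f i))" by auto
    from in_Lp_add[OF p *(1,2)] Lp_norm_triangle[OF p *(1,2)] *(3) insert(1,2) show ?case by auto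
  qed
  then show "in_Lp p (\<lambda>x. \<Sum>i\<in>S. f i x)" "Lp_norm p (\<lambda>x. \<Sum>i\<in>S. f i x) \<le> (\<Sum>i\<in>S. Lp_norm p (f i))" by auto
qed

text \<open>Young's inequality for f / a and g / b, with a and b slightly above the norms. The
  excess e tends to 0 at the end, which also covers vanishing norms.\<close>

lemma
  assumes p: "1 < p" and q: "q = p / (p - 1)" and f: "in_Lp p f" and g: "in_Lp q g"
  shows Holder_integrable: "integrable LM (\<lambda>x. g x * f x)"
    and Holder_integral_abs: "(\<integral>x. \<bar>g x * f x\<bar> \<partial>LM) \<le> Lp_norm q g * Lp_norm p f"
proof -
  note [measurable] = in_Lp_measurable[OF f] in_Lp_measurable[OF g]
  have q1: "q > 1" and pq: "1/p + 1/q = 1" using p by (auto simp: q field_simps)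
  have intf: "integrable LM (\<lambda>x. \<bar>f x\<bar> powr p)" and intg: "integrable LM (\<lambda>x. \<bar>g x\<bar> powr q)"
    using f g by (auto simp: in_Lp_def)
  have pw: "\<bar>g x * f x\<bar> \<le> a * b * (a powr (-p) * \<bar>f x\<bar> powr p / p + b powr (-q) * \<bar>g x\<bar> powr q / q)"
    if "a > 0" "b > 0" for a b x
  proof -
    have "\<bar>f x / a\<bar> * \<bar>g x / b\<bar> \<le> \<bar>f x / a\<bar> powr p / p + \<bar>g x / b\<bar> powr q / q"
      using p q1 pq by (intro Youngs_inequality) auto
    moreover have "\<bar>f x / a\<bar> powr p = a powr (-p) * \<bar>f x\<bar> powr p" "\<bar>g x / b\<bar> powr q = b powr (-q) * \<bar>g x\<bar> powr q"
      using that by (auto simp: powr_divide powr_minus_divide abs_divide)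
    moreover have "\<bar>f x / a\<bar> * \<bar>g x / b\<bar> = \<bar>g x * f x\<bar> / (a * b)"
      using that by (simp add: abs_divide abs_mult)
    ultimately have "\<bar>g x * f x\<bar> / (a * b) \<le> a powr (-p) * \<bar>f x\<bar> powr p / p + b powr (-q) * \<bar>g x\<bar> powr q / q"
      by metis
    then show ?thesis using that by (simp add: pos_divide_le_eq mult_ac)
  qed
  have int: "integrable LM (\<lambda>x. \<bar>g x * f x\<bar>)"
    by (rule Bochner_Integration.integrable_bound[where f = "\<lambda>x. \<bar>f x\<bar> powr p / p + \<bar>g x\<bar> powr q / q"])
       (use pw[of 1 1] intf intg in \<open>auto simp: abs_mult intro!: order_trans[OF _ abs_ge_self]\<close>)
  then show "integrable LM (\<lambda>x. g x * f x)"
    by (subst (asm) integrable_abs_iff) auto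
  have "(\<integral>x. \<bar>g x * f x\<bar> \<partial>LM) \<le> (Lp_norm q g + e) * (Lp_norm p f + e)" if e: "e > 0" for e
  proof -
    define a b where "a = Lp_norm p f + e" and "b = Lp_norm q g + e"
    have ab: "a > 0" "b > 0" using e Lp_norm_nonneg[of p f] Lp_norm_nonneg[of q g] by (auto simp: a_def b_def)
    have "(\<integral>x. \<bar>g x * f x\<bar> \<partial>LM) \<le>
      (\<integral>x. a * b * (a powr (-p) * \<bar>f x\<bar> powr p / p + b powr (-q) * \<bar>g x\<bar> powr q / q) \<partial>LM)"
      by (rule integral_mono[OF int]) (use pw[OF ab] intf intg in auto)
    also have "\<dots> = a * b * (a powr (-p) * (\<integral>x. \<bar>f x\<bar> powr p \<partial>LM) / p + b powr (-q) * (\<integral>x. \<bar>g x\<bar> powr q \<partial>LM) / q)"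
      using intf intg by simp
    also have "\<dots> \<le> a * b * (a powr (-p) * a powr p / p + b powr (-q) * b powr q / q)"
      using e ab p q1 by (intro mult_left_mono add_mono divide_right_mono integral_powr_le) (auto simp: a_def b_def)
    also have "\<dots> = a * b"
      using ab pq by (simp flip: powr_add)
    finally show ?thesis by (simp add: a_def b_def mult_ac)
  qed
  moreover have "((\<lambda>e. (Lp_norm q g + e) * (Lp_norm p f + e)) \<longlongrightarrow> (Lp_norm q g + 0) * (Lp_norm p f + 0)) (at_right 0)"
    by (intro tendsto_intros)
  ultimately show "(\<integral>x. \<bar>g x * f x\<bar> \<partial>LM) \<le> Lp_norm q g * Lp_norm p f"
    by (intro tendsto_lowerbound[where F = "at_right 0" and f = "\<lambda>e. (Lp_norm q g + e) * (Lp_norm p f + e)"])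
       (auto simp: eventually_at_right_field intro!: exI[of _ 1])
qed

lemma Holder_inner_L:
  assumes "1 < p" "q = p / (p - 1)" "in_Lp p f" "in_Lp q g"
  shows "\<bar>inner_L g f\<bar> \<le> Lp_norm q g * Lp_norm p f"
  using Holder_integral_abs[OF assms] integral_abs_bound[of LM "\<lambda>x. g x * f x"]
  unfolding inner_L_def by linarith

lemma
  assumes "1 \<le> p" "f \<in> borel_measurable LM" "AE x in LM. \<bar>f x\<bar> \<le> c" "0 \<le> c"
  shows in_Lp_bounded: "in_Lp p f"
    and Lp_norm_bounded: "Lp_norm p f \<le> c"
proof -
  have ae: "AE x in LM. \<bar>f x\<bar> powr p \<le> c powr p"
    using assms(3) by eventually_elim (use assms in \<open>auto intro!: powr_mono2\<close>)
  have int: "integrable LM (\<lambda>x. \<bar>f x\<bar> powr p)"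
    by (rule Bochner_Integration.integrable_bound[where f = "\<lambda>_. c powr p"]) (use assms ae in auto)
  then show "in_Lp p f" using assms by (simp add: in_Lp_def)
  have "(\<integral>x. \<bar>f x\<bar> powr p \<partial>LM) \<le> (\<integral>x. c powr p \<partial>LM)"
    by (rule integral_mono_AE[OF int]) (use ae in auto)
  then show "Lp_norm p f \<le> c"
    using assms LM.prob_space by (intro Lp_norm_leI) auto
qed

lemma integral_abs_le_Lp_norm:
  assumes p: "1 < p" and f: "in_Lp p f"
  shows "integrable LM f" "(\<integral>x. \<bar>f x\<bar> \<partial>LM) \<le> Lp_norm p f"
proof -
  define q where "q = p / (p - 1)"
  have q: "1 \<le> q" using p by (simp add: q_def field_simps)
  have 1: "in_Lp q (\<lambda>_. 1)" "Lp_norm q (\<lambda>_. 1) \<le> 1"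
    using q by (auto intro!: in_Lp_bounded[of _ _ 1] Lp_norm_bounded)
  show "integrable LM f" using Holder_integrable[OF p q_def f 1(1)] by simp
  have "(\<integral>x. \<bar>f x\<bar> \<partial>LM) \<le> Lp_norm q (\<lambda>_. 1) * Lp_norm p f"
    using Holder_integral_abs[OF p q_def f 1(1)] by simp
  also have "\<dots> \<le> 1 * Lp_norm p f"
    using 1 Lp_norm_nonneg by (intro mult_right_mono) auto
  finally show "(\<integral>x. \<bar>f x\<bar> \<partial>LM) \<le> Lp_norm p f" by simp
qed

lemma Lp_norm_eq_0_AE:
  assumes p: "1 < p" and f: "in_Lp p f" and "Lp_norm p f \<le> 0"
  shows "AE x in LM. f x = 0"
proof -
  have "(\<integral>x. \<bar>f x\<bar> \<partial>LM) = 0"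
    using integral_abs_le_Lp_norm[OF p f] assms(3) by (intro antisym) auto
  then show ?thesis
    using integral_abs_le_Lp_norm(1)[OF p f]
    by (subst (asm) integral_nonneg_eq_0_iff_AE) auto
qed

text \<open>The increments are summable in \<open>L\<^sub>1\<close>, so the sequence converges
  almost everywhere. Fatou's lemma then passes the tail bound 2 * (1/2) ^ k from differences of
  members to the distance from the limit.\<close>

lemma Lp_complete_aux:
  assumes p: "1 < p" and f: "\<And>k. in_Lp p (f k)"
    and d: "\<And>k. Lp_norm p (\<lambda>x. f (Suc k) x - f k x) \<le> (1/2) ^ k"
  shows "\<exists>g. in_Lp p g \<and> (\<lambda>k. Lp_norm p (\<lambda>x. f k x - g x)) \<longlonglongrightarrow> 0"
proof -
  have p': "1 \<le> p" using p by simp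
  note [measurable] = in_Lp_measurable[OF f]
  define D where "D k x = f (Suc k) x - f k x" for k x
  have D: "in_Lp p (D k)" for k unfolding D_def using in_Lp_diff[OF p' f f] .
  note [measurable] = in_Lp_measurable[OF D]
  have "(\<integral>\<^sup>+x. (\<Sum>k. ennreal \<bar>D k x\<bar>) \<partial>LM) = (\<Sum>k. \<integral>\<^sup>+x. ennreal \<bar>D k x\<bar> \<partial>LM)"
    by (rule nn_integral_suminf) auto
  also have "\<dots> \<le> (\<Sum>k. ennreal ((1/2)^k))"
  proof (intro suminf_le)
    fix k
    have "(\<integral>\<^sup>+x. ennreal \<bar>D k x\<bar> \<partial>LM) = ennreal (\<integral>x. \<bar>D k x\<bar> \<partial>LM)"
      using integral_abs_le_Lp_norm(1)[OF p D] by (intro nn_integral_eq_integral) auto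
    also have "\<dots> \<le> ennreal ((1/2)^k)"
      using integral_abs_le_Lp_norm(2)[OF p D[of k]] d[of k] by (intro ennreal_leI) (auto simp: D_def[abs_def])
    finally show "(\<integral>\<^sup>+x. ennreal \<bar>D k x\<bar> \<partial>LM) \<le> ennreal ((1/2)^k)" .
  qed auto
  also have "\<dots> = ennreal (\<Sum>k. (1/2)^k)"
    by (rule suminf_ennreal2) (auto simp: summable_geometric)
  finally have fin: "(\<integral>\<^sup>+x. (\<Sum>k. ennreal \<bar>D k x\<bar>) \<partial>LM) \<noteq> \<infinity>"
    by (metis ennreal_less_top infinity_ennreal_def leD)
  have "AE x in LM. (\<Sum>k. ennreal \<bar>D k x\<bar>) \<noteq> \<infinity>"
    by (rule nn_integral_PInf_AE[OF _ fin]) auto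
  then have "AE x in LM. convergent (\<lambda>k. f k x)"
  proof eventually_elim
    case (elim x)
    then have "summable (\<lambda>k. \<bar>D k x\<bar>)"
      by (intro summable_suminf_not_top) auto
    then have "summable (\<lambda>k. f (Suc k) x - f k x)"
      unfolding D_def[symmetric] by (rule summable_rabs_cancel)
    then have "convergent (\<lambda>n. \<Sum>k<n. f (Suc k) x - f k x)"
      by (simp add: summable_iff_convergent)
    then have "convergent (\<lambda>n. f n x - f 0 x)" by (simp add: sum_lessThan_telescope[of "\<lambda>k. f k x"])
    then have "convergent (\<lambda>n. (f n x - f 0 x) + f 0 x)"
      by (intro convergent_add convergent_const)
    then show ?case by simp
  qed
  then have lim: "AE x in LM. (\<lambda>k. f k x) \<longlonglongrightarrow> lim (\<lambda>k. f k x)"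
    by eventually_elim (simp add: convergent_LIMSEQ_iff)
  define g where "g x = lim (\<lambda>k. f k x)" for x
  have [measurable]: "g \<in> borel_measurable LM"
    unfolding g_def by measurable
  have dist: "Lp_norm p (\<lambda>x. f (k + j) x - f k x) \<le> 2 * (1/2)^k" for k j
  proof -
    have "Lp_norm p (\<lambda>x. f (k + j) x - f k x) \<le> 2 * (1/2)^k - 2 * (1/2)^(k+j)"
    proof (induction j)
      case 0
      then show ?case by (simp add: Lp_norm_zero)
    next
      case (Suc j)
      have "Lp_norm p (\<lambda>x. f (k + Suc j) x - f k x) \<le> Lp_norm p (\<lambda>x. f (Suc (k + j)) x - f (k+j) x) + Lp_norm p (\<lambda>x. f (k + j) x - f k x)"
        using Lp_norm_dist_triangle[OF p' f f f, of "k + Suc j" k "k+j"] by simp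
      with d[of "k+j"] Suc show ?case by simp
    qed
    then show ?thesis by (rule order_trans) simp
  qed
  have Fatou: "(\<integral>\<^sup>+x. ennreal (\<bar>f k x - g x\<bar> powr p) \<partial>LM) \<le> ennreal ((2 * (1/2)^k) powr p)" for k
  proof -
    have "(\<integral>\<^sup>+x. ennreal (\<bar>f k x - g x\<bar> powr p) \<partial>LM) = (\<integral>\<^sup>+x. liminf (\<lambda>j. ennreal (\<bar>f (k+j) x - f k x\<bar> powr p)) \<partial>LM)"
    proof (rule nn_integral_cong_AE)
      show "AE x in LM. ennreal (\<bar>f k x - g x\<bar> powr p) = liminf (\<lambda>j. ennreal (\<bar>f (k+j) x - f k x\<bar> powr p))"
        using lim
      proof eventually_elim
        case (elim x)
        then have "(\<lambda>j. f (j+k) x) \<longlonglongrightarrow> g x" unfolding g_def by (rule LIMSEQ_ignore_initial_segment)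
        then have "(\<lambda>j. f (k+j) x) \<longlonglongrightarrow> g x" by (simp add: add.commute)
        then have "(\<lambda>j. \<bar>f (k+j) x - f k x\<bar> powr p) \<longlonglongrightarrow> \<bar>g x - f k x\<bar> powr p"
          using p by (intro tendsto_powr2 tendsto_intros) auto
        then have "(\<lambda>j. ennreal (\<bar>f (k+j) x - f k x\<bar> powr p)) \<longlonglongrightarrow> ennreal (\<bar>f k x - g x\<bar> powr p)"
          by (simp add: abs_minus_commute)
        then show ?case by (rule lim_imp_Liminf[symmetric, rotated]) simp
      qed
    qed
    also have "\<dots> \<le> liminf (\<lambda>j. \<integral>\<^sup>+x. ennreal (\<bar>f (k+j) x - f k x\<bar> powr p) \<partial>LM)"
      by (rule nn_integral_liminf) auto
    also have "\<dots> \<le> liminf (\<lambda>j::nat. ennreal ((2 * (1/2)^k) powr p))"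
    proof (intro Liminf_mono always_eventually allI)
      fix j
      have "in_Lp p (\<lambda>x. f (k+j) x - f k x)" by (rule in_Lp_diff[OF p' f f])
      then have "(\<integral>\<^sup>+x. ennreal (\<bar>f (k+j) x - f k x\<bar> powr p) \<partial>LM) = ennreal (\<integral>x. \<bar>f (k+j) x - f k x\<bar> powr p \<partial>LM)"
        by (intro nn_integral_eq_integral) (auto simp: in_Lp_def)
      then show "(\<integral>\<^sup>+x. ennreal (\<bar>f (k+j) x - f k x\<bar> powr p) \<partial>LM) \<le> ennreal ((2 * (1/2)^k) powr p)"
        using integral_powr_le[OF p' dist[of k j]] by (simp add: ennreal_leI)
    qed
    also have "\<dots> = ennreal ((2 * (1/2)^k) powr p)"
      by (simp add: Liminf_const)
    finally show ?thesis .
  qed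
  have fg: "in_Lp p (\<lambda>x. f k x - g x)" for k
    unfolding in_Lp_def using Fatou[of k]
    by (auto intro!: integrableI_bounded simp: less_top[symmetric] top_unique)
  have fgn: "Lp_norm p (\<lambda>x. f k x - g x) \<le> 2 * (1/2)^k" for k
  proof (rule Lp_norm_leI[OF p'])
    have "ennreal (\<integral>x. \<bar>f k x - g x\<bar> powr p \<partial>LM) \<le> ennreal ((2 * (1/2)^k) powr p)"
      using Fatou[of k] fg[of k] by (subst (asm) nn_integral_eq_integral) (auto simp: in_Lp_def)
    then show "(\<integral>x. \<bar>f k x - g x\<bar> powr p \<partial>LM) \<le> (2 * (1/2)^k) powr p"
      by (simp add: ennreal_le_iff)
  qed simp
  have "in_Lp p g" using in_Lp_diff[OF p' f[of 0] fg[of 0]] by simp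
  moreover have "(\<lambda>k. Lp_norm p (\<lambda>x. f k x - g x)) \<longlonglongrightarrow> 0"
  proof (rule tendsto_sandwich[OF _ _ tendsto_const])
    show "(\<lambda>k. 2 * (1/2)^k) \<longlonglongrightarrow> (0::real)"
      by (intro tendsto_mult_right_zero LIMSEQ_power_zero) simp
  qed (auto simp: fgn Lp_norm_nonneg)
  ultimately show ?thesis by blast
qed

lemma Lp_complete:
  assumes p: "1 < p" and f: "\<And>k. in_Lp p (f k)"
    and cauchy: "\<And>e. e > 0 \<Longrightarrow> \<exists>K. \<forall>k\<ge>K. \<forall>j\<ge>K. Lp_norm p (\<lambda>x. f k x - f j x) < e"
  shows "\<exists>g. in_Lp p g \<and> (\<lambda>k. Lp_norm p (\<lambda>x. f k x - g x)) \<longlonglongrightarrow> 0"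
proof -
  have p': "1 \<le> p" using p by simp
  have "\<forall>i. \<exists>K. \<forall>k\<ge>K. \<forall>j\<ge>K. Lp_norm p (\<lambda>x. f k x - f j x) < (1/2)^i"
    using cauchy by auto
  then obtain K where K: "\<And>i k j. k \<ge> K i \<Longrightarrow> j \<ge> K i \<Longrightarrow> Lp_norm p (\<lambda>x. f k x - f j x) < (1/2)^i"
    by metis
  \<comment> \<open>Partial sums give indices that increase and still satisfy r i \<ge> K i.\<close>
  define r where "r i = (\<Sum>j\<le>i. K j)" for i
  have r: "K i \<le> r i" "r i \<le> r (Suc i)" for i
    unfolding r_def by (auto intro: member_le_sum)
  have "\<exists>g. in_Lp p g \<and> (\<lambda>k. Lp_norm p (\<lambda>x. f (r k) x - g x)) \<longlonglongrightarrow> 0"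
    using r K by (intro Lp_complete_aux p f less_imp_le) (meson order_trans)
  then obtain g where g: "in_Lp p g" "(\<lambda>k. Lp_norm p (\<lambda>x. f (r k) x - g x)) \<longlonglongrightarrow> 0" by blast
  have "(\<lambda>k. Lp_norm p (\<lambda>x. f k x - g x)) \<longlonglongrightarrow> 0"
  proof (rule LIMSEQ_I)
    fix e :: real assume e: "e > 0"
    obtain i0 where i0: "(1/2)^i0 < e/2" using e real_arch_pow_inv[of "e/2" "1/2"] by auto
    obtain i1 where i1: "\<And>i. i \<ge> i1 \<Longrightarrow> Lp_norm p (\<lambda>x. f (r i) x - g x) < e/2"
      using LIMSEQ_D[OF g(2), of "e/2"] e by (auto simp: Lp_norm_nonneg)
    have "Lp_norm p (\<lambda>x. f k x - g x) < e" if "k \<ge> K i0" for k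
    proof -
      define i where "i = max i0 i1"
      have "r i0 \<le> r i" unfolding r_def i_def by (intro sum_mono2) auto
      then have "r i \<ge> K i0" using r(1)[of i0] by simp
      then have "Lp_norm p (\<lambda>x. f k x - f (r i) x) < (1/2)^i0" using K that by blast
      moreover have "Lp_norm p (\<lambda>x. f k x - g x) \<le> Lp_norm p (\<lambda>x. f k x - f (r i) x) + Lp_norm p (\<lambda>x. f (r i) x - g x)"
        by (rule Lp_norm_dist_triangle[OF p' f f g(1)])
      ultimately show ?thesis using i0 i1[of i] by (simp add: i_def)
    qed
    then show "\<exists>no. \<forall>n\<ge>no. norm (Lp_norm p (\<lambda>x. f n x - g x) - 0) < e"
      by (auto simp: Lp_norm_nonneg)
  qed
  with g show ?thesis by blast
qed

section \<open>Haar functions on the leaves of a dyadic tree\<close>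

definition nodes :: "nat \<Rightarrow> (nat \<times> nat) set" where
  "nodes N = (SIGMA k:{..<N}. {1..2^k})"

text \<open>The sign of the binary digit number k of the leaf, counted from the most significant
  digit; the value 1 stands for the left half, where Haar functions are positive.\<close>

definition leaf_bit :: "nat \<Rightarrow> nat \<Rightarrow> nat \<Rightarrow> real" where
  "leaf_bit N k y = (if even (y div 2 ^ (N - Suc k)) then 1 else - 1)"

text \<open>Leaves \<open>y < 2 ^ N\<close> are counted from 0, whereas the second component of a node counts from 1.\<close>
definition leaf_node :: "nat \<Rightarrow> nat \<Rightarrow> nat \<Rightarrow> nat \<times> nat" where
  "leaf_node N k y = (k, Suc (y div 2 ^ (N - k)))"

definition leaf_haar :: "nat \<Rightarrow> nat \<times> nat \<Rightarrow> nat \<Rightarrow> real" where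
  "leaf_haar N J y = (if leaf_node N (fst J) y = J then leaf_bit N (fst J) y else 0)"

definition leaf_avg :: "nat \<Rightarrow> (nat \<Rightarrow> real) \<Rightarrow> real" where
  "leaf_avg N F = (\<Sum>y<2^N. F y) / 2 ^ N"

definition node_len :: "nat \<times> nat \<Rightarrow> real" where
  "node_len J = 1 / 2 ^ fst J"

lemma finite_nodes [simp]: "finite (nodes N)"
  by (simp add: nodes_def)

lemma fst_leaf_node [simp]: "fst (leaf_node N k y) = k"
  by (simp add: leaf_node_def)

lemma abs_leaf_bit [simp]: "\<bar>leaf_bit N k y\<bar> = 1"
  by (simp add: leaf_bit_def)

lemma div_two_power_diff:
  assumes "k < N"
  shows "(y::nat) div 2 ^ (N - k) = (y div 2 ^ (N - Suc k)) div 2"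
proof -
  have "N - k = Suc (N - Suc k)" using assms by simp
  then show ?thesis by (metis div_mult2_eq power_Suc2)
qed

lemma leaf_node_in_nodes:
  assumes "k < N" "y < 2 ^ N"
  shows "leaf_node N k y \<in> nodes N"
proof -
  have "y < 2 ^ k * 2 ^ (N - k)" using assms by (simp flip: power_add)
  then have "y div 2 ^ (N - k) < 2 ^ k" by (simp add: less_mult_imp_div_less)
  then show ?thesis using assms by (simp add: nodes_def leaf_node_def)
qed

lemma nodes_cases_leaf:
  assumes "J \<in> nodes N"
  obtains y where "y < 2 ^ N" "leaf_node N (fst J) y = J"
proof -
  obtain k i where J: "J = (k,i)" "k < N" "1 \<le> i" "i \<le> 2 ^ k" using assms by (auto simp: nodes_def)
  have "(i - 1) * 2 ^ (N - k) < 2 ^ k * 2 ^ (N - k)" using J by simp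
  also have "\<dots> = 2 ^ N" using J by (simp flip: power_add)
  finally show ?thesis using J by (intro that[of "(i - 1) * 2 ^ (N-k)"]) (auto simp: leaf_node_def)
qed

text \<open>With \<open>e k\<close> the indicator that \<open>y\<close> and \<open>z\<close> agree on level \<open>k\<close>, the level \<open>k\<close> summand
  is \<open>2 ^ Suc k * e (Suc k) - 2 ^ k * e k\<close>, and the sum telescopes.\<close>
lemma leaf_haar_kernel:
  assumes "y < 2 ^ N" "z < 2 ^ N"
  shows "(\<Sum>J\<in>nodes N. 2 ^ fst J * (leaf_haar N J y * leaf_haar N J z)) = (if y = z then 2 ^ N else 0) - 1"
proof -
  define e :: "nat \<Rightarrow> real" where "e k = (if y div 2 ^ (N - k) = z div 2 ^ (N - k) then 1 else 0)" for k
  have lev: "(\<Sum>i\<in>{1..2^k}. 2 ^ k * (leaf_haar N (k,i) y * leaf_haar N (k,i) z)) = 2 ^ Suc k * e (Suc k) - 2 ^ k * e k"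
    if k: "k < N" for k
  proof -
    have "(\<Sum>i\<in>{1..2^k}. 2 ^ k * (leaf_haar N (k,i) y * leaf_haar N (k,i) z))
      = (\<Sum>i\<in>{1..2^k}. if i = Suc (y div 2 ^ (N - k)) then 2 ^ k * (e k * (leaf_bit N k y * leaf_bit N k z)) else 0)"
      by (intro sum.cong) (auto simp: leaf_haar_def leaf_node_def e_def)
    also have "\<dots> = 2 ^ k * (e k * (leaf_bit N k y * leaf_bit N k z))"
      using leaf_node_in_nodes[OF k assms(1)] by (auto simp: leaf_node_def nodes_def)
    also have "e k * (leaf_bit N k y * leaf_bit N k z) = 2 * e (Suc k) - e k"
    proof -
      have eq: "a = b \<longleftrightarrow> a div 2 = b div 2 \<and> (even a \<longleftrightarrow> even b)" for a b :: nat
        by presburger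
      show ?thesis
        unfolding e_def div_two_power_diff[OF k] leaf_bit_def
          eq[of "y div 2 ^ (N - Suc k)" "z div 2 ^ (N - Suc k)"]
        by simp
    qed
    finally show ?thesis by (simp add: algebra_simps)
  qed
  have "(\<Sum>J\<in>nodes N. 2 ^ fst J * (leaf_haar N J y * leaf_haar N J z)) =
     (\<Sum>k<N. \<Sum>i\<in>{1..2^k}. 2 ^ k * (leaf_haar N (k,i) y * leaf_haar N (k,i) z))"
    unfolding nodes_def by (subst sum.Sigma) (auto simp: split_beta)
  also have "\<dots> = (\<Sum>k<N. 2 ^ Suc k * e (Suc k) - 2 ^ k * e k)"
    by (intro sum.cong lev) auto
  also have "\<dots> = 2 ^ N * e N - 2 ^ 0 * e 0"
    by (rule sum_lessThan_telescope)
  also have "\<dots> = (if y = z then 2 ^ N else 0) - 1"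
    using assms by (simp add: e_def)
  finally show ?thesis .
qed

text \<open>By \<open>leaf_haar_kernel\<close> the normalised Haar functions resolve the identity
  minus the mean, so they reproduce every function of mean zero.\<close>

lemma leaf_haar_expansion:
  assumes y: "y < 2 ^ N" and F: "leaf_avg N F = 0"
  shows "F y = (\<Sum>J\<in>nodes N. leaf_avg N (\<lambda>z. leaf_haar N J z * F z) / node_len J * leaf_haar N J y)"
proof -
  have "(\<Sum>J\<in>nodes N. leaf_avg N (\<lambda>z. leaf_haar N J z * F z) / node_len J * leaf_haar N J y)
    = (\<Sum>J\<in>nodes N. \<Sum>z<2^N. F z * (2 ^ fst J * (leaf_haar N J y * leaf_haar N J z)) / 2 ^ N)"
    by (simp add: leaf_avg_def node_len_def sum_distrib_left sum_distrib_right sum_divide_distrib mult_ac)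
  also have "\<dots> = (\<Sum>z<2^N. F z * (\<Sum>J\<in>nodes N. 2 ^ fst J * (leaf_haar N J y * leaf_haar N J z)) / 2 ^ N)"
    by (subst sum.swap) (simp add: sum_distrib_left sum_divide_distrib)
  also have "\<dots> = (\<Sum>z<2^N. (if z = y then F z else 0) - F z / 2 ^ N)"
    using y by (intro sum.cong refl) (simp add: leaf_haar_kernel, auto simp: field_simps)
  also have "\<dots> = F y - leaf_avg N F"
    using y by (simp add: sum_subtractf leaf_avg_def sum_divide_distrib)
  finally show ?thesis using F by simp
qed

text \<open>For different leaves the kernel is -1, whereas equal Haar values would make it 2 ^ N -
  1. This lets a leaf be recognised from the values of the Haar functions.\<close>

lemma leaf_haar_inj:
  assumes "y < 2 ^ N" "z < 2 ^ N" "\<And>J. J \<in> nodes N \<Longrightarrow> leaf_haar N J y = leaf_haar N J z"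
  shows "y = z"
proof -
  have "(\<Sum>J\<in>nodes N. 2 ^ fst J * (leaf_haar N J y * leaf_haar N J z)) = (\<Sum>J\<in>nodes N. 2 ^ fst J * (leaf_haar N J y * leaf_haar N J y))"
    using assms(3) by (intro sum.cong) auto
  then show ?thesis using leaf_haar_kernel[OF assms(1,2)] leaf_haar_kernel[OF assms(1,1)] by (simp split: if_splits)
qed

section \<open>Sums over leaves, split by binary digits\<close>

lemma bij_betw_two_div_mod: "bij_betw (\<lambda>y. (y div 2^m, y mod 2^m)) {..<(2::nat)^(k+m)} ({..<2^k} \<times> {..<2^m})"
proof (rule bij_betwI[where g = "\<lambda>(a,b). a * 2^m + b"])
  show "(\<lambda>y. (y div 2^m, y mod 2^m)) \<in> {..<(2::nat)^(k+m)} \<rightarrow> {..<2^k} \<times> {..<2^m}"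
    by (auto simp: power_add less_mult_imp_div_less)
  show "(\<lambda>(a,b). a * 2^m + b) \<in> {..<(2::nat)^k} \<times> {..<2^m} \<rightarrow> {..<2^(k+m)}"
  proof (clarsimp simp: power_add)
    fix a b :: nat assume "a < 2^k" "b < 2^m"
    then have "a * 2^m + b < (a + 1) * 2^m" "(a + 1) * 2^m \<le> 2^k * 2^m"
      by (auto simp: algebra_simps) (metis Suc_leI mult_Suc mult_le_mono1 add.commute mult.commute)
    then show "a * 2^m + b < 2^k * 2^m" by linarith
  qed
qed (auto simp: div_mult_mod_eq)

lemma sum_two_div_mod: "(\<Sum>y<2^(k+m). f (y div 2^m) (y mod 2^m)) = (\<Sum>a<2^k. \<Sum>b<(2::nat)^m. f a b)"
  using sum.reindex_bij_betw[OF bij_betw_two_div_mod[of m k], of "\<lambda>(a,b). f a b"]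
  by (simp add: sum.cartesian_product)

lemma sum_two_halves: "(\<Sum>a<2^Suc k. g (a div 2) (even a)) = (\<Sum>a<(2::nat)^k. g a True + g a False)"
  for g :: "nat \<Rightarrow> bool \<Rightarrow> real"
proof -
  have 2: "{..<2::nat} = {0,1}" by auto
  have "(\<Sum>a<2^(k+1). g (a div 2^1) (even (a mod 2^1))) = (\<Sum>a<2^k. \<Sum>b<(2::nat)^1. g a (even b))"
    by (rule sum_two_div_mod)
  then show ?thesis by (simp add: 2 dvd_mod_iff)
qed

lemma leaf_avg_haar_node:
  assumes J: "J \<in> nodes N"
  shows "leaf_avg N (\<lambda>y. \<bar>leaf_haar N J y\<bar>) = node_len J" "leaf_avg N (leaf_haar N J) = 0"
proof -
  obtain k i where Ji: "J = (k,i)" "k < N" "1 \<le> i" "i \<le> 2 ^ k" using J by (auto simp: nodes_def)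
  define m where "m = N - Suc k"
  have N: "N = Suc k + m" using Ji by (simp add: m_def)
  have H: "leaf_haar N J y = (if Suc ((y div 2^m) div 2) = i then (if even (y div 2^m) then 1 else -1) else 0)" for y
    using Ji div_two_power_diff[OF Ji(2), of y] by (auto simp: leaf_haar_def leaf_node_def leaf_bit_def m_def)
  note two = sum_two_halves[where k=k]
  have one: "(\<Sum>a<(2::nat)^k. if Suc a = i then c else 0) = (c::real)" for c
  proof -
    have "(\<Sum>a<(2::nat)^k. if Suc a = i then c else 0) = (\<Sum>a<(2::nat)^k. if a = i - 1 then c else 0)"
      using Ji by (intro sum.cong) auto
    also have "\<dots> = c" using Ji by (subst sum.delta) (auto simp: less_eq_Suc_le)
    finally show ?thesis .
  qed
  have "(\<Sum>y<2^N. leaf_haar N J y) = (\<Sum>a<2^Suc k. \<Sum>b<(2::nat)^m. if Suc (a div 2) = i then (if even a then 1 else -1) else 0)"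
    unfolding N H[unfolded N] by (rule sum_two_div_mod)
  also have "\<dots> = 2^m * (\<Sum>a<2^Suc k. if Suc (a div 2) = i then (if even a then 1 else -1) else 0)"
    by (simp add: sum_distrib_left)
  also have "(\<Sum>a<2^Suc k. if Suc (a div 2) = i then (if even a then 1 else -1) else 0) = (0::real)"
    by (rule trans[OF two[of "\<lambda>a b. if Suc a = i then if b then 1 else -1 else 0"]]) (auto intro!: sum.neutral)
  finally show "leaf_avg N (leaf_haar N J) = 0" by (simp add: leaf_avg_def)
  have "(\<Sum>y<2^N. \<bar>leaf_haar N J y\<bar>) = (\<Sum>a<2^Suc k. \<Sum>b<(2::nat)^m. if Suc (a div 2) = i then 1 else 0)"
    unfolding N H[unfolded N]
    by (subst sum_two_div_mod[where k="Suc k" and m=m, symmetric]) (auto intro!: sum.cong)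
  also have "\<dots> = 2^m * (\<Sum>a<2^Suc k. if Suc (a div 2) = i then 1 else 0)"
    by (simp add: sum_distrib_left)
  also have "(\<Sum>a<2^Suc k. if Suc (a div 2) = i then 1 else 0) = (2::real)"
    by (rule trans[OF two[of "\<lambda>a _. if Suc a = i then 1 else 0"]]) (simp add: one flip: sum_distrib_left)
  finally show "leaf_avg N (\<lambda>y. \<bar>leaf_haar N J y\<bar>) = node_len J"
    by (simp add: leaf_avg_def node_len_def Ji N power_add)
qed

lemma leaf_avg_add: "leaf_avg N (\<lambda>y. F y + G y) = leaf_avg N F + leaf_avg N G"
  by (simp add: leaf_avg_def sum.distrib add_divide_distrib)

lemma leaf_avg_mult: "leaf_avg N (\<lambda>y. c * F y) = c * leaf_avg N F"
  by (simp add: leaf_avg_def sum_distrib_left)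

lemma leaf_avg_sum: "leaf_avg N (\<lambda>y. \<Sum>i\<in>S. F i y) = (\<Sum>i\<in>S. leaf_avg N (F i))"
  by (simp add: leaf_avg_def sum_divide_distrib sum.swap[where A=S])

lemma leaf_avg_cong: "(\<And>y. y < 2 ^ N \<Longrightarrow> F y = G y) \<Longrightarrow> leaf_avg N F = leaf_avg N G"
  by (auto simp: leaf_avg_def intro!: sum.cong)

lemma leaf_avg_mono: "(\<And>y. y < 2 ^ N \<Longrightarrow> F y \<le> G y) \<Longrightarrow> leaf_avg N F \<le> leaf_avg N G"
  by (auto simp: leaf_avg_def intro!: divide_right_mono sum_mono)

lemma abs_leaf_avg_le: "\<bar>leaf_avg N F\<bar> \<le> leaf_avg N (\<lambda>y. \<bar>F y\<bar>)"
  by (auto simp: leaf_avg_def intro!: divide_right_mono sum_abs)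

lemma leaf_avg_const [simp]: "leaf_avg N (\<lambda>y. c) = c"
  by (simp add: leaf_avg_def)

section \<open>Kernels of random binary paths\<close>

text \<open>Given the leaf \<open>y\<close>, this is the probability of the binary path \<open>a\<close> of length \<open>k\<close> when step \<open>i\<close>
  of the path is 0 with probability \<open>(1 + w i y) / 2\<close>.\<close>
fun ker :: "(nat \<Rightarrow> nat \<Rightarrow> real) \<Rightarrow> nat \<Rightarrow> nat \<Rightarrow> nat \<Rightarrow> real" where
  "ker w 0 y a = 1"
| "ker w (Suc k) y a = ker w k y (a div 2) * ((1 + w k y * (if even a then 1 else - 1)) / 2)"

lemma ker_bounds:
  assumes "\<And>i. i < k \<Longrightarrow> \<bar>w i y\<bar> \<le> 1"
  shows "0 \<le> ker w k y a \<and> ker w k y a \<le> 1"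
  using assms
proof (induction k arbitrary: a)
  case (Suc k)
  have "\<bar>w k y\<bar> \<le> 1" using Suc.prems by simp
  then have *: "0 \<le> (1 + w k y * (if even a then 1 else - 1)) / 2" "(1 + w k y * (if even a then 1 else - 1)) / 2 \<le> 1"
    by (auto simp: abs_le_iff)
  have "0 \<le> ker w k y (a div 2)" "ker w k y (a div 2) \<le> 1" using Suc by auto
  then show ?case using * by (simp only: ker.simps) (intro conjI mult_nonneg_nonneg mult_le_one; simp)
qed simp

lemma ker_cong:
  assumes "\<And>i. i < k \<Longrightarrow> w i y = w' i z"
  shows "ker w k y a = ker w' k z a"
  using assms by (induction k arbitrary: a) auto

lemma ker_split: "ker w (Suc k) y a = (\<lambda>a' b. ker w k y a' * ((1 + w k y * (if b then 1 else - 1)) / 2)) (a div 2) (even a)"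
  by simp

lemma ker_row_sum: "(\<Sum>a<2^k. ker w k y a) = 1"
proof (induction k)
  case (Suc k)
  have "(\<Sum>a<2^Suc k. ker w (Suc k) y a) = (\<Sum>a<2^k. ker w k y a)"
    unfolding ker_split by (subst sum_two_halves) (simp add: field_simps)
  then show ?case using Suc by simp
qed simp

text \<open>This is the mean of a Haar function at the end of the random path. The path has to reach
  the node, which has probability \<open>ker w k y a\<close>; its next step then has mean sign
  \<open>w k y\<close>, and all later steps average out.\<close>

lemma ker_haar:
  assumes "k < n" "a < 2 ^ k"
  shows "(\<Sum>v<2^n. ker w n y v * leaf_haar n (k, Suc a) v) = ker w k y a * w k y"
  using assms
proof (induction n)
  case (Suc n)
  show ?case
  proof (cases "k = n")
    case True
    have H: "leaf_haar (Suc n) (k, Suc a) v = (if v div 2 = a then if even v then 1 else - 1 else 0)" for v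
      using True by (auto simp: leaf_haar_def leaf_node_def leaf_bit_def)
    have "(\<Sum>v<2^Suc n. ker w (Suc n) y v * leaf_haar (Suc n) (k, Suc a) v)
      = (\<Sum>v<2^n. ker w n y v * ((1 + w n y) / 2) * (if v = a then 1 else 0) + ker w n y v * ((1 - w n y) / 2) * (if v = a then - 1 else 0))"
      unfolding H
      using sum_two_halves[where k=n and g = "\<lambda>a' b. ker w n y a' * ((1 + w n y * (if b then 1 else - 1)) / 2) * (if a' = a then if b then 1 else - 1 else 0)"]
      by simp
    also have "\<dots> = (\<Sum>v<2^n. if v = a then ker w n y v * w n y else 0)"
      by (intro sum.cong) (auto simp: field_simps)
    also have "\<dots> = ker w k y a * w k y" using Suc.prems True by simp
    finally show ?thesis .
  next
    \<comment> \<open>The last step lies strictly below level k, so its two probabilities simply add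
      up to 1.\<close>
    case False
    then have k: "k < n" using Suc by simp
    have H: "leaf_haar (Suc n) (k, Suc a) v = leaf_haar n (k, Suc a) (v div 2)" for v
    proof -
      have "v div 2 ^ (Suc n - k) = v div 2 div 2 ^ (n - k)" "v div 2 ^ (Suc n - Suc k) = v div 2 div 2 ^ (n - Suc k)"
        using k by (auto simp: Suc_diff_le Suc_diff_Suc simp flip: div_mult2_eq power_Suc)
      then show ?thesis by (simp add: leaf_haar_def leaf_node_def leaf_bit_def)
    qed
    have "(\<Sum>v<2^Suc n. ker w (Suc n) y v * leaf_haar (Suc n) (k, Suc a) v) = (\<Sum>v<2^n. ker w n y v * leaf_haar n (k, Suc a) v)"
      unfolding H
      using sum_two_halves[where k=n and g = "\<lambda>a' b. ker w n y a' * ((1 + w n y * (if b then 1 else - 1)) / 2) * leaf_haar n (k, Suc a) a'"]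
      by (simp add: field_simps)
    then show ?thesis using Suc.IH k Suc.prems by simp
  qed
qed simp

text \<open>Appending a step halves the column average, up to a multiple of the mean of ker times w.
  That mean vanishes because w is a martingale difference along every path. With
  \<open>ker_row_sum\<close> this makes the kernel doubly stochastic.\<close>

lemma ker_column_avg:
  assumes "\<And>k a. k < n \<Longrightarrow> a < 2 ^ k \<Longrightarrow> leaf_avg N (\<lambda>y. ker w k y a * w k y) = 0" "v < 2 ^ n"
  shows "leaf_avg N (\<lambda>y. ker w n y v) = 1 / 2 ^ n"
  using assms
proof (induction n arbitrary: v)
  case (Suc n)
  have v: "v div 2 < 2 ^ n" using Suc.prems(2) by (simp add: less_mult_imp_div_less)
  have "leaf_avg N (\<lambda>y. ker w (Suc n) y v) =
    leaf_avg N (\<lambda>y. 1/2 * ker w n y (v div 2) + (if even v then 1/2 else -1/2) * (ker w n y (v div 2) * w n y))"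
    by (intro leaf_avg_cong) (auto simp: field_simps)
  also have "\<dots> = 1/2 * leaf_avg N (\<lambda>y. ker w n y (v div 2)) + (if even v then 1/2 else -1/2) * leaf_avg N (\<lambda>y. ker w n y (v div 2) * w n y)"
    by (simp only: leaf_avg_add leaf_avg_mult)
  also have "leaf_avg N (\<lambda>y. ker w n y (v div 2)) = 1 / 2 ^ n"
    using Suc v by simp
  also have "leaf_avg N (\<lambda>y. ker w n y (v div 2) * w n y) = 0"
    using Suc.prems v by simp
  finally show ?case by simp
qed simp

text \<open>If all steps are certain, the path is deterministic and the kernel is the indicator of
  that path. This and \<open>ker_orth\<close> are the two algebraic consequences.\<close>

lemma ker_idem:
  assumes "\<And>i. i < k \<Longrightarrow> \<bar>w i y\<bar> = 1"
  shows "ker w k y a * ker w k y a = ker w k y a"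
  using assms
proof (induction k arbitrary: a)
  case (Suc k)
  have "w k y = 1 \<or> w k y = -1" using Suc.prems[of k] by auto
  moreover have "ker w k y (a div 2) * ker w k y (a div 2) = ker w k y (a div 2)" using Suc by simp
  ultimately show ?case by auto
qed simp

lemma ker_orth:
  assumes "\<And>i. i < k \<Longrightarrow> \<bar>w i y\<bar> = 1" "a < 2 ^ k" "b < 2 ^ k" "a \<noteq> b"
  shows "ker w k y a * ker w k y b = 0"
  using assms
proof (induction k arbitrary: a b)
  case (Suc k)
  have w: "w k y = 1 \<or> w k y = -1" using Suc.prems(1)[of k] by auto
  show ?case
  proof (cases "a div 2 = b div 2")
    case True
    then have "even a \<noteq> even b" using Suc.prems(4) by presburger
    then show ?thesis using w by auto
  next
    case False
    then have "ker w k y (a div 2) * ker w k y (b div 2) = 0"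
      using Suc by (intro Suc.IH) (auto simp: less_mult_imp_div_less)
    then show ?thesis by auto
  qed
qed simp

text \<open>The second moment bound for quadratic forms in random signs, simultaneously for all
  forms in A. It is derandomised: one sign is fixed at a time, and the better of its two values
  keeps the bound. The factor 2 comes from (x + y)^2 \<le> 2 (x^2 + y^2), since (J, K) and (K, J)
  carry the same product of signs.\<close>

lemma exists_signs:
  fixes c :: "'i \<Rightarrow> real" and l :: "'i \<Rightarrow> 'a \<Rightarrow> real" and m :: "'i \<Rightarrow> 'a \<Rightarrow> 'a \<Rightarrow> real"
  assumes "finite G" "finite A"
  shows "\<exists>\<epsilon>. (\<forall>J. \<epsilon> J = 1 \<or> \<epsilon> J = (-1::real)) \<and>
    (\<Sum>\<alpha>\<in>A. (c \<alpha> + (\<Sum>J\<in>G. l \<alpha> J * \<epsilon> J) + (\<Sum>J\<in>G. \<Sum>K\<in>G - {J}. m \<alpha> J K * (\<epsilon> J * \<epsilon> K)))\<^sup>2)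
    \<le> (\<Sum>\<alpha>\<in>A. (c \<alpha>)\<^sup>2 + (\<Sum>J\<in>G. (l \<alpha> J)\<^sup>2) + 2 * (\<Sum>J\<in>G. \<Sum>K\<in>G - {J}. (m \<alpha> J K)\<^sup>2))"
  using assms(1)
proof (induction G arbitrary: c l rule: finite_induct)
  case empty
  then show ?case by (intro exI[of _ "\<lambda>_. 1"]) simp
next
  case (insert j G)
  have split: "(\<Sum>J\<in>insert j G. \<Sum>K\<in>insert j G - {J}. f J K) =
    (\<Sum>K\<in>G. f j K + f K j) + (\<Sum>J\<in>G. \<Sum>K\<in>G - {J}. f J K)" for f :: "'a \<Rightarrow> 'a \<Rightarrow> real"
  proof -
    have "insert j G - {J} = insert j (G - {J})" if "J \<in> G" for J using insert that by auto
    then have "(\<Sum>J\<in>G. \<Sum>K\<in>insert j G - {J}. f J K) = (\<Sum>J\<in>G. f J j + (\<Sum>K\<in>G - {J}. f J K))"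
      using insert by (intro sum.cong refl) simp
    then show ?thesis using insert by (simp add: sum.distrib)
  qed
  define Q where "Q = (\<Sum>\<alpha>\<in>A. 2 * (\<Sum>J\<in>G. \<Sum>K\<in>G - {J}. (m \<alpha> J K)\<^sup>2))"
  \<comment> \<open>Giving j the sign s leaves a form on G with the constant c' and the linear
    coefficients l'. R s is the part of its bound that depends on s; the mean of R 1 and R (-1) is
    small enough.\<close>
  define c' where "c' s \<alpha> = c \<alpha> + s * l \<alpha> j" for s :: real and \<alpha>
  define l' where "l' s \<alpha> K = l \<alpha> K + s * (m \<alpha> j K + m \<alpha> K j)" for s :: real and \<alpha> K
  define R where "R s = (\<Sum>\<alpha>\<in>A. (c' s \<alpha>)\<^sup>2 + (\<Sum>J\<in>G. (l' s \<alpha> J)\<^sup>2))" for s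
  have "R 1 + R (-1) = (\<Sum>\<alpha>\<in>A. 2 * ((c \<alpha>)\<^sup>2 + (l \<alpha> j)\<^sup>2) + (\<Sum>J\<in>G. 2 * ((l \<alpha> J)\<^sup>2 + (m \<alpha> j J + m \<alpha> J j)\<^sup>2)))"
    unfolding R_def sum.distrib[symmetric]
  proof (intro sum.cong refl)
    fix \<alpha>
    have "(\<Sum>J\<in>G. (l' 1 \<alpha> J)\<^sup>2) + (\<Sum>J\<in>G. (l' (-1) \<alpha> J)\<^sup>2) = (\<Sum>J\<in>G. 2 * ((l \<alpha> J)\<^sup>2 + (m \<alpha> j J + m \<alpha> J j)\<^sup>2))"
      unfolding sum.distrib[symmetric] by (intro sum.cong) (auto simp: l'_def power2_eq_square algebra_simps)
    moreover have "(c' 1 \<alpha>)\<^sup>2 + (c' (-1) \<alpha>)\<^sup>2 = 2 * ((c \<alpha>)\<^sup>2 + (l \<alpha> j)\<^sup>2)"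
      by (simp add: c'_def power2_eq_square algebra_simps)
    ultimately show "(c' 1 \<alpha>)\<^sup>2 + (\<Sum>J\<in>G. (l' 1 \<alpha> J)\<^sup>2) + ((c' (-1) \<alpha>)\<^sup>2 + (\<Sum>J\<in>G. (l' (-1) \<alpha> J)\<^sup>2)) =
      2 * ((c \<alpha>)\<^sup>2 + (l \<alpha> j)\<^sup>2) + (\<Sum>J\<in>G. 2 * ((l \<alpha> J)\<^sup>2 + (m \<alpha> j J + m \<alpha> J j)\<^sup>2))"
      by linarith
  qed
  also have "\<dots> \<le> (\<Sum>\<alpha>\<in>A. 2 * ((c \<alpha>)\<^sup>2 + (l \<alpha> j)\<^sup>2) + (\<Sum>J\<in>G. 2 * ((l \<alpha> J)\<^sup>2 + 2 * ((m \<alpha> j J)\<^sup>2 + (m \<alpha> J j)\<^sup>2))))"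
  proof (intro sum_mono add_mono mult_left_mono order_refl)
    fix \<alpha> J
    have "0 \<le> (m \<alpha> j J - m \<alpha> J j)\<^sup>2" by simp
    then show "(m \<alpha> j J + m \<alpha> J j)\<^sup>2 \<le> 2 * ((m \<alpha> j J)\<^sup>2 + (m \<alpha> J j)\<^sup>2)"
      unfolding power2_eq_square by (simp add: algebra_simps)
  qed auto
  also have "\<dots> = 2 * (\<Sum>\<alpha>\<in>A. (c \<alpha>)\<^sup>2 + ((l \<alpha> j)\<^sup>2 + (\<Sum>J\<in>G. (l \<alpha> J)\<^sup>2)) + 2 * (\<Sum>J\<in>G. (m \<alpha> j J)\<^sup>2 + (m \<alpha> J j)\<^sup>2))"
    by (simp add: sum_distrib_left sum.distrib algebra_simps)
  finally have R: "\<exists>s\<in>{1,-1}. R s \<le> (\<Sum>\<alpha>\<in>A. (c \<alpha>)\<^sup>2 + ((l \<alpha> j)\<^sup>2 + (\<Sum>J\<in>G. (l \<alpha> J)\<^sup>2)) + 2 * (\<Sum>J\<in>G. (m \<alpha> j J)\<^sup>2 + (m \<alpha> J j)\<^sup>2))"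
    by (smt (verit) insertCI)
  then obtain s where s: "s = 1 \<or> s = -1" and
    Rs: "R s \<le> (\<Sum>\<alpha>\<in>A. (c \<alpha>)\<^sup>2 + ((l \<alpha> j)\<^sup>2 + (\<Sum>J\<in>G. (l \<alpha> J)\<^sup>2)) + 2 * (\<Sum>J\<in>G. (m \<alpha> j J)\<^sup>2 + (m \<alpha> J j)\<^sup>2))"
    by auto
  obtain \<epsilon> where \<epsilon>: "\<forall>J. \<epsilon> J = 1 \<or> \<epsilon> J = (-1::real)" and
    le: "(\<Sum>\<alpha>\<in>A. (c' s \<alpha> + (\<Sum>J\<in>G. l' s \<alpha> J * \<epsilon> J) + (\<Sum>J\<in>G. \<Sum>K\<in>G - {J}. m \<alpha> J K * (\<epsilon> J * \<epsilon> K)))\<^sup>2)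
    \<le> (\<Sum>\<alpha>\<in>A. (c' s \<alpha>)\<^sup>2 + (\<Sum>J\<in>G. (l' s \<alpha> J)\<^sup>2) + 2 * (\<Sum>J\<in>G. \<Sum>K\<in>G - {J}. (m \<alpha> J K)\<^sup>2))"
    using insert.IH by blast
  define \<epsilon>' where "\<epsilon>' = \<epsilon>(j := s)"
  have [simp]: "\<epsilon>' j = s" "J \<in> G \<Longrightarrow> \<epsilon>' J = \<epsilon> J" for J using insert by (auto simp: \<epsilon>'_def)
  have form: "c \<alpha> + (\<Sum>J\<in>insert j G. l \<alpha> J * \<epsilon>' J) + (\<Sum>J\<in>insert j G. \<Sum>K\<in>insert j G - {J}. m \<alpha> J K * (\<epsilon>' J * \<epsilon>' K))
    = c' s \<alpha> + (\<Sum>J\<in>G. l' s \<alpha> J * \<epsilon> J) + (\<Sum>J\<in>G. \<Sum>K\<in>G - {J}. m \<alpha> J K * (\<epsilon> J * \<epsilon> K))" for \<alpha>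
  proof -
    have 1: "(\<Sum>J\<in>G. l \<alpha> J * \<epsilon>' J) = (\<Sum>J\<in>G. l \<alpha> J * \<epsilon> J)" by (intro sum.cong) auto
    have 2: "(\<Sum>J\<in>G. \<Sum>K\<in>G - {J}. m \<alpha> J K * (\<epsilon>' J * \<epsilon>' K)) = (\<Sum>J\<in>G. \<Sum>K\<in>G - {J}. m \<alpha> J K * (\<epsilon> J * \<epsilon> K))"
      by (intro sum.cong) auto
    have 3: "(\<Sum>K\<in>G. m \<alpha> j K * (\<epsilon>' j * \<epsilon>' K) + m \<alpha> K j * (\<epsilon>' K * \<epsilon>' j)) = (\<Sum>K\<in>G. s * (m \<alpha> j K + m \<alpha> K j) * \<epsilon> K)"
      by (intro sum.cong) (auto simp: algebra_simps)
    show ?thesis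
      unfolding split 2 3 using insert 1
      by (simp add: c'_def l'_def distrib_right sum.distrib)
  qed
  have "(\<Sum>\<alpha>\<in>A. (c \<alpha> + (\<Sum>J\<in>insert j G. l \<alpha> J * \<epsilon>' J) + (\<Sum>J\<in>insert j G. \<Sum>K\<in>insert j G - {J}. m \<alpha> J K * (\<epsilon>' J * \<epsilon>' K)))\<^sup>2)
    \<le> R s + Q"
    unfolding form using le by (simp add: R_def Q_def sum.distrib)
  also have "\<dots> \<le> (\<Sum>\<alpha>\<in>A. (c \<alpha>)\<^sup>2 + ((l \<alpha> j)\<^sup>2 + (\<Sum>J\<in>G. (l \<alpha> J)\<^sup>2)) + 2 * (\<Sum>J\<in>G. (m \<alpha> j J)\<^sup>2 + (m \<alpha> J j)\<^sup>2)) + Q"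
    using Rs by simp
  also have "\<dots> = (\<Sum>\<alpha>\<in>A. (c \<alpha>)\<^sup>2 + (\<Sum>J\<in>insert j G. (l \<alpha> J)\<^sup>2) + 2 * (\<Sum>J\<in>insert j G. \<Sum>K\<in>insert j G - {J}. (m \<alpha> J K)\<^sup>2))"
    unfolding split Q_def using insert by (simp add: sum.distrib distrib_left sum_distrib_left)
  finally show ?case
    using \<epsilon> s by (intro exI[of _ \<epsilon>']) (auto simp: \<epsilon>'_def)
qed

section \<open>Nodes of a given rank\<close>

definition leaf_rank :: "nat \<Rightarrow> (nat \<times> nat \<Rightarrow> bool) \<Rightarrow> nat \<Rightarrow> nat \<Rightarrow> nat" where
  "leaf_rank N Q k y = card {k'. k' < k \<and> Q (leaf_node N k' y)}"

text \<open>The condition on the leaves says that exactly \<open>r\<close> strict ancestors of \<open>J\<close> satisfy \<open>Q\<close>.\<close>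
definition rank_nodes :: "nat \<Rightarrow> (nat \<times> nat \<Rightarrow> bool) \<Rightarrow> nat \<Rightarrow> (nat \<times> nat) set" where
  "rank_nodes N Q r = {J \<in> nodes N. Q J \<and> (\<forall>y<2^N. leaf_node N (fst J) y = J \<longrightarrow> leaf_rank N Q (fst J) y = r)}"

definition disjoint_nodes :: "nat \<Rightarrow> (nat \<times> nat) set \<Rightarrow> bool" where
  "disjoint_nodes N U \<longleftrightarrow> U \<subseteq> nodes N \<and>
     (\<forall>y<2^N. \<forall>J\<in>U. \<forall>K\<in>U. leaf_node N (fst J) y = J \<longrightarrow> leaf_node N (fst K) y = K \<longrightarrow> J = K)"

lemma leaf_node_eq_lower:
  assumes "leaf_node N k y = leaf_node N k z" "k' \<le> k" "k \<le> N"
  shows "leaf_node N k' y = leaf_node N k' z"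
proof -
  have "(2::nat) ^ (N - k') = 2 ^ (N - k) * 2 ^ (k - k')" using assms by (simp flip: power_add)
  then show ?thesis using assms by (simp add: leaf_node_def div_mult2_eq)
qed

lemma leaf_bit_eq_lower:
  assumes "leaf_node N k y = leaf_node N k z" "k' < k" "k \<le> N"
  shows "leaf_bit N k' y = leaf_bit N k' z"
proof -
  have "(2::nat) ^ (N - Suc k') = 2 ^ (N - k) * 2 ^ (k - Suc k')" using assms by (simp flip: power_add)
  then show ?thesis using assms by (simp add: leaf_node_def leaf_bit_def div_mult2_eq)
qed

lemma leaf_rank_Suc: "leaf_rank N Q (Suc k) y = leaf_rank N Q k y + (if Q (leaf_node N k y) then 1 else 0)"
proof -
  have "{k'. k' < Suc k \<and> Q (leaf_node N k' y)} = {k'. k' < k \<and> Q (leaf_node N k' y)} \<union> (if Q (leaf_node N k y) then {k} else {})"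
    by (auto simp: less_Suc_eq)
  then show ?thesis by (simp add: leaf_rank_def)
qed

lemma leaf_rank_0 [simp]: "leaf_rank N Q 0 y = 0"
  by (simp add: leaf_rank_def)

lemma leaf_rank_mono: "k \<le> k' \<Longrightarrow> leaf_rank N Q k y \<le> leaf_rank N Q k' y"
  by (induction k' rule: dec_induct) (auto simp: leaf_rank_Suc)

lemma leaf_rank_le: "leaf_rank N Q k y \<le> k"
  by (induction k) (auto simp: leaf_rank_Suc)

text \<open>The rank starts at 0 and grows by at most 1 per level, each time at a node satisfying Q,
  so no value below the final one is skipped.\<close>

lemma leaf_rank_hit:
  assumes "r < leaf_rank N Q k y"
  shows "\<exists>k'<k. Q (leaf_node N k' y) \<and> leaf_rank N Q k' y = r"
  using assms
proof (induction k)
  case (Suc k)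
  then show ?case by (cases "r < leaf_rank N Q k y") (auto simp: leaf_rank_Suc less_Suc_eq split: if_splits)
qed simp

lemma leaf_rank_complement: "leaf_rank N Q k y + leaf_rank N (\<lambda>J. \<not> Q J) k y = k"
  by (induction k) (auto simp: leaf_rank_Suc)

text \<open>All leaves below a node share its strict ancestors, so the rank can be tested at any one
  of them.\<close>

lemma leaf_node_rank_iff:
  assumes "k < N" "y < 2 ^ N"
  shows "leaf_node N k y \<in> rank_nodes N Q r \<longleftrightarrow> Q (leaf_node N k y) \<and> leaf_rank N Q k y = r"
proof -
  have "leaf_rank N Q k z = leaf_rank N Q k y" if "leaf_node N k z = leaf_node N k y" for z
  proof -
    have "{k'. k' < k \<and> Q (leaf_node N k' z)} = {k'. k' < k \<and> Q (leaf_node N k' y)}"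
      using leaf_node_eq_lower[OF that] assms by auto
    then show ?thesis by (simp add: leaf_rank_def)
  qed
  then have "(\<forall>z<2^N. leaf_node N k z = leaf_node N k y \<longrightarrow> leaf_rank N Q k z = r) \<longleftrightarrow> leaf_rank N Q k y = r"
    using assms(2) by metis
  then show ?thesis using leaf_node_in_nodes[OF assms] by (simp add: rank_nodes_def)
qed

text \<open>The rank increases strictly when a node satisfying Q is passed. Therefore one branch
  contains at most one node of each rank, and the nodes of a fixed rank are disjoint.\<close>

lemma leaf_rank_unique:
  assumes "Q (leaf_node N k y)" "Q (leaf_node N k' y)" "leaf_rank N Q k y = leaf_rank N Q k' y"
  shows "k = k'"
proof (rule ccontr)
  have *: False if "k < k'" "Q (leaf_node N k y)" "leaf_rank N Q k y = leaf_rank N Q k' y" for k k'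
    using leaf_rank_mono[of "Suc k" k' N Q y] that by (simp add: leaf_rank_Suc)
  assume "k \<noteq> k'"
  then show False using *[of k k'] *[of k' k] assms by force
qed

lemma nodes_level: "J \<in> nodes N \<Longrightarrow> fst J < N"
  by (auto simp: nodes_def)

lemma rank_nodes_subset: "rank_nodes N Q r \<subseteq> nodes N"
  by (auto simp: rank_nodes_def)

lemma finite_rank_nodes [simp]: "finite (rank_nodes N Q r)"
  by (rule finite_subset[OF rank_nodes_subset]) simp

lemma rank_nodesD: "J \<in> rank_nodes N Q r \<Longrightarrow> J \<in> nodes N" "J \<in> rank_nodes N Q r \<Longrightarrow> Q J"
  by (auto simp: rank_nodes_def)

lemma disjoint_rank_nodes: "disjoint_nodes N (rank_nodes N Q r)"
  unfolding disjoint_nodes_def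
proof (intro conjI rank_nodes_subset ballI allI impI)
  fix y J K
  assume y: "y < 2 ^ N" and JK: "J \<in> rank_nodes N Q r" "K \<in> rank_nodes N Q r"
    "leaf_node N (fst J) y = J" "leaf_node N (fst K) y = K"
  then have *: "fst J < N" "fst K < N" using rank_nodesD(1) nodes_level by blast+
  have "Q (leaf_node N (fst J) y) \<and> leaf_rank N Q (fst J) y = r"
    using leaf_node_rank_iff[OF *(1) y, of Q r] JK(1) unfolding JK(3) by blast
  moreover have "Q (leaf_node N (fst K) y) \<and> leaf_rank N Q (fst K) y = r"
    using leaf_node_rank_iff[OF *(2) y, of Q r] JK(2) unfolding JK(4) by blast
  ultimately have "fst J = fst K" using leaf_rank_unique[of Q N "fst J" y "fst K"] by metis
  then show "J = K" using JK(3,4) by metis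
qed

text \<open>A node of level k has only k strict ancestors. Large ranks thus force short intervals,
  which is the source of all smallness inside a block.\<close>

lemma rank_nodes_level:
  assumes "J \<in> rank_nodes N Q r"
  shows "r \<le> fst J"
proof -
  obtain y where "y < 2 ^ N" "leaf_node N (fst J) y = J"
    using nodes_cases_leaf[OF rank_nodesD(1)[OF assms]] .
  then have "leaf_rank N Q (fst J) y = r" using assms by (auto simp: rank_nodes_def)
  then show ?thesis using leaf_rank_le[of N Q "fst J" y] by simp
qed

lemma node_len_rank_le: "J \<in> rank_nodes N Q r \<Longrightarrow> r0 \<le> r \<Longrightarrow> node_len J \<le> (1/2) ^ r0"
  using rank_nodes_level[of J N Q r] power_decreasing[of r0 "fst J" "1/2::real"]
  by (simp add: node_len_def power_one_over)

lemma node_len_pos [simp]: "0 < node_len J"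
  by (simp add: node_len_def)

lemma node_len_nonneg [simp]: "0 \<le> node_len J"
  by (simp add: node_len_def)

lemma node_len_le_1: "node_len J \<le> 1"
  by (simp add: node_len_def)

lemma sum_disjoint_nodes:
  assumes "disjoint_nodes N U" "y < 2 ^ N" "K \<in> U" "leaf_node N (fst K) y = K"
    and "\<And>J. J \<in> U \<Longrightarrow> leaf_node N (fst J) y \<noteq> J \<Longrightarrow> g J = 0"
  shows "(\<Sum>J\<in>U. g J) = (g K :: real)"
proof -
  have "finite U" using assms by (auto simp: disjoint_nodes_def intro: finite_subset[OF _ finite_nodes])
  then have "(\<Sum>J\<in>U. g J) = (\<Sum>J\<in>{K}. g J)"
  proof (intro sum.mono_neutral_right ballI)
    fix J assume "J \<in> U - {K}"
    then show "g J = 0" using assms(1-4) assms(5)[of J] unfolding disjoint_nodes_def by blast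
  qed (use assms in auto)
  then show ?thesis by simp
qed

text \<open>At a given leaf at most one node of a disjoint family contributes.\<close>

lemma sum_leaf_haar_abs_le:
  assumes "disjoint_nodes N U" "y < 2 ^ N" "\<And>J. J \<in> U \<Longrightarrow> \<bar>g J\<bar> \<le> c" "0 \<le> c"
  shows "\<bar>\<Sum>J\<in>U. g J * leaf_haar N J y\<bar> \<le> c" "\<bar>\<Sum>J\<in>U. g J * \<bar>leaf_haar N J y\<bar>\<bar> \<le> c"
proof -
  have "\<bar>\<Sum>J\<in>U. g J * leaf_haar N J y\<bar> \<le> c \<and> \<bar>\<Sum>J\<in>U. g J * \<bar>leaf_haar N J y\<bar>\<bar> \<le> c"
  proof (cases "\<exists>K\<in>U. leaf_node N (fst K) y = K")
    case True
    then obtain K where K: "K \<in> U" "leaf_node N (fst K) y = K" by blast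
    have *: "(\<Sum>J\<in>U. g J * leaf_haar N J y) = g K * leaf_haar N K y" "(\<Sum>J\<in>U. g J * \<bar>leaf_haar N J y\<bar>) = g K * \<bar>leaf_haar N K y\<bar>"
      by (rule sum_disjoint_nodes[OF assms(1,2) K]; simp add: leaf_haar_def)+
    show ?thesis using assms(3)[OF K(1)] K(2) unfolding * by (simp add: leaf_haar_def abs_mult)
  next
    case False
    then have "(\<Sum>J\<in>U. g J * leaf_haar N J y) = 0" "(\<Sum>J\<in>U. g J * \<bar>leaf_haar N J y\<bar>) = 0"
      by (auto intro!: sum.neutral simp: leaf_haar_def)
    then show ?thesis using assms by simp
  qed
  then show "\<bar>\<Sum>J\<in>U. g J * leaf_haar N J y\<bar> \<le> c" "\<bar>\<Sum>J\<in>U. g J * \<bar>leaf_haar N J y\<bar>\<bar> \<le> c" by auto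
qed

text \<open>Turns weighted sums of interval lengths into averages over the leaves, which can then be
  estimated leaf by leaf.\<close>

lemma sum_node_len_eq:
  assumes "U \<subseteq> nodes N"
  shows "(\<Sum>J\<in>U. g J * node_len J) = leaf_avg N (\<lambda>y. \<Sum>J\<in>U. g J * \<bar>leaf_haar N J y\<bar>)"
  using assms by (auto simp: leaf_avg_sum leaf_avg_mult leaf_avg_haar_node intro!: sum.cong)

lemma sum_node_len_le_1:
  assumes "disjoint_nodes N U"
  shows "(\<Sum>J\<in>U. node_len J) \<le> 1"
proof -
  have "(\<Sum>J\<in>U. 1 * node_len J) = leaf_avg N (\<lambda>y. \<Sum>J\<in>U. 1 * \<bar>leaf_haar N J y\<bar>)"
    using assms by (intro sum_node_len_eq) (auto simp: disjoint_nodes_def)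
  also have "\<dots> \<le> leaf_avg N (\<lambda>y. 1)"
    using sum_leaf_haar_abs_le(2)[OF assms, of _ "\<lambda>_. 1" 1] by (intro leaf_avg_mono) (auto simp: abs_le_iff)
  finally show ?thesis by simp
qed

text \<open>Every leaf has \<open>N\<close> ancestors, so more than \<open>R\<close> of them satisfy \<open>Q\<close> or more than \<open>R\<close> of them
  satisfy its negation; one of the two alternatives covers at least half of the leaves.\<close>
lemma rank_nodes_cover_half:
  assumes R: "2 * R + 1 \<le> N"
  shows "(\<forall>r\<le>R. 1/2 \<le> (\<Sum>J\<in>rank_nodes N Q r. node_len J)) \<or>
         (\<forall>r\<le>R. 1/2 \<le> (\<Sum>J\<in>rank_nodes N (\<lambda>J. \<not> Q J) r. node_len J))"
proof -
  \<comment> \<open>By \<open>leaf_rank_hit\<close> a leaf in A Q lies below a node of every rank r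
    \<le> R.\<close>
  define A where "A Q = {y. y < 2 ^ N \<and> R < leaf_rank N Q N y}" for Q
  have *: "1/2 \<le> (\<Sum>J\<in>rank_nodes N Q r. node_len J)" if A: "2 ^ N \<le> 2 * card (A Q)" and "r \<le> R" for Q r
  proof -
    have "1/2 \<le> card (A Q) / 2 ^ N"
    proof -
      have "real (2 ^ N) \<le> real (2 * card (A Q))" using A by (simp only: of_nat_le_iff)
      then show ?thesis by (simp add: field_simps)
    qed
    also have "\<dots> = leaf_avg N (\<lambda>y. if y \<in> A Q then 1 else 0)"
    proof -
      have "{..<2 ^ N} \<inter> A Q = A Q" by (auto simp: A_def)
      then show ?thesis by (simp add: leaf_avg_def flip: sum.inter_restrict)
    qed
    also have "\<dots> \<le> leaf_avg N (\<lambda>y. \<Sum>J\<in>rank_nodes N Q r. 1 * \<bar>leaf_haar N J y\<bar>)"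
    proof (intro leaf_avg_mono)
      fix y :: nat assume y: "y < 2 ^ N"
      show "(if y \<in> A Q then 1 else 0) \<le> (\<Sum>J\<in>rank_nodes N Q r. 1 * \<bar>leaf_haar N J y\<bar>)"
      proof (cases "y \<in> A Q")
        case True
        then have "r < leaf_rank N Q N y" using \<open>r \<le> R\<close> by (simp add: A_def)
        then obtain k where k: "k < N" "Q (leaf_node N k y)" "leaf_rank N Q k y = r"
          using leaf_rank_hit by blast
        then have "leaf_node N k y \<in> rank_nodes N Q r" using y by (simp add: leaf_node_rank_iff)
        then have "(\<Sum>J\<in>rank_nodes N Q r. 1 * \<bar>leaf_haar N J y\<bar>) = 1 * \<bar>leaf_haar N (leaf_node N k y) y\<bar>"
          using y by (intro sum_disjoint_nodes[OF disjoint_rank_nodes]) (auto simp: leaf_haar_def)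
        then show ?thesis by (simp add: leaf_haar_def)
      qed (auto intro!: sum_nonneg)
    qed
    also have "\<dots> = (\<Sum>J\<in>rank_nodes N Q r. 1 * node_len J)"
      by (rule sum_node_len_eq[symmetric]) (rule rank_nodes_subset)
    finally show ?thesis by simp
  qed
  have "{..<2 ^ N} \<subseteq> A Q \<union> A (\<lambda>J. \<not> Q J)"
  proof
    fix y :: nat assume "y \<in> {..<2 ^ N}"
    then show "y \<in> A Q \<union> A (\<lambda>J. \<not> Q J)"
      using R leaf_rank_complement[of N Q N y] unfolding A_def by simp linarith
  qed
  moreover have "finite (A Q)" for Q by (simp add: A_def)
  ultimately have "2 ^ N \<le> card (A Q \<union> A (\<lambda>J. \<not> Q J))"
    using card_mono[of "A Q \<union> A (\<lambda>J. \<not> Q J)" "{..<2 ^ N}"] by simp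
  also have "\<dots> \<le> card (A Q) + card (A (\<lambda>J. \<not> Q J))" by (rule card_Un_le)
  finally have "2 ^ N \<le> 2 * card (A Q) \<or> 2 ^ N \<le> 2 * card (A (\<lambda>J. \<not> Q J))" by linarith
  then show ?thesis using * by blast
qed

text \<open>The values fall into floor(C / \<eta>) + 1 cells of width \<eta>, so one cell receives n
  indices; listing them in increasing order gives \<rho>.\<close>

lemma pigeonhole_close_values:
  fixes m :: "nat \<Rightarrow> real"
  assumes "0 < \<eta>" "\<And>r. r \<in> A \<Longrightarrow> 0 \<le> m r \<and> m r \<le> C" "finite A" "n * (nat \<lfloor>C / \<eta>\<rfloor> + 1) < card A + 1" "0 < n"
  obtains \<rho> where "\<And>i. i < n \<Longrightarrow> \<rho> i \<in> A" "\<And>i j. i < j \<Longrightarrow> j < n \<Longrightarrow> \<rho> i < \<rho> j"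
    "\<And>i j. i < n \<Longrightarrow> j < n \<Longrightarrow> \<bar>m (\<rho> i) - m (\<rho> j)\<bar> \<le> \<eta>"
proof -
  define f where "f r = nat \<lfloor>m r / \<eta>\<rfloor>" for r
  define V where "V = {..nat \<lfloor>C / \<eta>\<rfloor>}"
  have fV: "f ` A \<subseteq> V"
    using assms by (auto simp: f_def V_def intro!: nat_mono floor_mono divide_right_mono)
  have "\<exists>v\<in>V. n \<le> card {r\<in>A. f r = v}"
  proof (rule ccontr)
    assume neg: "\<not> ?thesis"
    have "card A = (\<Sum>v\<in>V. card {r\<in>A. f r = v})"
      using sum.group[OF assms(3) _ fV, of "\<lambda>_. 1::nat"] by (simp add: V_def)
    also have "\<dots> \<le> (\<Sum>v\<in>V. n - 1)" using neg by (intro sum_mono) force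
    also have "\<dots> = (n - 1) * card V" by simp
    also have "\<dots> = n * (nat \<lfloor>C / \<eta>\<rfloor> + 1) - (nat \<lfloor>C / \<eta>\<rfloor> + 1)"
      using assms(5) by (cases n) (auto simp: V_def)
    finally show False using assms(4,5) by (cases n) auto
  qed
  then obtain v where v: "n \<le> card {r\<in>A. f r = v}" by blast
  define xs where "xs = sorted_list_of_set {r\<in>A. f r = v}"
  have fin: "finite {r\<in>A. f r = v}" using assms by simp
  have len: "n \<le> length xs" using v by (simp add: xs_def)
  have set: "set xs = {r\<in>A. f r = v}" using fin by (simp add: xs_def)
  have in_xs: "xs ! i \<in> A \<and> f (xs ! i) = v" if "i < n" for i
    using that len set nth_mem[of i xs] by auto
  have "sorted_wrt (<) xs" unfolding xs_def by simp
  show thesis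
  proof (rule that[of "\<lambda>i. xs ! i"])
    fix i j assume "i < j" "j < n"
    then show "xs ! i < xs ! j" using \<open>sorted_wrt (<) xs\<close> len by (auto simp: sorted_wrt_iff_nth_less)
  next
    fix i j assume ij: "i < n" "j < n"
    then have eq: "nat \<lfloor>m (xs ! i) / \<eta>\<rfloor> = nat \<lfloor>m (xs ! j) / \<eta>\<rfloor>" using in_xs by (metis f_def)
    have "0 \<le> m (xs ! i) / \<eta>" "0 \<le> m (xs ! j) / \<eta>" using ij in_xs assms by auto
    then have "\<lfloor>m (xs ! i) / \<eta>\<rfloor> = \<lfloor>m (xs ! j) / \<eta>\<rfloor>" using eq
      by (metis zero_le_floor eq_nat_nat_iff)
    then have "\<bar>m (xs ! i) / \<eta> - m (xs ! j) / \<eta>\<bar> \<le> 1" by linarith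
    then have "\<bar>m (xs ! i) - m (xs ! j)\<bar> / \<eta> \<le> 1" using assms(1) by (simp flip: diff_divide_distrib)
    then show "\<bar>m (xs ! i) - m (xs ! j)\<bar> \<le> \<eta>" using assms(1) by (simp add: field_simps)
  qed (use in_xs in auto)
qed

text \<open>The matrix t, compressed to the images of the Haar functions under the kernel of w, is
  close to c times the Gram matrix of the Haar system, which is diagonal with entries
  \<open>node_len I\<close>. The coefficients \<beta> expand these images in Haar functions of depth
  N, so that the compression becomes a finite sum over t.\<close>

definition good_block ::
  "nat \<Rightarrow> real \<Rightarrow> real \<Rightarrow> nat \<Rightarrow> (nat \<times> nat \<Rightarrow> nat \<times> nat \<Rightarrow> real) \<Rightarrow> (nat \<Rightarrow> nat \<Rightarrow> real) \<Rightarrow> (nat \<times> nat \<Rightarrow> nat \<times> nat \<Rightarrow> real) \<Rightarrow> bool"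
  where "good_block n \<eta> c N t w \<beta> \<longleftrightarrow>
    (\<forall>i. \<forall>y<2^N. \<bar>w i y\<bar> \<le> 1) \<and>
    (\<forall>I\<in>nodes n. \<forall>y<2^N. ker w (fst I) y (snd I - 1) * w (fst I) y = (\<Sum>J\<in>nodes N. \<beta> I J * leaf_haar N J y)) \<and>
    (\<forall>I\<in>nodes n. \<forall>I'\<in>nodes n.
       \<bar>(\<Sum>J\<in>nodes N. \<Sum>K\<in>nodes N. \<beta> I J * \<beta> I' K * t J K) - (if I = I' then c * node_len I else 0)\<bar> \<le> \<eta>)"

text \<open>Lengths are at most 1, so a change of scalar moves a diagonal entry by at most |c - c'|.
  This refers blocks with different scalars to a common limit.\<close>

lemma good_block_weaken:
  assumes "good_block n' \<eta>' c' N t w \<beta>" "n \<le> n'" "\<eta>' + \<bar>c - c'\<bar> \<le> \<eta>"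
  shows "good_block n \<eta> c N t w \<beta>"
proof -
  have sub: "nodes n \<subseteq> nodes n'" using assms(2) by (auto simp: nodes_def)
  have "\<bar>X - (if b then c * node_len I else 0)\<bar> \<le> \<eta>" if "\<bar>X - (if b then c' * node_len I else 0)\<bar> \<le> \<eta>'" for X b I
  proof -
    have "\<bar>c - c'\<bar> * node_len I \<le> \<bar>c - c'\<bar> * 1" using node_len_le_1 by (intro mult_left_mono) auto
    then have "\<bar>c * node_len I - c' * node_len I\<bar> \<le> \<bar>c - c'\<bar>" by (simp add: abs_mult flip: left_diff_distrib)
    then show ?thesis using that assms(3) by (cases b) auto
  qed
  then show ?thesis using assms(1) sub unfolding good_block_def by (meson subsetD)
qed

lemma disjoint_single: "J \<in> nodes N \<Longrightarrow> disjoint_nodes N {J}"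
  by (auto simp: disjoint_nodes_def)

lemma sum_square_le:
  assumes "finite U" "\<And>J. J \<in> U \<Longrightarrow> \<bar>x J\<bar> \<le> b" "(\<Sum>J\<in>U. \<bar>x J\<bar>) \<le> d" "0 \<le> b"
  shows "(\<Sum>J\<in>U. (x J)\<^sup>2) \<le> b * (d::real)"
proof -
  have "(\<Sum>J\<in>U. (x J)\<^sup>2) \<le> (\<Sum>J\<in>U. b * \<bar>x J\<bar>)"
  proof (intro sum_mono)
    fix J assume "J \<in> U"
    then have "\<bar>x J\<bar> * \<bar>x J\<bar> \<le> b * \<bar>x J\<bar>" using assms(2) by (intro mult_right_mono) auto
    then show "(x J)\<^sup>2 \<le> b * \<bar>x J\<bar>" by (simp add: power2_eq_square)
  qed
  also have "\<dots> \<le> b * d" unfolding sum_distrib_left[symmetric] using assms by (intro mult_left_mono)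
  finally show ?thesis .
qed

lemma finite_disjoint_nodes: "disjoint_nodes N U \<Longrightarrow> finite U"
  by (auto simp: disjoint_nodes_def intro: finite_subset[OF _ finite_nodes])

text \<open>Here \<open>t J K\<close> stands for the pairing of \<open>h\<^sub>J\<close> with the
  image of \<open>h\<^sub>K\<close>. The assumption \<open>bound\<close> is Hoelder's inequality: a
  combination over disjoint nodes with coefficients at most 1 has norm at most the total length to
  the power 1 / r in \<open>L\<^sub>r\<close>.\<close>

locale haar_block =
  fixes N :: nat and t :: "nat \<times> nat \<Rightarrow> nat \<times> nat \<Rightarrow> real" and C \<delta> p q :: real
  assumes p: "1 < p" and q: "1 < q" and pq: "1 / p + 1 / q = 1" and C: "0 \<le> C" and \<delta>: "0 < \<delta>"
    and diag: "\<And>J. J \<in> nodes N \<Longrightarrow> \<delta> * node_len J \<le> \<bar>t J J\<bar>"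
    and bound: "\<And>U V u v. disjoint_nodes N U \<Longrightarrow> disjoint_nodes N V \<Longrightarrow> (\<And>J. \<bar>u J\<bar> \<le> 1) \<Longrightarrow> (\<And>J. \<bar>v J\<bar> \<le> 1) \<Longrightarrow>
      \<bar>\<Sum>J\<in>U. \<Sum>K\<in>V. u J * v K * t J K\<bar> \<le> C * (\<Sum>J\<in>U. node_len J) powr (1 / q) * (\<Sum>K\<in>V. node_len K) powr (1 / p)"
begin

text \<open>Exchanging rows with columns and p with q preserves the assumptions, so every row
  estimate is also a column estimate.\<close>

lemma transpose: "haar_block N (\<lambda>J K. t K J) C \<delta> q p"
proof
  fix U V and u v :: "nat \<times> nat \<Rightarrow> real"
  assume "disjoint_nodes N U" "disjoint_nodes N V" "\<And>J. \<bar>u J\<bar> \<le> 1" "\<And>J. \<bar>v J\<bar> \<le> 1"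
  then show "\<bar>\<Sum>J\<in>U. \<Sum>K\<in>V. u J * v K * t K J\<bar> \<le> C * (\<Sum>J\<in>U. node_len J) powr (1 / p) * (\<Sum>K\<in>V. node_len K) powr (1 / q)"
    using bound[of V U v u] by (subst sum.swap) (simp add: mult_ac)
qed (use p q pq C \<delta> diag in auto)

lemma row_le:
  assumes "J \<in> nodes N" "disjoint_nodes N V" "\<And>K. \<bar>v K\<bar> \<le> 1"
  shows "\<bar>\<Sum>K\<in>V. v K * t J K\<bar> \<le> C * node_len J powr (1 / q) * (\<Sum>K\<in>V. node_len K) powr (1 / p)"
  using bound[OF disjoint_single[OF assms(1)] assms(2), of "\<lambda>_. 1" v] assms(3) by simp

lemma powr_sum_len_le_1: "disjoint_nodes N V \<Longrightarrow> (\<Sum>K\<in>V. node_len K) powr (1 / p) \<le> 1"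
  using sum_node_len_le_1[of N V] p by (intro powr_le1) (auto simp: sum_nonneg)

lemma entry_le:
  assumes "J \<in> nodes N" "K \<in> nodes N"
  shows "\<bar>t J K\<bar> \<le> C * node_len J powr (1 / q) * node_len K powr (1 / p)"
  using row_le[OF assms(1) disjoint_single[OF assms(2)], of "\<lambda>_. 1"] by simp

lemma diag_le:
  assumes "J \<in> nodes N"
  shows "\<bar>t J J\<bar> \<le> C * node_len J"
proof -
  have "node_len J powr (1 / q) * node_len J powr (1 / p) = node_len J"
    using pq node_len_pos[of J] by (simp add: add.commute flip: powr_add)
  then show ?thesis using entry_le[OF assms assms] by (simp add: mult.assoc)
qed

text \<open>Choosing u as the signs of the row sums turns the bilinear bound into a bound for their
  absolute sum.\<close>

lemma row_abs_sum_le: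
  assumes U: "disjoint_nodes N U" and "disjoint_nodes N V" "\<And>K. \<bar>v K\<bar> \<le> 1"
  shows "(\<Sum>J\<in>U. \<bar>\<Sum>K\<in>V. v K * t J K\<bar>) \<le> C * (\<Sum>K\<in>V. node_len K) powr (1 / p)"
proof -
  define u :: "nat \<times> nat \<Rightarrow> real" where "u J = (if (\<Sum>K\<in>V. v K * t J K) \<ge> 0 then 1 else -1)" for J
  have "(\<Sum>J\<in>U. \<bar>\<Sum>K\<in>V. v K * t J K\<bar>) = (\<Sum>J\<in>U. \<Sum>K\<in>V. u J * v K * t J K)"
    unfolding mult.assoc sum_distrib_left[symmetric] by (intro sum.cong) (auto simp: u_def)
  also have "\<dots> \<le> C * (\<Sum>J\<in>U. node_len J) powr (1 / q) * (\<Sum>K\<in>V. node_len K) powr (1 / p)"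
    using bound[OF assms(1,2), of u v] assms(3) by (auto simp: u_def abs_le_iff)
  also have "\<dots> \<le> C * 1 * (\<Sum>K\<in>V. node_len K) powr (1 / p)"
    using C haar_block.powr_sum_len_le_1[OF transpose U] by (intro mult_right_mono mult_left_mono) auto
  finally show ?thesis by simp
qed

text \<open>A sum of squares is at most the maximum times the sum of absolute values. The maximum
  supplies the small factor, since the nodes of U are short.\<close>

lemma row_square_sum_le:
  assumes U: "disjoint_nodes N U" and V: "disjoint_nodes N V" and v: "\<And>K. \<bar>v K\<bar> \<le> 1"
    and a: "\<And>J. J \<in> U \<Longrightarrow> node_len J \<le> a"
  shows "(\<Sum>J\<in>U. (\<Sum>K\<in>V. v K * t J K)\<^sup>2) \<le>
    (C * a powr (1 / q) * (\<Sum>K\<in>V. node_len K) powr (1 / p)) * (C * (\<Sum>K\<in>V. node_len K) powr (1 / p))"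
proof (rule sum_square_le[OF finite_disjoint_nodes[OF U]])
  fix J assume J: "J \<in> U"
  then have "J \<in> nodes N" using U by (auto simp: disjoint_nodes_def)
  from row_le[OF this V v]
  have "\<bar>\<Sum>K\<in>V. v K * t J K\<bar> \<le> C * node_len J powr (1 / q) * (\<Sum>K\<in>V. node_len K) powr (1 / p)" .
  also have "\<dots> \<le> C * a powr (1 / q) * (\<Sum>K\<in>V. node_len K) powr (1 / p)"
    using C a[OF J] q node_len_pos[of J] by (intro mult_right_mono mult_left_mono powr_mono2) auto
  finally show "\<bar>\<Sum>K\<in>V. v K * t J K\<bar> \<le> C * a powr (1 / q) * (\<Sum>K\<in>V. node_len K) powr (1 / p)" .
qed (use row_abs_sum_le[OF U V v] C in auto)

lemma row_square_sum_le':
  assumes U: "disjoint_nodes N U" and V: "disjoint_nodes N V" and v: "\<And>K. \<bar>v K\<bar> \<le> 1"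
    and a: "\<And>J. J \<in> U \<Longrightarrow> node_len J \<le> a"
  shows "(\<Sum>J\<in>U. (\<Sum>K\<in>V. v K * t J K)\<^sup>2) \<le> C\<^sup>2 * a powr (1 / q)"
proof -
  have "(\<Sum>J\<in>U. (\<Sum>K\<in>V. v K * t J K)\<^sup>2) \<le>
    (C * a powr (1 / q) * (\<Sum>K\<in>V. node_len K) powr (1 / p)) * (C * (\<Sum>K\<in>V. node_len K) powr (1 / p))"
    by (rule row_square_sum_le[OF assms])
  also have "\<dots> \<le> (C * a powr (1 / q) * 1) * (C * 1)"
    using C powr_sum_len_le_1[OF V] by (intro mult_mono) auto
  finally show ?thesis by (simp add: power2_eq_square mult_ac)
qed

text \<open>Columns are treated one at a time. Column K contributes a multiple of |K| to the power 2
  / p, which for p \<le> 2 is at most |K| and hence summable over disjoint nodes.\<close>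

lemma square_sum_le_aux:
  assumes U: "disjoint_nodes N U" and a: "\<And>J. J \<in> U \<Longrightarrow> node_len J \<le> a" and "p \<le> 2"
  shows "(\<Sum>J\<in>U. \<Sum>K\<in>U. (t J K)\<^sup>2) \<le> C\<^sup>2 * a powr (1 / q)"
proof -
  have UN: "J \<in> U \<Longrightarrow> J \<in> nodes N" for J using U by (auto simp: disjoint_nodes_def)
  have "(\<Sum>J\<in>U. \<Sum>K\<in>U. (t J K)\<^sup>2) = (\<Sum>K\<in>U. \<Sum>J\<in>U. (\<Sum>L\<in>{K}. 1 * t J L)\<^sup>2)"
    by (subst sum.swap) simp
  also have "\<dots> \<le> (\<Sum>K\<in>U. C\<^sup>2 * a powr (1 / q) * node_len K)"
  proof (intro sum_mono)
    fix K assume K: "K \<in> U"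
    have "(\<Sum>J\<in>U. (\<Sum>L\<in>{K}. 1 * t J L)\<^sup>2) \<le> (C * a powr (1 / q) * (\<Sum>K\<in>{K}. node_len K) powr (1 / p)) * (C * (\<Sum>K\<in>{K}. node_len K) powr (1 / p))"
      by (rule row_square_sum_le[OF U disjoint_single[OF UN[OF K]]]) (use a in auto)
    also have "\<dots> = C\<^sup>2 * a powr (1 / q) * (node_len K powr (2 / p))"
      by (simp add: power2_eq_square mult_ac flip: powr_add)
    also have "\<dots> \<le> C\<^sup>2 * a powr (1 / q) * (node_len K powr 1)"
      using \<open>p \<le> 2\<close> p node_len_le_1[of K] by (intro mult_left_mono powr_mono') auto
    finally show "(\<Sum>J\<in>U. (\<Sum>L\<in>{K}. 1 * t J L)\<^sup>2) \<le> C\<^sup>2 * a powr (1 / q) * node_len K"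
      using node_len_pos[of K] by simp
  qed
  also have "\<dots> = C\<^sup>2 * a powr (1 / q) * (\<Sum>K\<in>U. node_len K)" by (simp add: sum_distrib_left)
  also have "\<dots> \<le> C\<^sup>2 * a powr (1 / q) * 1"
    using sum_node_len_le_1[OF U] by (intro mult_left_mono) auto
  finally show ?thesis by simp
qed

text \<open>One of the two conjugate exponents is at most 2, so \<open>square_sum_le_aux\<close>
  applies to t or to its transpose.\<close>

lemma square_sum_le:
  assumes U: "disjoint_nodes N U" and a: "\<And>J. J \<in> U \<Longrightarrow> node_len J \<le> a"
  shows "(\<Sum>J\<in>U. \<Sum>K\<in>U. (t J K)\<^sup>2) \<le> C\<^sup>2 * (a powr (1 / p) + a powr (1 / q))"
proof (cases "p \<le> 2")
  case True
  have "C\<^sup>2 * a powr (1 / q) \<le> C\<^sup>2 * (a powr (1 / p) + a powr (1 / q))" by (intro mult_left_mono) auto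
  then show ?thesis using square_sum_le_aux[OF U a True] by linarith
next
  case False
  have "q \<le> 2"
  proof -
    have "1 / p \<le> 1 / 2" using False by (intro divide_left_mono) auto
    then have "1/2 \<le> 1 / q" using pq by linarith
    then show ?thesis using q by (simp add: field_simps)
  qed
  then have "(\<Sum>J\<in>U. \<Sum>K\<in>U. (t K J)\<^sup>2) \<le> C\<^sup>2 * a powr (1 / p)"
    by (intro haar_block.square_sum_le_aux[OF transpose] U a)
  also have "\<dots> \<le> C\<^sup>2 * (a powr (1 / p) + a powr (1 / q))" by (intro mult_left_mono) auto
  finally show ?thesis by (subst sum.swap)
qed

end

section \<open>Waves on nodes of prescribed ranks\<close>

definition rank_wave :: "nat \<Rightarrow> (nat \<times> nat \<Rightarrow> bool) \<Rightarrow> (nat \<Rightarrow> nat) \<Rightarrow> (nat \<Rightarrow> nat \<times> nat \<Rightarrow> real) \<Rightarrow> nat \<Rightarrow> nat \<Rightarrow> real" where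
  "rank_wave N Q \<rho> e i y = (\<Sum>J\<in>rank_nodes N Q (\<rho> i). e i J * leaf_haar N J y)"

definition node_rep :: "nat \<Rightarrow> nat \<times> nat \<Rightarrow> nat" where
  "node_rep N J = (SOME y. y < 2 ^ N \<and> leaf_node N (fst J) y = J)"

lemma node_rep:
  assumes "J \<in> nodes N"
  shows "node_rep N J < 2 ^ N" "leaf_node N (fst J) (node_rep N J) = J"
proof -
  have "\<exists>y. y < 2 ^ N \<and> leaf_node N (fst J) y = J" using nodes_cases_leaf[OF assms] by blast
  from someI_ex[OF this] show "node_rep N J < 2 ^ N" "leaf_node N (fst J) (node_rep N J) = J"
    by (auto simp: node_rep_def)
qed

text \<open>On a node of rank \<open>\<rho> k\<close> the kernel of length k is constant when the
  ranks increase, see \<open>ker_eq_node_ker\<close>; its value is read off at one leaf below the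
  node.\<close>

definition node_ker :: "nat \<Rightarrow> (nat \<times> nat \<Rightarrow> bool) \<Rightarrow> (nat \<Rightarrow> nat) \<Rightarrow> (nat \<Rightarrow> nat \<times> nat \<Rightarrow> real) \<Rightarrow> nat \<Rightarrow> nat \<Rightarrow> nat \<times> nat \<Rightarrow> real" where
  "node_ker N Q \<rho> e k a J = ker (rank_wave N Q \<rho> e) k (node_rep N J) a"

lemma abs_rank_wave_le:
  assumes "\<And>i J. \<bar>e i J\<bar> = 1" "y < 2 ^ N"
  shows "\<bar>rank_wave N Q \<rho> e i y\<bar> \<le> 1"
  unfolding rank_wave_def using assms
  by (intro sum_leaf_haar_abs_le[OF disjoint_rank_nodes]) auto

text \<open>A leaf below J has passed exactly one node of the smaller rank \<open>\<rho> i\<close>,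
  a strict ancestor of J. There wave i is a sign times a digit of the leaf, and this digit is
  already determined by J.\<close>

lemma rank_wave_on_node:
  assumes e: "\<And>i J. \<bar>e i J\<bar> = 1" and J: "J \<in> rank_nodes N Q r" and lt: "\<rho> i < r"
    and y: "y < 2 ^ N" "leaf_node N (fst J) y = J" and z: "z < 2 ^ N" "leaf_node N (fst J) z = J"
  shows "\<bar>rank_wave N Q \<rho> e i y\<bar> = 1" "rank_wave N Q \<rho> e i z = rank_wave N Q \<rho> e i y"
proof -
  have lev: "fst J < N" using J rank_nodesD(1) nodes_level by blast
  have "leaf_rank N Q (fst J) y = r" using J y by (auto simp: rank_nodes_def)
  then obtain k where k: "k < fst J" "Q (leaf_node N k y)" "leaf_rank N Q k y = \<rho> i"
    using leaf_rank_hit[of "\<rho> i" N Q "fst J" y] lt by auto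
  define K where "K = leaf_node N k y"
  have K: "K \<in> rank_nodes N Q (\<rho> i)" using k lev y by (simp add: K_def leaf_node_rank_iff)
  have yz: "leaf_node N (fst J) y = leaf_node N (fst J) z" using y z by simp
  have Kz: "leaf_node N k z = K" using leaf_node_eq_lower[OF yz, of k] k lev by (simp add: K_def)
  have wave: "rank_wave N Q \<rho> e i x = e i K * leaf_bit N k x" if "x < 2 ^ N" "leaf_node N k x = K" for x
  proof -
    have fK: "fst K = k" by (simp add: K_def)
    have "rank_wave N Q \<rho> e i x = e i K * leaf_haar N K x"
      unfolding rank_wave_def using that fK
      by (intro sum_disjoint_nodes[OF disjoint_rank_nodes _ K]) (auto simp: leaf_haar_def)
    then show ?thesis using that fK by (simp add: leaf_haar_def)
  qed
  show "\<bar>rank_wave N Q \<rho> e i y\<bar> = 1" using wave[OF y(1)] e by (simp add: K_def abs_mult)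
  show "rank_wave N Q \<rho> e i z = rank_wave N Q \<rho> e i y"
    using wave[OF y(1)] wave[OF z(1) Kz] leaf_bit_eq_lower[OF yz k(1)] lev by (simp add: K_def)
qed

lemma ker_eq_node_ker:
  assumes e: "\<And>i J. \<bar>e i J\<bar> = 1" and J: "J \<in> rank_nodes N Q (\<rho> k)" and lt: "\<And>i. i < k \<Longrightarrow> \<rho> i < \<rho> k"
    and y: "y < 2 ^ N" "leaf_node N (fst J) y = J"
  shows "ker (rank_wave N Q \<rho> e) k y a = node_ker N Q \<rho> e k a J"
  unfolding node_ker_def
  using rank_wave_on_node(2)[where \<rho>=\<rho> and e=e, OF e J lt node_rep[OF rank_nodesD(1)[OF J]] y] by (intro ker_cong) auto

lemma node_ker_bounds:
  assumes e: "\<And>i J. \<bar>e i J\<bar> = 1" and J: "J \<in> nodes N"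
  shows "0 \<le> node_ker N Q \<rho> e k a J" "node_ker N Q \<rho> e k a J \<le> 1"
  unfolding node_ker_def
  using ker_bounds[of k "rank_wave N Q \<rho> e" "node_rep N J" a] abs_rank_wave_le[OF e node_rep(1)[OF J]] by auto

text \<open>The earlier waves are signs on J, so the path leading there is deterministic. Distinct
  paths of equal length therefore use disjoint sets of nodes, and the diagonal entries of t survive
  only for a = b.\<close>

lemma node_ker_products:
  assumes e: "\<And>i J. \<bar>e i J\<bar> = 1" and J: "J \<in> rank_nodes N Q (\<rho> k)" and lt: "\<And>i. i < k \<Longrightarrow> \<rho> i < \<rho> k"
    and ab: "a < 2 ^ k" "b < 2 ^ k"
  shows "node_ker N Q \<rho> e k a J * node_ker N Q \<rho> e k b J = (if a = b then node_ker N Q \<rho> e k a J else 0)"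
proof -
  note z = node_rep[OF rank_nodesD(1)[OF J]]
  have "\<bar>rank_wave N Q \<rho> e i (node_rep N J)\<bar> = 1" if "i < k" for i
    using rank_wave_on_node(1)[where \<rho>=\<rho> and e=e, OF e J lt[OF that] z z] .
  then show ?thesis unfolding node_ker_def using ab by (auto simp: ker_idem ker_orth)
qed

text \<open>The kernel of length k involves the signs of earlier generations only; this permits
  choosing signs one generation at a time.\<close>

lemma node_ker_cong:
  assumes "\<And>i. i < k \<Longrightarrow> e i = e' i"
  shows "node_ker N Q \<rho> e k a J = node_ker N Q \<rho> e' k a J"
  unfolding node_ker_def using assms by (intro ker_cong) (simp add: rank_wave_def)

lemma ker_rank_wave_cong:
  assumes "\<And>i. i < k \<Longrightarrow> e i = e' i"
  shows "ker (rank_wave N Q \<rho> e) k y a = ker (rank_wave N Q \<rho> e') k y a"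
  using assms by (intro ker_cong) (simp add: rank_wave_def)

section \<open>Almost diagonalising a single block\<close>

context haar_block
begin

text \<open>A density for the diagonal: its average over all leaves is the sum of
  \<open>t J J\<close> over the given rank, and its average against a kernel is the share of this
  mass that belongs to one path.\<close>

definition diag_wave :: "(nat \<times> nat \<Rightarrow> bool) \<Rightarrow> nat \<Rightarrow> nat \<Rightarrow> real" where
  "diag_wave Q r y = (\<Sum>J\<in>rank_nodes N Q r. t J J / node_len J * \<bar>leaf_haar N J y\<bar>)"

text \<open>The first three bounds make the off-diagonal entries small, within generation \<open>k\<close> and between
  generation \<open>k\<close> and the earlier ones. The last one says that generation \<open>k\<close> nearly halves the mass of the
  diagonal entries of each later generation, so that finally these entries depend on the generation only.\<close>
definition step_ok :: "(nat \<times> nat \<Rightarrow> bool) \<Rightarrow> (nat \<Rightarrow> nat) \<Rightarrow> nat \<Rightarrow> real \<Rightarrow> (nat \<Rightarrow> nat \<times> nat \<Rightarrow> real) \<Rightarrow> nat \<Rightarrow> bool" where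
  "step_ok Q \<rho> n \<eta> e k \<longleftrightarrow>
    (\<forall>a<2^n. \<forall>b<2^n. \<bar>\<Sum>J\<in>rank_nodes N Q (\<rho> k). \<Sum>K\<in>rank_nodes N Q (\<rho> k) - {J}.
        node_ker N Q \<rho> e k a J * node_ker N Q \<rho> e k b K * t J K * (e k J * e k K)\<bar> \<le> \<eta>) \<and>
    (\<forall>j<k. \<forall>a<2^n. \<forall>b<2^n. \<bar>\<Sum>J\<in>rank_nodes N Q (\<rho> k).
        node_ker N Q \<rho> e k a J * (\<Sum>K\<in>rank_nodes N Q (\<rho> j). node_ker N Q \<rho> e j b K * e j K * t J K) * e k J\<bar> \<le> \<eta>) \<and>
    (\<forall>j<k. \<forall>a<2^n. \<forall>b<2^n. \<bar>\<Sum>J\<in>rank_nodes N Q (\<rho> k).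
        node_ker N Q \<rho> e k a J * (\<Sum>K\<in>rank_nodes N Q (\<rho> j). node_ker N Q \<rho> e j b K * e j K * t K J) * e k J\<bar> \<le> \<eta>) \<and>
    (\<forall>j<n. \<forall>a<2^n. \<bar>\<Sum>J\<in>rank_nodes N Q (\<rho> k).
        leaf_avg N (\<lambda>y. ker (rank_wave N Q \<rho> e) k y a * leaf_haar N J y * diag_wave Q (\<rho> j) y) * e k J\<bar> \<le> \<eta>)"

lemma abs_diag_wave_le:
  assumes "y < 2 ^ N"
  shows "\<bar>diag_wave Q r y\<bar> \<le> C"
  unfolding diag_wave_def
proof (rule sum_leaf_haar_abs_le(2)[OF disjoint_rank_nodes assms _ C])
  fix J assume "J \<in> rank_nodes N Q r"
  then have "\<bar>t J J\<bar> \<le> C * node_len J" using diag_le rank_nodesD(1) by blast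
  then show "\<bar>t J J / node_len J\<bar> \<le> C" using node_len_pos[of J] by (simp add: abs_divide pos_divide_le_eq)
qed

lemma step_ok_cong:
  assumes "\<And>i. i \<le> k \<Longrightarrow> e i = e' i"
  shows "step_ok Q \<rho> n \<eta> e k \<longleftrightarrow> step_ok Q \<rho> n \<eta> e' k"
proof -
  have 1: "e k = e' k" using assms by simp
  have 2: "node_ker N Q \<rho> e k a J = node_ker N Q \<rho> e' k a J" for a J
    using assms by (intro node_ker_cong) simp
  have 3: "ker (rank_wave N Q \<rho> e) k y a = ker (rank_wave N Q \<rho> e') k y a" for y a
    using assms by (intro ker_rank_wave_cong) simp
  have 4: "node_ker N Q \<rho> e j a J = node_ker N Q \<rho> e' j a J" "e j = e' j" if "j < k" for a J j
    using assms that by (auto intro!: node_ker_cong)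
  show ?thesis unfolding step_ok_def 1 2 3 using 4 by (simp cong: conj_cong)
qed

text \<open>Every quantity in \<open>step_ok\<close> is a linear or quadratic form in the new signs
  with small second moment, so \<open>exists_signs\<close> handles all of them together. In the
  hypothesis \<open>small\<close>, the factor 4 * 2 ^ n * real n * 2 ^ n counts the forms and the
  remaining factor bounds each second moment.\<close>

lemma exists_step:
  assumes e: "\<And>i J. \<bar>e i J\<bar> = 1" and k: "k < n" and r0: "\<And>i. i < n \<Longrightarrow> r0 \<le> \<rho> i"
    and small: "4 * 2 ^ n * real n * 2 ^ n * (2 * C\<^sup>2 * (((1/2) ^ r0) powr (1 / p) + ((1/2) ^ r0) powr (1 / q))) \<le> \<eta>\<^sup>2"
    and \<eta>: "0 < \<eta>"
  shows "\<exists>f. (\<forall>J. \<bar>f J\<bar> = 1) \<and> step_ok Q \<rho> n \<eta> (e(k := f)) k"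
proof -
  define P where "P i = rank_nodes N Q (\<rho> i)" for i
  define \<kappa> where "\<kappa> = node_ker N Q \<rho> e"
  define d :: real where "d = (1/2) ^ r0"
  have d: "0 < d" "d \<le> 1" by (auto simp: d_def power_le_one)
  define v where "v = 2 * C\<^sup>2 * (d powr (1 / p) + d powr (1 / q))"
  have Pdis: "disjoint_nodes N (P i)" for i by (simp add: P_def disjoint_rank_nodes)
  have PN: "J \<in> nodes N" if "J \<in> P i" for i J using that rank_nodesD(1) by (auto simp: P_def)
  have Plen: "node_len J \<le> d" if "J \<in> P k" for J
    using that node_len_rank_le[OF _ r0[OF k]] by (auto simp: P_def d_def)
  have [simp]: "finite (P i)" for i by (simp add: P_def)
  have \<kappa>: "0 \<le> \<kappa> i a J" "\<kappa> i a J \<le> 1" if "J \<in> nodes N" for i a J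
    using node_ker_bounds[of e, OF e that] by (auto simp: \<kappa>_def)
  \<comment> \<open>The tag g selects one of the four families in \<open>step_ok\<close>: 0 is the
    quadratic one, with coefficients m; 1 and 2 are rows and columns against earlier generations; 3
    is the diagonal mass.\<close>
  define l :: "nat \<times> nat \<times> nat \<times> nat \<Rightarrow> nat \<times> nat \<Rightarrow> real" where
    "l = (\<lambda>(g, a, j, b) J.
      if g = 1 then \<kappa> k a J * (\<Sum>K\<in>P j. \<kappa> j b K * e j K * t J K)
      else if g = 2 then \<kappa> k a J * (\<Sum>K\<in>P j. \<kappa> j b K * e j K * t K J)
      else if g = 3 then leaf_avg N (\<lambda>y. ker (rank_wave N Q \<rho> e) k y a * leaf_haar N J y * diag_wave Q (\<rho> j) y)
      else 0)"
  define m :: "nat \<times> nat \<times> nat \<times> nat \<Rightarrow> nat \<times> nat \<Rightarrow> nat \<times> nat \<Rightarrow> real" where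
    "m = (\<lambda>(g, a, j, b) J K. if g = 0 then \<kappa> k a J * \<kappa> k b K * t J K else 0)"
  define A :: "(nat \<times> nat \<times> nat \<times> nat) set" where "A = {..<4} \<times> {..<2^n} \<times> {..<n} \<times> {..<2^n}"
  have sq\<kappa>: "(\<kappa> k a J * x)\<^sup>2 \<le> x\<^sup>2" if "J \<in> P k" for a J x
  proof -
    have "(\<kappa> k a J)\<^sup>2 \<le> 1" using \<kappa>[OF PN[OF that]] by (simp add: power_le_one)
    then show ?thesis by (simp add: power_mult_distrib mult_left_le_one_le)
  qed
  have dq: "0 \<le> C\<^sup>2 * d powr (1/p)" "0 \<le> C\<^sup>2 * d powr (1/q)" by auto
  have l1: "(\<Sum>J\<in>P k. (\<kappa> k a J * (\<Sum>K\<in>P j. \<kappa> j b K * e j K * t J K))\<^sup>2) \<le> v" 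
    and l2: "(\<Sum>J\<in>P k. (\<kappa> k a J * (\<Sum>K\<in>P j. \<kappa> j b K * e j K * t K J))\<^sup>2) \<le> v" for a j b
  proof -
    define u where "u K = (if K \<in> P j then \<kappa> j b K * e j K else 0)" for K
    have u: "\<bar>u K\<bar> \<le> 1" for K using \<kappa>[OF PN, of K j] e by (auto simp: u_def abs_mult)
    have "(\<Sum>J\<in>P k. (\<kappa> k a J * (\<Sum>K\<in>P j. \<kappa> j b K * e j K * t J K))\<^sup>2) \<le> (\<Sum>J\<in>P k. (\<Sum>K\<in>P j. u K * t J K)\<^sup>2)"
      by (intro sum_mono order_trans[OF sq\<kappa>]) (auto simp: u_def)
    also have "\<dots> \<le> C\<^sup>2 * d powr (1 / q)" by (rule row_square_sum_le'[OF Pdis Pdis u Plen])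
    also have "\<dots> \<le> v" using dq by (simp add: v_def algebra_simps)
    finally show "(\<Sum>J\<in>P k. (\<kappa> k a J * (\<Sum>K\<in>P j. \<kappa> j b K * e j K * t J K))\<^sup>2) \<le> v" .
    have "(\<Sum>J\<in>P k. (\<kappa> k a J * (\<Sum>K\<in>P j. \<kappa> j b K * e j K * t K J))\<^sup>2) \<le> (\<Sum>J\<in>P k. (\<Sum>K\<in>P j. u K * t K J)\<^sup>2)"
      by (intro sum_mono order_trans[OF sq\<kappa>]) (auto simp: u_def)
    also have "\<dots> \<le> C\<^sup>2 * d powr (1 / p)" by (rule haar_block.row_square_sum_le'[OF transpose Pdis Pdis u Plen])
    also have "\<dots> \<le> v" using dq by (simp add: v_def algebra_simps)
    finally show "(\<Sum>J\<in>P k. (\<kappa> k a J * (\<Sum>K\<in>P j. \<kappa> j b K * e j K * t K J))\<^sup>2) \<le> v" .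
  qed
  have l3: "(\<Sum>J\<in>P k. (leaf_avg N (\<lambda>y. ker (rank_wave N Q \<rho> e) k y a * leaf_haar N J y * diag_wave Q (\<rho> j) y))\<^sup>2) \<le> v" for a j
  proof -
    have le: "\<bar>leaf_avg N (\<lambda>y. ker (rank_wave N Q \<rho> e) k y a * leaf_haar N J y * diag_wave Q (\<rho> j) y)\<bar> \<le> C * node_len J"
      if J: "J \<in> P k" for J
    proof -
      have "\<bar>leaf_avg N (\<lambda>y. ker (rank_wave N Q \<rho> e) k y a * leaf_haar N J y * diag_wave Q (\<rho> j) y)\<bar>
        \<le> leaf_avg N (\<lambda>y. \<bar>ker (rank_wave N Q \<rho> e) k y a * leaf_haar N J y * diag_wave Q (\<rho> j) y\<bar>)"
        by (rule abs_leaf_avg_le)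
      also have "\<dots> \<le> leaf_avg N (\<lambda>y. C * \<bar>leaf_haar N J y\<bar>)"
      proof (rule leaf_avg_mono)
        fix y :: nat assume y: "y < 2 ^ N"
        have "\<bar>ker (rank_wave N Q \<rho> e) k y a\<bar> \<le> 1"
          using ker_bounds[of k "rank_wave N Q \<rho> e" y a] abs_rank_wave_le[OF e y] by auto
        then have "\<bar>ker (rank_wave N Q \<rho> e) k y a\<bar> * \<bar>leaf_haar N J y\<bar> * \<bar>diag_wave Q (\<rho> j) y\<bar> \<le> 1 * \<bar>leaf_haar N J y\<bar> * C"
          using abs_diag_wave_le[OF y] C by (intro mult_mono) auto
        then show "\<bar>ker (rank_wave N Q \<rho> e) k y a * leaf_haar N J y * diag_wave Q (\<rho> j) y\<bar> \<le> C * \<bar>leaf_haar N J y\<bar>"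
          by (simp add: abs_mult mult_ac)
      qed
      also have "\<dots> = C * node_len J" using leaf_avg_haar_node(1)[OF PN[OF J]] by (simp add: leaf_avg_mult)
      finally show ?thesis .
    qed
    have "(\<Sum>J\<in>P k. (leaf_avg N (\<lambda>y. ker (rank_wave N Q \<rho> e) k y a * leaf_haar N J y * diag_wave Q (\<rho> j) y))\<^sup>2) \<le> (C * d) * (C * 1)"
    proof (rule sum_square_le)
      fix J assume J: "J \<in> P k"
      have "C * node_len J \<le> C * d" using Plen[OF J] C by (intro mult_left_mono)
      then show "\<bar>leaf_avg N (\<lambda>y. ker (rank_wave N Q \<rho> e) k y a * leaf_haar N J y * diag_wave Q (\<rho> j) y)\<bar> \<le> C * d"
        using le[OF J] by linarith
    next
      have "(\<Sum>J\<in>P k. \<bar>leaf_avg N (\<lambda>y. ker (rank_wave N Q \<rho> e) k y a * leaf_haar N J y * diag_wave Q (\<rho> j) y)\<bar>) \<le> (\<Sum>J\<in>P k. C * node_len J)"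
        by (intro sum_mono le)
      also have "\<dots> \<le> C * 1" unfolding sum_distrib_left[symmetric] using sum_node_len_le_1[OF Pdis] C by (intro mult_left_mono)
      finally show "(\<Sum>J\<in>P k. \<bar>leaf_avg N (\<lambda>y. ker (rank_wave N Q \<rho> e) k y a * leaf_haar N J y * diag_wave Q (\<rho> j) y)\<bar>) \<le> C * 1" .
    qed (use C d in auto)
    also have "\<dots> = C\<^sup>2 * d powr 1" using d by (simp add: power2_eq_square)
    also have "\<dots> \<le> C\<^sup>2 * d powr (1 / p)" using d p by (intro mult_left_mono powr_mono') auto
    also have "\<dots> \<le> v" using dq by (simp add: v_def algebra_simps)
    finally show ?thesis .
  qed
  have q0: "2 * (\<Sum>J\<in>P k. \<Sum>K\<in>P k - {J}. (\<kappa> k a J * \<kappa> k b K * t J K)\<^sup>2) \<le> v" for a b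
  proof -
    have "(\<Sum>J\<in>P k. \<Sum>K\<in>P k - {J}. (\<kappa> k a J * \<kappa> k b K * t J K)\<^sup>2) \<le> (\<Sum>J\<in>P k. \<Sum>K\<in>P k - {J}. (t J K)\<^sup>2)"
      by (intro sum_mono) (auto simp: mult.assoc intro!: order_trans[OF sq\<kappa>])
    also have "\<dots> \<le> (\<Sum>J\<in>P k. \<Sum>K\<in>P k. (t J K)\<^sup>2)"
      by (intro sum_mono sum_mono2) auto
    also have "\<dots> \<le> C\<^sup>2 * (d powr (1 / p) + d powr (1 / q))"
      by (rule square_sum_le[OF Pdis Plen])
    finally show ?thesis by (simp add: v_def)
  qed
  have v0: "0 \<le> v" by (simp add: v_def)
  have var: "0\<^sup>2 + (\<Sum>J\<in>P k. (l \<alpha> J)\<^sup>2) + 2 * (\<Sum>J\<in>P k. \<Sum>K\<in>P k - {J}. (m \<alpha> J K)\<^sup>2) \<le> v" for \<alpha>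
  proof -
    obtain g a j b where \<alpha>: "\<alpha> = (g, a, j, b)" by (metis prod_cases4)
    consider "g = 0" | "g = 1" | "g = 2" | "g = 3" | "g > 3" by linarith
    then show ?thesis
      using l1[of a j b] l2[of a j b] l3[of a j] q0[of a b] v0 by cases (auto simp: l_def m_def \<alpha>)
  qed
  obtain f where f: "\<forall>J. f J = 1 \<or> f J = (-1::real)" and
    le: "(\<Sum>\<alpha>\<in>A. (0 + (\<Sum>J\<in>P k. l \<alpha> J * f J) + (\<Sum>J\<in>P k. \<Sum>K\<in>P k - {J}. m \<alpha> J K * (f J * f K)))\<^sup>2)
    \<le> (\<Sum>\<alpha>\<in>A. 0\<^sup>2 + (\<Sum>J\<in>P k. (l \<alpha> J)\<^sup>2) + 2 * (\<Sum>J\<in>P k. \<Sum>K\<in>P k - {J}. (m \<alpha> J K)\<^sup>2))"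
    using exists_signs[of "P k" A "\<lambda>_. 0" l m] by (auto simp: A_def)
  have "(\<Sum>\<alpha>\<in>A. (0 + (\<Sum>J\<in>P k. l \<alpha> J * f J) + (\<Sum>J\<in>P k. \<Sum>K\<in>P k - {J}. m \<alpha> J K * (f J * f K)))\<^sup>2) \<le> (\<Sum>\<alpha>\<in>A. v)"
    by (rule order_trans[OF le]) (intro sum_mono var)
  also have "\<dots> \<le> \<eta>\<^sup>2" using small by (simp add: A_def card_cartesian_product v_def d_def mult_ac)
  finally have tot: "(\<Sum>\<alpha>\<in>A. ((\<Sum>J\<in>P k. l \<alpha> J * f J) + (\<Sum>J\<in>P k. \<Sum>K\<in>P k - {J}. m \<alpha> J K * (f J * f K)))\<^sup>2) \<le> \<eta>\<^sup>2" by simp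
  have form: "\<bar>(\<Sum>J\<in>P k. l \<alpha> J * f J) + (\<Sum>J\<in>P k. \<Sum>K\<in>P k - {J}. m \<alpha> J K * (f J * f K))\<bar> \<le> \<eta>" if "\<alpha> \<in> A" for \<alpha>
  proof -
    have "((\<Sum>J\<in>P k. l \<alpha> J * f J) + (\<Sum>J\<in>P k. \<Sum>K\<in>P k - {J}. m \<alpha> J K * (f J * f K)))\<^sup>2 \<le> \<eta>\<^sup>2"
      by (rule order_trans[OF _ tot], rule member_le_sum[OF that]) (auto simp: A_def)
    then show ?thesis using \<eta> by (simp add: abs_le_square_iff[symmetric])
  qed
  define e' where "e' = e(k := f)"
  have e'k: "e' k = f" by (simp add: e'_def)
  have e'j: "e' j = e j" if "j < k" for j using that by (simp add: e'_def)
  have \<kappa>': "node_ker N Q \<rho> e' j a J = \<kappa> j a J" if "j \<le> k" for j a J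
    unfolding \<kappa>_def using that by (intro node_ker_cong) (simp add: e'_def)
  have ker': "ker (rank_wave N Q \<rho> e') k y a = ker (rank_wave N Q \<rho> e) k y a" for y a
    by (intro ker_rank_wave_cong) (simp add: e'_def)
  have "step_ok Q \<rho> n \<eta> e' k"
    unfolding step_ok_def P_def[symmetric] e'k ker'
  proof (intro conjI allI impI)
    fix a b :: nat assume "a < 2^n" "b < 2^n"
    then show "\<bar>\<Sum>J\<in>P k. \<Sum>K\<in>P k - {J}. node_ker N Q \<rho> e' k a J * node_ker N Q \<rho> e' k b K * t J K * (f J * f K)\<bar> \<le> \<eta>"
      using form[of "(0, a, 0, b)"] k by (simp add: \<kappa>' l_def m_def A_def)
  next
    fix j a b :: nat assume "j < k" "a < 2^n" "b < 2^n"
    then show "\<bar>\<Sum>J\<in>P k. node_ker N Q \<rho> e' k a J * (\<Sum>K\<in>P j. node_ker N Q \<rho> e' j b K * e' j K * t J K) * f J\<bar> \<le> \<eta>"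
      using form[of "(1, a, j, b)"] k by (simp add: \<kappa>' e'j l_def m_def A_def)
  next
    fix j a b :: nat assume "j < k" "a < 2^n" "b < 2^n"
    then show "\<bar>\<Sum>J\<in>P k. node_ker N Q \<rho> e' k a J * (\<Sum>K\<in>P j. node_ker N Q \<rho> e' j b K * e' j K * t K J) * f J\<bar> \<le> \<eta>"
      using form[of "(2, a, j, b)"] k by (simp add: \<kappa>' e'j l_def m_def A_def)
  next
    fix j a :: nat assume "j < n" "a < 2^n"
    then show "\<bar>\<Sum>J\<in>P k. leaf_avg N (\<lambda>y. ker (rank_wave N Q \<rho> e) k y a * leaf_haar N J y * diag_wave Q (\<rho> j) y) * f J\<bar> \<le> \<eta>"
      using form[of "(3, a, j, 0)"] k by (simp add: l_def m_def A_def)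
  qed
  then show ?thesis using f unfolding e'_def by (intro exI[of _ f]) (metis abs_1 abs_minus_cancel)
qed

text \<open>Signs of later generations leave the conditions of earlier ones untouched, by
  \<open>step_ok_cong\<close>.\<close>

lemma exists_all_steps:
  assumes r0: "\<And>i. i < n \<Longrightarrow> r0 \<le> \<rho> i"
    and small: "4 * 2 ^ n * real n * 2 ^ n * (2 * C\<^sup>2 * (((1/2) ^ r0) powr (1 / p) + ((1/2) ^ r0) powr (1 / q))) \<le> \<eta>\<^sup>2"
    and \<eta>: "0 < \<eta>"
  shows "\<exists>e. (\<forall>i J. \<bar>e i J\<bar> = 1) \<and> (\<forall>k<n. step_ok Q \<rho> n \<eta> e k)"
proof -
  have "\<exists>e. (\<forall>i J. \<bar>e i J\<bar> = 1) \<and> (\<forall>k<m. step_ok Q \<rho> n \<eta> e k)" if "m \<le> n" for m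
    using that
  proof (induction m)
    case 0
    then show ?case by (intro exI[of _ "\<lambda>_ _. 1"]) simp
  next
    case (Suc m)
    then obtain e where e: "\<And>i J. \<bar>e i J\<bar> = 1" "\<And>k. k < m \<Longrightarrow> step_ok Q \<rho> n \<eta> e k" by auto
    obtain f where f: "\<And>J. \<bar>f J\<bar> = 1" "step_ok Q \<rho> n \<eta> (e(m := f)) m"
      using exists_step[of e m n r0 \<rho> \<eta> Q] e(1) r0 small \<eta> Suc.prems by (metis Suc_le_lessD)
    have "step_ok Q \<rho> n \<eta> (e(m := f)) k" if "k < Suc m" for k
    proof (cases "k = m")
      case False
      then have "step_ok Q \<rho> n \<eta> (e(m := f)) k \<longleftrightarrow> step_ok Q \<rho> n \<eta> e k"
        using that by (intro step_ok_cong) auto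
      then show ?thesis using e that False by simp
    qed (use f in simp)
    moreover have "\<forall>i J. \<bar>(e(m := f)) i J\<bar> = 1" using e f by simp
    ultimately show ?case by blast
  qed
  then show ?thesis by blast
qed

text \<open>Three errors of size \<eta> meet on the diagonal: the remaining off-diagonal sum, the
  uneven splitting of mass among the paths, and the distance of the total mass from c.\<close>

lemma good_block_of_steps:
  assumes e: "\<And>i J. \<bar>e i J\<bar> = 1" and ok: "\<And>k. k < n \<Longrightarrow> step_ok Q \<rho> n \<eta> e k"
    and \<rho>: "\<And>i j. i < j \<Longrightarrow> j < n \<Longrightarrow> \<rho> i < \<rho> j" and \<eta>: "0 < \<eta>"
    and c: "\<And>i. i < n \<Longrightarrow> \<bar>(\<Sum>J\<in>rank_nodes N Q (\<rho> i). t J J) - c\<bar> \<le> \<eta>"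
  shows "\<exists>\<beta>. good_block n (3 * \<eta>) c N t (rank_wave N Q \<rho> e) \<beta>"
proof -
  define P where "P i = rank_nodes N Q (\<rho> i)" for i
  define \<kappa> where "\<kappa> = node_ker N Q \<rho> e"
  define w where "w = rank_wave N Q \<rho> e"
  define \<beta> where "\<beta> I J = (if J \<in> P (fst I) then \<kappa> (fst I) (snd I - 1) J * e (fst I) J else 0)" for I J
  have PN: "P i \<subseteq> nodes N" for i using rank_nodes_subset by (auto simp: P_def)
  have ker\<kappa>: "ker w k y a = \<kappa> k a J" if "J \<in> P k" "k < n" "y < 2 ^ N" "leaf_node N (fst J) y = J" for k y a J
    using ker_eq_node_ker[of e J N Q \<rho> k y a, OF e] that \<rho> by (simp add: w_def \<kappa>_def P_def)
  have nodesn: "fst I < n" "snd I - 1 < 2 ^ fst I" "snd I - 1 < 2 ^ n" "1 \<le> snd I" if "I \<in> nodes n" for I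
  proof -
    have *: "fst I < n" "1 \<le> snd I" "snd I \<le> 2 ^ fst I" using that by (auto simp: nodes_def)
    have "(2::nat) ^ fst I \<le> 2 ^ n" using * by (intro power_increasing) auto
    then show "fst I < n" "snd I - 1 < 2 ^ fst I" "snd I - 1 < 2 ^ n" "1 \<le> snd I" using * by linarith+
  qed
  have wave: "ker w (fst I) y (snd I - 1) * w (fst I) y = (\<Sum>J\<in>nodes N. \<beta> I J * leaf_haar N J y)"
    if I: "I \<in> nodes n" and y: "y < 2 ^ N" for I y
  proof -
    have "ker w (fst I) y (snd I - 1) * w (fst I) y = (\<Sum>J\<in>P (fst I). ker w (fst I) y (snd I - 1) * (e (fst I) J * leaf_haar N J y))"
      by (simp add: w_def rank_wave_def P_def sum_distrib_left)
    also have "\<dots> = (\<Sum>J\<in>P (fst I). \<beta> I J * leaf_haar N J y)"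
    proof (intro sum.cong refl)
      fix J assume J: "J \<in> P (fst I)"
      show "ker w (fst I) y (snd I - 1) * (e (fst I) J * leaf_haar N J y) = \<beta> I J * leaf_haar N J y"
        using ker\<kappa>[OF J nodesn(1)[OF I] y] J
        by (cases "leaf_node N (fst J) y = J") (auto simp: \<beta>_def leaf_haar_def)
    qed
    also have "\<dots> = (\<Sum>J\<in>nodes N. \<beta> I J * leaf_haar N J y)"
      by (rule sum.mono_neutral_left[OF finite_nodes PN]) (auto simp: \<beta>_def)
    finally show ?thesis .
  qed
  define X where "X k a k' b = (\<Sum>J\<in>P k. \<Sum>K\<in>P k'. (\<kappa> k a J * e k J) * (\<kappa> k' b K * e k' K) * t J K)" for k a k' b
  have entry: "(\<Sum>J\<in>nodes N. \<Sum>K\<in>nodes N. \<beta> I J * \<beta> I' K * t J K) = X (fst I) (snd I - 1) (fst I') (snd I' - 1)" for I I'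
  proof -
    have "(\<Sum>J\<in>nodes N. \<Sum>K\<in>nodes N. \<beta> I J * \<beta> I' K * t J K) = (\<Sum>J\<in>nodes N. \<Sum>K\<in>P (fst I'). \<beta> I J * \<beta> I' K * t J K)"
      by (intro sum.cong refl sum.mono_neutral_right[OF finite_nodes PN]) (auto simp: \<beta>_def)
    also have "\<dots> = (\<Sum>J\<in>P (fst I). \<Sum>K\<in>P (fst I'). \<beta> I J * \<beta> I' K * t J K)"
      by (rule sum.mono_neutral_right[OF finite_nodes PN]) (auto simp: \<beta>_def)
    also have "\<dots> = X (fst I) (snd I - 1) (fst I') (snd I' - 1)"
      unfolding X_def by (intro sum.cong refl) (auto simp: \<beta>_def)
    finally show ?thesis .
  qed
  \<comment> \<open>The diagonal mass of generation j that belongs to the path a of length k. By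
    \<open>Mstep\<close> it is nearly the fraction 1 / 2 ^ k of the whole.\<close>
  define M where "M k a j = leaf_avg N (\<lambda>y. ker w k y a * diag_wave Q (\<rho> j) y)" for k a j
  have Mstep: "\<bar>M k a j - (1 / 2 ^ k) * (\<Sum>J\<in>P j. t J J)\<bar> \<le> \<eta>" if "k \<le> n" "a < 2 ^ k" "j < n" for k a j
    using that(1,2)
  proof (induction k arbitrary: a)
    case 0
    have "M 0 a j = leaf_avg N (\<lambda>y. \<Sum>J\<in>P j. t J J / node_len J * \<bar>leaf_haar N J y\<bar>)"
      by (simp add: M_def diag_wave_def P_def)
    also have "\<dots> = (\<Sum>J\<in>P j. t J J / node_len J * node_len J)" by (rule sum_node_len_eq[symmetric, OF PN])
    also have "\<dots> = (\<Sum>J\<in>P j. t J J)"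
      by (intro sum.cong refl) (metis nonzero_eq_divide_eq node_len_pos less_numeral_extra(3) times_divide_eq_left)
    finally show ?case using \<eta> by simp
  next
    case (Suc k)
    define a' where "a' = a div 2"
    define Z where "Z = leaf_avg N (\<lambda>y. ker w k y a' * w k y * diag_wave Q (\<rho> j) y)"
    have a': "a' < 2 ^ k" using Suc.prems by (simp add: a'_def less_mult_imp_div_less)
    have a'n: "a' < 2 ^ n"
      using a' Suc.prems(1) power_increasing[of k n "2::nat"] by linarith
    have "M (Suc k) a j = leaf_avg N (\<lambda>y. 1/2 * (ker w k y a' * diag_wave Q (\<rho> j) y) + (if even a then 1/2 else -1/2) * (ker w k y a' * w k y * diag_wave Q (\<rho> j) y))"
      unfolding M_def by (intro leaf_avg_cong) (auto simp: field_simps a'_def)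
    also have "\<dots> = 1/2 * M k a' j + (if even a then 1/2 else -1/2) * Z"
      by (simp only: leaf_avg_add leaf_avg_mult M_def Z_def)
    finally have M: "M (Suc k) a j = 1/2 * M k a' j + (if even a then 1/2 else -1/2) * Z" .
    have "Z = leaf_avg N (\<lambda>y. \<Sum>J\<in>P k. e k J * (ker w k y a' * leaf_haar N J y * diag_wave Q (\<rho> j) y))"
      unfolding Z_def by (intro leaf_avg_cong) (simp add: w_def rank_wave_def P_def sum_distrib_left sum_distrib_right mult_ac)
    also have "\<dots> = (\<Sum>J\<in>P k. leaf_avg N (\<lambda>y. ker w k y a' * leaf_haar N J y * diag_wave Q (\<rho> j) y) * e k J)"
      by (simp only: leaf_avg_sum leaf_avg_mult mult.commute)
    finally have "\<bar>Z\<bar> \<le> \<eta>"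
      using ok[of k] Suc.prems(1) a'n \<open>j < n\<close> unfolding step_ok_def P_def[symmetric] w_def[symmetric] by auto
    moreover have "\<bar>M k a' j - (1 / 2 ^ k) * (\<Sum>J\<in>P j. t J J)\<bar> \<le> \<eta>"
      using Suc a' by simp
    \<comment> \<open>The error does not accumulate: the new one is half of the old error plus or
      minus half of Z, and both are at most \<eta>.\<close>
    moreover have "M (Suc k) a j - (1 / 2 ^ Suc k) * (\<Sum>J\<in>P j. t J J) =
      1/2 * (M k a' j - (1 / 2 ^ k) * (\<Sum>J\<in>P j. t J J)) + (if even a then 1/2 else -1/2) * Z"
      unfolding M by (simp add: field_simps)
    ultimately have "\<exists>D. \<bar>Z\<bar> \<le> \<eta> \<and> \<bar>D\<bar> \<le> \<eta> \<and>
      M (Suc k) a j - (1 / 2 ^ Suc k) * (\<Sum>J\<in>P j. t J J) = 1/2 * D + (if even a then 1/2 else -1/2) * Z" by blast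
    then obtain D where "\<bar>Z\<bar> \<le> \<eta>" "\<bar>D\<bar> \<le> \<eta>"
      and eq: "M (Suc k) a j - (1 / 2 ^ Suc k) * (\<Sum>J\<in>P j. t J J) = 1/2 * D + (if even a then 1/2 else -1/2) * Z" by blast
    then show ?case unfolding eq by (auto simp: abs_le_iff)
  qed
  have Mdiag: "M k a k = (\<Sum>J\<in>P k. \<kappa> k a J * t J J)" if "k < n" for k a
  proof -
    have "M k a k = leaf_avg N (\<lambda>y. \<Sum>J\<in>P k. (\<kappa> k a J * (t J J / node_len J)) * \<bar>leaf_haar N J y\<bar>)"
      unfolding M_def diag_wave_def P_def[symmetric] sum_distrib_left
    proof (intro leaf_avg_cong sum.cong refl)
      fix y J assume "y < (2::nat) ^ N" "J \<in> P k"
      then show "ker w k y a * (t J J / node_len J * \<bar>leaf_haar N J y\<bar>) = \<kappa> k a J * (t J J / node_len J) * \<bar>leaf_haar N J y\<bar>"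
        using ker\<kappa>[of J k y a] that by (cases "leaf_node N (fst J) y = J") (auto simp: leaf_haar_def)
    qed
    also have "\<dots> = (\<Sum>J\<in>P k. (\<kappa> k a J * (t J J / node_len J)) * node_len J)"
      by (rule sum_node_len_eq[symmetric, OF PN])
    also have "\<dots> = (\<Sum>J\<in>P k. \<kappa> k a J * t J J)"
      by (intro sum.cong refl) (metis nonzero_eq_divide_eq node_len_pos less_numeral_extra(3) times_divide_eq_right times_divide_eq_left)
    finally show ?thesis .
  qed
  have small: "\<bar>X k a k' b - (if k = k' \<and> a = b then c / 2 ^ k else 0)\<bar> \<le> 3 * \<eta>"
    if k: "k < n" "k' < n" and a: "a < 2 ^ k" "b < 2 ^ k'" "a < 2 ^ n" "b < 2 ^ n" for k k' a b
  proof -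
    consider "k' < k" | "k < k'" | "k' = k" by linarith
    then show ?thesis
    proof cases
      case 1
      have "X k a k' b = (\<Sum>J\<in>P k. \<kappa> k a J * (\<Sum>K\<in>P k'. \<kappa> k' b K * e k' K * t J K) * e k J)"
        unfolding X_def by (simp add: sum_distrib_left sum_distrib_right mult_ac)
      then have "\<bar>X k a k' b\<bar> \<le> \<eta>"
        using ok[OF k(1)] 1 a unfolding step_ok_def P_def[symmetric] \<kappa>_def[symmetric] by auto
      then show ?thesis using 1 \<eta> by simp
    next
      case 2
      have "X k a k' b = (\<Sum>K\<in>P k'. \<kappa> k' b K * (\<Sum>J\<in>P k. \<kappa> k a J * e k J * t J K) * e k' K)"
        unfolding X_def by (subst sum.swap) (simp add: sum_distrib_left sum_distrib_right mult_ac)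
      then have "\<bar>X k a k' b\<bar> \<le> \<eta>"
        using ok[OF k(2)] 2 a unfolding step_ok_def P_def[symmetric] \<kappa>_def[symmetric] by auto
      then show ?thesis using 2 \<eta> by simp
    next
      case 3
      have ee: "e k J * e k J = 1" for J using e[of k J] by (metis abs_mult_self_eq mult_1)
      have finP: "finite (P k)" by (simp add: P_def)
      have "X k a k b = (\<Sum>J\<in>P k. \<kappa> k a J * \<kappa> k b J * t J J + (\<Sum>K\<in>P k - {J}. \<kappa> k a J * \<kappa> k b K * t J K * (e k J * e k K)))"
        unfolding X_def
      proof (intro sum.cong refl)
        fix J assume J: "J \<in> P k"
        have "(\<kappa> k a J * e k J) * (\<kappa> k b J * e k J) * t J J = \<kappa> k a J * \<kappa> k b J * t J J * (e k J * e k J)"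
          by (simp add: mult_ac)
        then show "(\<Sum>K\<in>P k. \<kappa> k a J * e k J * (\<kappa> k b K * e k K) * t J K) = \<kappa> k a J * \<kappa> k b J * t J J + (\<Sum>K\<in>P k - {J}. \<kappa> k a J * \<kappa> k b K * t J K * (e k J * e k K))"
          by (subst sum.remove[OF finP J]) (simp add: ee mult_ac)
      qed
      then have X: "X k a k b = (\<Sum>J\<in>P k. \<kappa> k a J * \<kappa> k b J * t J J) + (\<Sum>J\<in>P k. \<Sum>K\<in>P k - {J}. \<kappa> k a J * \<kappa> k b K * t J K * (e k J * e k K))"
        by (simp add: sum.distrib)
      have off: "\<bar>\<Sum>J\<in>P k. \<Sum>K\<in>P k - {J}. \<kappa> k a J * \<kappa> k b K * t J K * (e k J * e k K)\<bar> \<le> \<eta>"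
        using ok[OF k(1)] a unfolding step_ok_def P_def[symmetric] \<kappa>_def[symmetric] by auto
      have \<kappa>\<kappa>: "\<kappa> k a J * \<kappa> k b J = (if a = b then \<kappa> k a J else 0)" if "J \<in> P k" for J
        unfolding \<kappa>_def using node_ker_products[of e J N Q \<rho> k a b, OF e] that \<rho> k a 3 by (simp add: P_def)
      have D: "(\<Sum>J\<in>P k. \<kappa> k a J * \<kappa> k b J * t J J) = (if a = b then M k a k else 0)"
        using k by (simp add: \<kappa>\<kappa> Mdiag cong: sum.cong)
      show ?thesis
      proof (cases "a = b")
        case True
        have "\<bar>M k a k - (1 / 2 ^ k) * (\<Sum>J\<in>P k. t J J)\<bar> \<le> \<eta>" using Mstep k a by simp
        moreover have "\<bar>(1 / 2 ^ k) * (\<Sum>J\<in>P k. t J J) - c / 2 ^ k\<bar> \<le> \<eta>"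
        proof -
          have "\<bar>(1 / 2 ^ k) * (\<Sum>J\<in>P k. t J J) - c / 2 ^ k\<bar> = \<bar>(\<Sum>J\<in>P k. t J J) - c\<bar> / 2 ^ k"
            by (simp add: diff_divide_distrib[symmetric] abs_divide)
          also have "\<dots> \<le> \<bar>(\<Sum>J\<in>P k. t J J) - c\<bar> / 1" by (intro divide_left_mono) auto
          also have "\<dots> \<le> \<eta>" using c[OF k(1)] by (simp add: P_def)
          finally show ?thesis .
        qed
        ultimately show ?thesis using off 3 True unfolding 3 X D by (auto simp: abs_le_iff)
      next
        case False
        then show ?thesis using off \<eta> unfolding 3 X D by (auto simp: abs_le_iff)
      qed
    qed
  qed
  have "good_block n (3 * \<eta>) c N t w \<beta>"
    unfolding good_block_def
  proof (intro conjI ballI allI impI)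
    fix i y assume "y < (2::nat) ^ N"
    then show "\<bar>w i y\<bar> \<le> 1" unfolding w_def by (intro abs_rank_wave_le e)
  next
    fix I I' assume II: "I \<in> nodes n" "I' \<in> nodes n"
    have eq: "fst I = fst I' \<and> snd I - 1 = snd I' - 1 \<longleftrightarrow> I = I'"
      using nodesn(4)[OF II(1)] nodesn(4)[OF II(2)] by (auto simp: prod_eq_iff)
    show "\<bar>(\<Sum>J\<in>nodes N. \<Sum>K\<in>nodes N. \<beta> I J * \<beta> I' K * t J K) - (if I = I' then c * node_len I else 0)\<bar> \<le> 3 * \<eta>"
      using small[OF nodesn(1)[OF II(1)] nodesn(1)[OF II(2)] nodesn(2)[OF II(1)] nodesn(2)[OF II(2)] nodesn(3)[OF II(1)] nodesn(3)[OF II(2)]]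
      unfolding entry eq by (simp only: node_len_def times_divide_eq_right mult_1_right)
  qed (rule wave)
  then show ?thesis unfolding w_def by blast
qed

text \<open>All ranks up to R occur on at least half of the leaves. Discarding those below r0 makes
  the nodes short, and n * (floor(C / \<eta>) + 1) + 1 ranks remain for the pigeonhole
  argument.\<close>

lemma exists_good_block:
  assumes n: "0 < n" and \<eta>: "0 < \<eta>" and R: "R = r0 + n * (nat \<lfloor>C / \<eta>\<rfloor> + 1)" and N: "2 * R + 1 \<le> N"
    and small: "4 * 2 ^ n * real n * 2 ^ n * (2 * C\<^sup>2 * (((1/2) ^ r0) powr (1 / p) + ((1/2) ^ r0) powr (1 / q))) \<le> \<eta>\<^sup>2"
  shows "\<exists>c w \<beta>. \<delta> / 2 \<le> \<bar>c\<bar> \<and> \<bar>c\<bar> \<le> C \<and> good_block n (3 * \<eta>) c N t w \<beta>"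
proof -
  have "\<exists>Q s. (s = 1 \<or> s = -1) \<and> (\<forall>J\<in>nodes N. Q J \<longrightarrow> t J J = s * \<bar>t J J\<bar>) \<and> (\<forall>r\<le>R. 1/2 \<le> (\<Sum>J\<in>rank_nodes N Q r. node_len J))"
    using rank_nodes_cover_half[OF N, of "\<lambda>J. t J J > 0"]
  proof
    assume "\<forall>r\<le>R. 1/2 \<le> (\<Sum>J\<in>rank_nodes N (\<lambda>J. t J J > 0) r. node_len J)"
    then show ?thesis by (intro exI[of _ "\<lambda>J. t J J > 0"] exI[of _ 1]) auto
  next
    assume "\<forall>r\<le>R. 1/2 \<le> (\<Sum>J\<in>rank_nodes N (\<lambda>J. \<not> t J J > 0) r. node_len J)"
    then show ?thesis by (intro exI[of _ "\<lambda>J. \<not> t J J > 0"] exI[of _ "-1"]) auto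
  qed
  then obtain Q and s :: real where s: "s = 1 \<or> s = -1" and Q: "\<And>J. J \<in> nodes N \<Longrightarrow> Q J \<Longrightarrow> t J J = s * \<bar>t J J\<bar>"
    and half: "\<And>r. r \<le> R \<Longrightarrow> 1/2 \<le> (\<Sum>J\<in>rank_nodes N Q r. node_len J)" by blast
  define m where "m r = (\<Sum>J\<in>rank_nodes N Q r. \<bar>t J J\<bar>)" for r
  have sm: "(\<Sum>J\<in>rank_nodes N Q r. t J J) = s * m r" for r
    unfolding m_def sum_distrib_left using Q rank_nodesD by (intro sum.cong refl) blast
  \<comment> \<open>The factor 1/2 is lost here, because the nodes of one rank are only known to
    cover half of the leaves.\<close>
  have m_ge: "\<delta> / 2 \<le> m r" if "r \<le> R" for r
  proof -
    have "\<delta> * (1/2) \<le> \<delta> * (\<Sum>J\<in>rank_nodes N Q r. node_len J)"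
      using half[OF that] \<delta> by (intro mult_left_mono) auto
    also have "\<dots> \<le> m r" unfolding m_def sum_distrib_left
      using rank_nodesD(1) by (intro sum_mono diag)
    finally show ?thesis by simp
  qed
  have m_le: "m r \<le> C" for r
  proof -
    have "m r \<le> (\<Sum>J\<in>rank_nodes N Q r. C * node_len J)"
      unfolding m_def using rank_nodesD(1) by (intro sum_mono diag_le)
    also have "\<dots> \<le> C * 1" unfolding sum_distrib_left[symmetric]
      using sum_node_len_le_1[OF disjoint_rank_nodes] C by (intro mult_left_mono)
    finally show ?thesis by simp
  qed
  have card: "n * (nat \<lfloor>C / \<eta>\<rfloor> + 1) < card {r0..R} + 1" by (simp add: R)
  have mA: "0 \<le> m r \<and> m r \<le> C" if "r \<in> {r0..R}" for r
    using m_le[of r] by (auto simp: m_def intro: sum_nonneg)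
  obtain \<rho> where \<rho>: "\<And>i. i < n \<Longrightarrow> \<rho> i \<in> {r0..R}" "\<And>i j. i < j \<Longrightarrow> j < n \<Longrightarrow> \<rho> i < \<rho> j"
    "\<And>i j. i < n \<Longrightarrow> j < n \<Longrightarrow> \<bar>m (\<rho> i) - m (\<rho> j)\<bar> \<le> \<eta>"
    using pigeonhole_close_values[of \<eta> "{r0..R}" m C n] \<eta> mA card n by (metis finite_atLeastAtMost)
  obtain e where e: "\<And>i J. \<bar>e i J\<bar> = 1" "\<And>k. k < n \<Longrightarrow> step_ok Q \<rho> n \<eta> e k"
    using exists_all_steps[of n r0 \<rho> \<eta> Q] \<rho>(1) small \<eta> by auto
  define c where "c = s * m (\<rho> 0)"
  have "\<exists>\<beta>. good_block n (3 * \<eta>) c N t (rank_wave N Q \<rho> e) \<beta>"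
  proof (rule good_block_of_steps[OF e \<rho>(2) \<eta>])
    fix i assume "i < n"
    then have "\<bar>m (\<rho> i) - m (\<rho> 0)\<bar> \<le> \<eta>" using \<rho>(3) n by blast
    then show "\<bar>(\<Sum>J\<in>rank_nodes N Q (\<rho> i). t J J) - c\<bar> \<le> \<eta>"
      unfolding sm c_def using s by auto
  qed
  moreover have "\<delta> / 2 \<le> \<bar>c\<bar>" "\<bar>c\<bar> \<le> C"
    using s m_ge[of "\<rho> 0"] m_le[of "\<rho> 0"] \<rho>(1)[OF n] mA[of "\<rho> 0"] by (auto simp: c_def)
  ultimately show ?thesis by blast
qed

end

text \<open>The threshold N0 is uniform in the matrix t. This matters because the matrix of T on
  block N is known only once N has been chosen.\<close>

theorem haar_block_good:
  assumes p: "1 < p" and q: "1 < q" and n: "0 < n" and \<eta>: "0 < \<eta>"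
  shows "\<exists>N0. \<forall>N\<ge>N0. \<forall>t. haar_block N t C \<delta> p q \<longrightarrow>
    (\<exists>c w \<beta>. \<delta> / 2 \<le> \<bar>c\<bar> \<and> \<bar>c\<bar> \<le> C \<and> good_block n \<eta> c N t w \<beta>)"
proof -
  define L where "L = 4 * 2 ^ n * real n * 2 ^ n * (2 * C\<^sup>2)"
  have *: "(\<lambda>r. ((1/2::real) ^ r) powr (1 / x)) \<longlonglongrightarrow> 0" if "1 < x" for x :: real
  proof -
    have "((1/2::real) ^ r) powr (1 / x) = ((1/2) powr (1 / x)) ^ r" for r
      by (induction r) (auto simp: powr_mult powr_divide)
    moreover have "(1/2::real) powr (1 / x) < 1" using that powr_less_mono2[of "1 / x" "1/2" 1] by simp
    ultimately show ?thesis by (simp add: LIMSEQ_power_zero)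
  qed
  have "(\<lambda>r. L * (((1/2) ^ r) powr (1 / p) + ((1/2) ^ r) powr (1 / q))) \<longlonglongrightarrow> L * (0 + 0)"
    using p q by (intro tendsto_intros *)
  then have "eventually (\<lambda>r. L * (((1/2) ^ r) powr (1 / p) + ((1/2) ^ r) powr (1 / q)) < (\<eta>/3)\<^sup>2) sequentially"
    using \<eta> by (intro order_tendstoD) auto
  then obtain r0 where r0: "L * (((1/2) ^ r0) powr (1 / p) + ((1/2) ^ r0) powr (1 / q)) < (\<eta>/3)\<^sup>2"
    by (auto simp: eventually_sequentially)
  \<comment> \<open>The accuracy \<eta> / 3 compensates the factor 3 of
    \<open>exists_good_block\<close>.\<close>
  define R where "R = r0 + n * (nat \<lfloor>C / (\<eta>/3)\<rfloor> + 1)"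
  show ?thesis
  proof (intro exI[of _ "2 * R + 1"] allI impI)
    fix N t assume N: "2 * R + 1 \<le> N" and t: "haar_block N t C \<delta> p q"
    have "\<exists>c w \<beta>. \<delta> / 2 \<le> \<bar>c\<bar> \<and> \<bar>c\<bar> \<le> C \<and> good_block n (3 * (\<eta>/3)) c N t w \<beta>"
      by (rule haar_block.exists_good_block[OF t n _ R_def N]) (use r0 \<eta> in \<open>auto simp: L_def mult.assoc\<close>)
    then show "\<exists>c w \<beta>. \<delta> / 2 \<le> \<bar>c\<bar> \<and> \<bar>c\<bar> \<le> C \<and> good_block n \<eta> c N t w \<beta>" by simp
  qed
qed

section \<open>Leaf events of the independent copies\<close>

lemma dyadic_upto_eq_nodes: "1 \<le> n \<Longrightarrow> dyadic_upto (n - 1) = nodes n"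
  by (auto simp: dyadic_upto_def dyadic_def nodes_def)

lemma D_omega_eq: "D_omega = {(n, I). 1 \<le> n \<and> I \<in> nodes n}"
  using dyadic_upto_eq_nodes by (auto simp: D_omega_def)

lemma dy_len_eq_node_len: "dy_len = node_len"
  by (simp add: dy_len_def node_len_def fun_eq_iff)

lemma borel_measurable_haar [measurable]: "haar J \<in> borel_measurable LM"
proof -
  have "haar J \<in> borel_measurable borel" unfolding haar_def[abs_def] dy_left_def dy_right_def by measurable
  then have "haar J \<in> borel_measurable lborel" by simp
  then have "haar J \<in> borel_measurable lebesgue" by (rule measurable_completion)
  then show ?thesis by (rule measurable_restrict_space1)
qed

lemma haar_on_leaf:
  assumes x: "real j / 2 ^ n \<le> x" "x < real (Suc j) / 2 ^ n" and J: "J \<in> nodes n"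
  shows "haar J x = leaf_haar n J j"
proof -
  obtain k i where Ji: "J = (k, i)" "k < n" "1 \<le> i" using J by (auto simp: nodes_def)
  define m where "m = n - Suc k"
  \<comment> \<open>c numbers the dyadic interval of level k + 1 that contains x, and z is x
    measured in units of the length of that interval.\<close>
  define c where "c = j div 2 ^ m"
  define z where "z = x * 2 ^ Suc k"
  have n: "n = Suc k + m" using Ji by (simp add: m_def)
  have "c * 2 ^ m \<le> j" "Suc j \<le> (c + 1) * 2 ^ m"
    using dividend_less_div_times[of "2 ^ m" j] by (auto simp: c_def)
  then have "real (c * 2 ^ m) \<le> real j" "real (Suc j) \<le> real ((c + 1) * 2 ^ m)"
    by (simp_all only: of_nat_le_iff)
  then have cj: "real c * 2 ^ m \<le> real j" "real (Suc j) \<le> (real c + 1) * 2 ^ m" by (simp_all add: algebra_simps)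
  have "real j \<le> z * 2 ^ m" "z * 2 ^ m < real (Suc j)"
    using x by (simp_all add: z_def n power_add field_simps)
  then have "real c * 2 ^ m \<le> z * 2 ^ m" "z * 2 ^ m < (real c + 1) * 2 ^ m" using cj by linarith+
  then have z: "real c \<le> z" "z < real c + 1" by simp_all
  have L: "x \<in> dy_left J \<longleftrightarrow> 2 * real i - 2 \<le> z \<and> z < 2 * real i - 1"
    by (simp add: dy_left_def Ji z_def field_simps) (safe; linarith)
  have R: "x \<in> dy_right J \<longleftrightarrow> 2 * real i - 1 \<le> z \<and> z < 2 * real i"
    by (simp add: dy_right_def Ji z_def field_simps)
  have L': "x \<in> dy_left J \<longleftrightarrow> c + 2 = 2 * i" unfolding L
  proof
    assume "2 * real i - 2 \<le> z \<and> z < 2 * real i - 1"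
    then have "real c + 2 < 2 * real i + 1" "2 * real i < real c + 3" using z by linarith+
    then show "c + 2 = 2 * i" by linarith
  next
    assume "c + 2 = 2 * i"
    then have "real c + 2 = 2 * real i" by linarith
    then show "2 * real i - 2 \<le> z \<and> z < 2 * real i - 1" using z by linarith
  qed
  have R': "x \<in> dy_right J \<longleftrightarrow> c + 1 = 2 * i" unfolding R
  proof
    assume "2 * real i - 1 \<le> z \<and> z < 2 * real i"
    then have "real c < 2 * real i" "2 * real i < real c + 2" using z by linarith+
    then show "c + 1 = 2 * i" by linarith
  next
    assume "c + 1 = 2 * i"
    then have "real c + 1 = 2 * real i" by linarith
    then show "2 * real i - 1 \<le> z \<and> z < 2 * real i" using z by linarith
  qed
  have "leaf_haar n J j = (if Suc (c div 2) = i then if even c then 1 else - 1 else 0)"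
    using div_two_power_diff[OF Ji(2), of j] by (simp add: leaf_haar_def leaf_node_def leaf_bit_def Ji c_def m_def)
  also have "\<dots> = (if c + 2 = 2 * i then 1 else 0) - (if c + 1 = 2 * i then 1 else 0)"
  proof -
    have "c + 2 = 2 * i \<longleftrightarrow> Suc (c div 2) = i \<and> even c" "c + 1 = 2 * i \<longleftrightarrow> Suc (c div 2) = i \<and> odd c"
      by presburger+
    then show ?thesis by simp
  qed
  also have "\<dots> = haar J x" unfolding haar_def indicator_def L' R' by simp
  finally show ?thesis by simp
qed

lemma measure_leaf_interval:
  assumes n: "1 \<le> n" and j: "j < 2 ^ n"
  shows "measure LM {x \<in> space LM. \<forall>J\<in>nodes n. haar J x = leaf_haar n J j} = 1 / 2 ^ n"
proof -
  have "{x \<in> space LM. \<forall>J\<in>nodes n. haar J x = leaf_haar n J j} = {real j / 2 ^ n ..< real (Suc j) / 2 ^ n}"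
  proof (intro equalityI subsetI)
    fix x assume x: "x \<in> {x \<in> space LM. \<forall>J\<in>nodes n. haar J x = leaf_haar n J j}"
    then have x01: "0 \<le> x" "x \<le> 1" by auto
    \<comment> \<open>The root Haar function vanishes at the end point 1 but is nonzero on every
      leaf.\<close>
    have "x < 1"
    proof (rule ccontr)
      assume "\<not> x < 1"
      then have "x = 1" using x01 by simp
      moreover have root: "(0, 1) \<in> nodes n" using n by (simp add: nodes_def)
      ultimately have "leaf_haar n (0, 1) j = 0" using x by (force simp: haar_def dy_left_def dy_right_def)
      moreover have "leaf_haar n (0, 1) j \<noteq> 0" using j by (simp add: leaf_haar_def leaf_node_def leaf_bit_def)
      ultimately show False by simp
    qed
    define i where "i = nat \<lfloor>x * 2 ^ n\<rfloor>"
    have "0 \<le> x * 2 ^ n" "x * 2 ^ n < 2 ^ n" using x01 \<open>x < 1\<close> by auto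
    then have i: "real i \<le> x * 2 ^ n" "x * 2 ^ n < real (Suc i)" "real i < 2 ^ n"
      unfolding i_def by linarith+
    then have "real i < real (2 ^ n)" by simp
    then have i2: "i < 2 ^ n" by (simp only: of_nat_less_iff)
    have ix: "real i / 2 ^ n \<le> x" "x < real (Suc i) / 2 ^ n" using i by (simp_all add: field_simps)
    have "i = j"
      using haar_on_leaf[OF ix] x by (intro leaf_haar_inj[OF i2 j]) auto
    then show "x \<in> {real j / 2 ^ n ..< real (Suc j) / 2 ^ n}" using ix by simp
  next
    fix x assume x: "x \<in> {real j / 2 ^ n ..< real (Suc j) / 2 ^ n}"
    have "real (Suc j) \<le> real (2 ^ n)" using j by (simp only: of_nat_le_iff Suc_leI)
    then have "real (Suc j) / 2 ^ n \<le> 1" by simp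
    moreover have "0 \<le> real j / 2 ^ n" by simp
    ultimately have "0 \<le> x" "x \<le> 1" using x by (simp_all only: atLeastLessThan_iff) linarith+
    then show "x \<in> {x \<in> space LM. \<forall>J\<in>nodes n. haar J x = leaf_haar n J j}"
      using haar_on_leaf x by auto
  qed
  moreover have "{real j / 2 ^ n ..< real (Suc j) / 2 ^ n} \<subseteq> {0..1}"
  proof -
    have "real (Suc j) \<le> real (2 ^ n)" using j by (simp only: of_nat_le_iff Suc_leI)
    then have "real (Suc j) / 2 ^ n \<le> 1" by simp
    moreover have "0 \<le> real j / 2 ^ n" by simp
    ultimately show ?thesis by (intro subsetI) (simp only: atLeastLessThan_iff atLeastAtMost_iff, linarith)
  qed
  ultimately have "measure LM {x \<in> space LM. \<forall>J\<in>nodes n. haar J x = leaf_haar n J j} = measure lebesgue {real j / 2 ^ n ..< real (Suc j) / 2 ^ n}"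
    by (simp only:) (rule measure_restrict_space; simp)
  also have "\<dots> = 1 / 2 ^ n"
    by (simp add: divide_right_mono diff_divide_distrib[symmetric] del: of_nat_Suc)
  finally show ?thesis .
qed

lemma restrict_eq_iff: "restrict f A = restrict g A \<longleftrightarrow> (\<forall>x\<in>A. f x = g x)"
  by (metis restrict_apply' restrict_ext)

text \<open>The event is expressed through the values of the whole family in block n, so its
  probability depends only on the joint distribution.\<close>

definition leaf_event :: "(nat \<Rightarrow> nat \<times> nat \<Rightarrow> real \<Rightarrow> real) \<Rightarrow> nat \<Rightarrow> nat \<Rightarrow> real set" where
  "leaf_event h n j = {x \<in> space LM. \<forall>J\<in>nodes n. h n J x = leaf_haar n J j}"

text \<open>A version of \<open>F\<close> applied to the random leaf of block \<open>n\<close>; it is 0 on the null set outside all leaf events.\<close>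
definition blk :: "(nat \<Rightarrow> nat \<times> nat \<Rightarrow> real \<Rightarrow> real) \<Rightarrow> nat \<Rightarrow> (nat \<Rightarrow> real) \<Rightarrow> real \<Rightarrow> real" where
  "blk h n F x = (\<Sum>j<2^n. F j * indicator (leaf_event h n j) x)"

locale haar_copies =
  fixes h :: "nat \<Rightarrow> nat \<times> nat \<Rightarrow> real \<Rightarrow> real"
  assumes fam: "haar_copy_family h"
begin

lemma h_measurable [measurable]: "1 \<le> n \<Longrightarrow> J \<in> nodes n \<Longrightarrow> h n J \<in> borel_measurable LM"
  using fam unfolding haar_copy_family_def D_omega_eq by blast

abbreviation "hvec n x \<equiv> \<lambda>J\<in>dyadic_upto (n - 1). h n J x"
abbreviation "lvec n j \<equiv> \<lambda>J\<in>dyadic_upto (n - 1). leaf_haar n J j"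

lemma lvec_sets: "1 \<le> n \<Longrightarrow> {lvec n j} \<in> sets (PiM (dyadic_upto (n - 1)) (\<lambda>_. borel :: real measure))"
proof -
  assume n: "1 \<le> n"
  have "{lvec n j} = PiE (dyadic_upto (n - 1)) (\<lambda>J. {leaf_haar n J j})"
    by (intro equalityI subsetI) (auto simp: PiE_iff extensional_def fun_eq_iff restrict_def)
  also have "\<dots> \<in> sets (PiM (dyadic_upto (n - 1)) (\<lambda>_. borel :: real measure))"
    using dyadic_upto_eq_nodes[OF n] by (intro sets_PiM_I_finite) auto
  finally show ?thesis .
qed

lemma leaf_event_eq: "1 \<le> n \<Longrightarrow> leaf_event h n j = (\<lambda>x. hvec n x) -` {lvec n j} \<inter> space LM"
  unfolding leaf_event_def by (subst (1 2) dyadic_upto_eq_nodes) (auto simp: restrict_eq_iff simp del: split_paired_All)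

lemma leaf_event_sets [measurable]: "1 \<le> n \<Longrightarrow> leaf_event h n j \<in> sets LM"
  unfolding leaf_event_def using h_measurable[of n] by measurable

text \<open>Equality of distributions moves the event to the genuine Haar functions, where it is a
  dyadic interval of length 2^-n.\<close>

lemma prob_leaf_event:
  assumes n: "1 \<le> n" and j: "j < 2 ^ n"
  shows "LM.prob (leaf_event h n j) = 1 / 2 ^ n"
proof -
  let ?P = "PiM (dyadic_upto (n - 1)) (\<lambda>_. borel :: real measure)"
  have mh: "(\<lambda>x. hvec n x) \<in> measurable LM ?P"
    using h_measurable[OF n] dyadic_upto_eq_nodes[OF n] by (intro measurable_restrict) auto
  have mhaar: "(\<lambda>x. \<lambda>J\<in>dyadic_upto (n - 1). haar J x) \<in> measurable LM ?P"
    by (intro measurable_restrict) auto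
  have "LM.prob (leaf_event h n j) = measure (distr LM ?P (\<lambda>x. hvec n x)) {lvec n j}"
    unfolding leaf_event_eq[OF n] by (rule measure_distr[symmetric, OF mh lvec_sets[OF n]])
  also have "distr LM ?P (\<lambda>x. hvec n x) = distr LM ?P (\<lambda>x. \<lambda>J\<in>dyadic_upto (n - 1). haar J x)"
    using fam n by (simp add: haar_copy_family_def)
  also have "measure \<dots> {lvec n j} = measure LM ((\<lambda>x. \<lambda>J\<in>dyadic_upto (n - 1). haar J x) -` {lvec n j} \<inter> space LM)"
    by (rule measure_distr[OF mhaar lvec_sets[OF n]])
  also have "(\<lambda>x. \<lambda>J\<in>dyadic_upto (n - 1). haar J x) -` {lvec n j} \<inter> space LM = {x \<in> space LM. \<forall>J\<in>nodes n. haar J x = leaf_haar n J j}"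
    unfolding dyadic_upto_eq_nodes[OF n] by (auto simp: restrict_eq_iff)
  also have "measure LM \<dots> = 1 / 2 ^ n" by (rule measure_leaf_interval[OF assms])
  finally show ?thesis .
qed

lemma leaf_event_disjoint:
  assumes "x \<in> leaf_event h n i" "x \<in> leaf_event h n j" "i < 2 ^ n" "j < 2 ^ n"
  shows "i = j"
proof (rule leaf_haar_inj[OF assms(3,4)])
  fix J assume "J \<in> nodes n"
  then show "leaf_haar n J i = leaf_haar n J j" using assms(1,2) by (simp add: leaf_event_def)
qed

lemma prob_leaf_events:
  assumes S: "finite S" "S \<noteq> {}" and \<iota>: "inj_on \<iota> S" "\<And>i. i \<in> S \<Longrightarrow> 1 \<le> \<iota> i"
    and y: "\<And>i. i \<in> S \<Longrightarrow> y i < 2 ^ \<iota> i"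
  shows "LM.prob (\<Inter>i\<in>S. leaf_event h (\<iota> i) (y i)) = 1 / (\<Prod>i\<in>S. 2 ^ \<iota> i)"
proof -
  \<comment> \<open>Independence is indexed by block numbers; z transports the chosen leaves along
    the injective map.\<close>
  define z where "z = (\<lambda>n. y (the_inv_into S \<iota> n))"
  have z: "z (\<iota> i) = y i" if "i \<in> S" for i using the_inv_into_f_f[OF \<iota>(1) that] by (simp add: z_def)
  have ind: "LM.indep_vars (\<lambda>n. PiM (dyadic_upto (n - 1)) (\<lambda>_. borel :: real measure)) (\<lambda>n x. hvec n x) {1..}"
    using fam by (simp add: haar_copy_family_def)
  have "LM.prob (\<Inter>i\<in>S. leaf_event h (\<iota> i) (y i)) = LM.prob (\<Inter>n\<in>\<iota> ` S. (\<lambda>x. hvec n x) -` {lvec n (z n)} \<inter> space LM)"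
    using z \<iota>(2) leaf_event_eq by (intro arg_cong[where f = LM.prob]) (simp add: image_image)
  also have "\<dots> = (\<Prod>n\<in>\<iota> ` S. LM.prob ((\<lambda>x. hvec n x) -` {lvec n (z n)} \<inter> space LM))"
    using S \<iota>(2) lvec_sets by (intro LM.indep_varsD[OF ind]) auto
  also have "\<dots> = (\<Prod>i\<in>S. LM.prob (leaf_event h (\<iota> i) (y i)))"
    unfolding prod.reindex[OF \<iota>(1)] using z \<iota>(2) leaf_event_eq by (intro prod.cong) auto
  also have "\<dots> = (\<Prod>i\<in>S. 1 / 2 ^ \<iota> i)"
    using prob_leaf_event \<iota>(2) y by (intro prod.cong) auto
  finally show ?thesis by (simp add: prod_dividef)
qed

lemma AE_leaf_event:
  assumes n: "1 \<le> n"
  shows "AE x in LM. \<exists>j<2^n. x \<in> leaf_event h n j"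
proof -
  have "LM.prob (\<Union>j<2^n. leaf_event h n j) = (\<Sum>j<2^n. LM.prob (leaf_event h n j))"
    using leaf_event_disjoint n by (intro LM.finite_measure_finite_Union) (auto simp: disjoint_family_on_def)
  also have "\<dots> = 1" using prob_leaf_event[OF n] by simp
  finally have "AE x in LM. x \<in> (\<Union>j<2^n. leaf_event h n j)"
    using n by (intro LM.AE_prob_1) auto
  then show ?thesis by eventually_elim auto
qed

lemma blk_measurable [measurable]: "1 \<le> n \<Longrightarrow> blk h n F \<in> borel_measurable LM"
  unfolding blk_def[abs_def] by measurable

lemma blk_eq:
  assumes "x \<in> leaf_event h n j" "j < 2 ^ n"
  shows "blk h n F x = F j"
proof -
  have "blk h n F x = (\<Sum>i<2^n. if i = j then F i else 0)"
    unfolding blk_def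
  proof (intro sum.cong refl)
    fix i :: nat assume "i \<in> {..<2^n}"
    then have i: "i < 2 ^ n" by simp
    have "x \<in> leaf_event h n i \<longleftrightarrow> i = j"
      using leaf_event_disjoint[OF _ assms(1) i assms(2)] assms(1) by blast
    then show "F i * indicator (leaf_event h n i) x = (if i = j then F i else 0)" using assms(1) by simp
  qed
  then show ?thesis using assms by simp
qed

text \<open>Almost every point lies in exactly one leaf event of each block involved, and by
  independence the joint events are equally likely. The integral is therefore a finite
  average.\<close>

lemma integral_leaves:
  fixes f :: "real \<Rightarrow> real"
  assumes S: "finite S" and \<iota>: "inj_on \<iota> S" "\<And>i. i \<in> S \<Longrightarrow> 1 \<le> \<iota> i"
    and f: "f \<in> borel_measurable LM"
    and fg: "\<And>x y. x \<in> space LM \<Longrightarrow> y \<in> PiE S (\<lambda>i. {..<2^\<iota> i}) \<Longrightarrow> (\<And>i. i \<in> S \<Longrightarrow> x \<in> leaf_event h (\<iota> i) (y i)) \<Longrightarrow> f x = g y"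
  shows "(\<integral>x. f x \<partial>LM) = (\<Sum>y\<in>PiE S (\<lambda>i. {..<2^\<iota> i}). g y / (\<Prod>i\<in>S. 2 ^ \<iota> i))"
proof -
  define Y where "Y = PiE S (\<lambda>i. {..<(2::nat)^\<iota> i})"
  have finY: "finite Y" using S by (auto simp: Y_def intro!: finite_PiE)
  define E where "E y = {x \<in> space LM. \<forall>i\<in>S. x \<in> leaf_event h (\<iota> i) (y i)}" for y
  have Em [measurable]: "E y \<in> sets LM" for y
    unfolding E_def
  proof (intro sets.sets_Collect_finite_All S)
    fix i assume "i \<in> S"
    moreover have "{x \<in> space LM. x \<in> leaf_event h (\<iota> i) (y i)} = leaf_event h (\<iota> i) (y i)"
      by (auto simp: leaf_event_def)
    ultimately show "{x \<in> space LM. x \<in> leaf_event h (\<iota> i) (y i)} \<in> sets LM"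
      using leaf_event_sets[OF \<iota>(2)] by simp
  qed
  have AE: "AE x in LM. \<forall>i\<in>S. \<exists>j<2^\<iota> i. x \<in> leaf_event h (\<iota> i) j"
    using S AE_leaf_event[OF \<iota>(2)] by (intro AE_finite_allI) auto
  have eq: "AE x in LM. f x = (\<Sum>y\<in>Y. g y * indicator (E y) x)"
    using AE AE_space
  proof eventually_elim
    case (elim x)
    then obtain j where j: "\<And>i. i \<in> S \<Longrightarrow> j i < 2 ^ \<iota> i \<and> x \<in> leaf_event h (\<iota> i) (j i)" by metis
    define y where "y = restrict j S"
    have y: "y \<in> Y" "x \<in> E y" using j elim by (auto simp: y_def Y_def E_def)
    have uniq: "z = y" if "z \<in> Y" "x \<in> E z" for z
    proof (rule PiE_ext[OF that(1)[unfolded Y_def] y(1)[unfolded Y_def]])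
      fix i assume i: "i \<in> S"
      have "x \<in> leaf_event h (\<iota> i) (z i)" "x \<in> leaf_event h (\<iota> i) (y i)" using i that(2) y(2) by (simp_all add: E_def)
      moreover have "z i < 2 ^ \<iota> i" "y i < 2 ^ \<iota> i" 
        using PiE_mem[OF that(1)[unfolded Y_def] i] PiE_mem[OF y(1)[unfolded Y_def] i] by simp_all
      ultimately show "z i = y i" by (rule leaf_event_disjoint)
    qed
    have "(\<Sum>z\<in>Y. g z * indicator (E z) x) = (\<Sum>z\<in>Y. if z = y then g z else 0)"
    proof (intro sum.cong refl)
      fix z assume z: "z \<in> Y"
      show "g z * indicator (E z) x = (if z = y then g z else 0)"
      proof (cases "z = y")
        case False
        then have "x \<notin> E z" using uniq[OF z] by blast
        then show ?thesis using False by simp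
      qed (use y in simp)
    qed
    also have "\<dots> = g y" using finY y by simp
    also have "\<dots> = f x" using fg[of x y] y elim by (auto simp: Y_def E_def)
    finally show ?case by simp
  qed
  have "(\<integral>x. f x \<partial>LM) = (\<integral>x. (\<Sum>y\<in>Y. g y * indicator (E y) x) \<partial>LM)"
    using eq f by (intro integral_cong_AE) auto
  also have "\<dots> = (\<Sum>y\<in>Y. g y * LM.prob (E y))"
  proof -
    have "E y \<inter> {0..1} = E y" for y by (auto simp: E_def)
    then show ?thesis
      by (subst Bochner_Integration.integral_sum) (auto simp: LM.emeasure_eq_measure intro!: integrable_real_indicator)
  qed
  also have "\<dots> = (\<Sum>y\<in>Y. g y / (\<Prod>i\<in>S. 2 ^ \<iota> i))"
  proof (intro sum.cong refl)
    fix y assume y: "y \<in> Y"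
    have "LM.prob (E y) = 1 / (\<Prod>i\<in>S. 2 ^ \<iota> i)"
    proof (cases "S = {}")
      case True
      then have "E y = space LM" by (auto simp: E_def)
      then show ?thesis using True LM.prob_space by simp
    next
      case False
      then have "E y = (\<Inter>i\<in>S. leaf_event h (\<iota> i) (y i))" by (auto simp: E_def leaf_event_def)
      then show ?thesis using prob_leaf_events[OF S False \<iota>, of y] y by (auto simp: Y_def PiE_iff)
    qed
    then show "g y * LM.prob (E y) = g y / (\<Prod>i\<in>S. 2 ^ \<iota> i)" by simp
  qed
  finally show "(\<integral>x. f x \<partial>LM) = (\<Sum>y\<in>PiE S (\<lambda>i. {..<2^\<iota> i}). g y / (\<Prod>i\<in>S. 2 ^ \<iota> i))" by (simp add: Y_def)
qed

lemma integral_prod_blk: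
  assumes S: "finite S" and \<iota>: "inj_on \<iota> S" "\<And>i. i \<in> S \<Longrightarrow> 1 \<le> \<iota> i"
  shows "(\<integral>x. (\<Prod>i\<in>S. blk h (\<iota> i) (F i) x) \<partial>LM) = (\<Prod>i\<in>S. leaf_avg (\<iota> i) (F i))"
proof -
  have "(\<integral>x. (\<Prod>i\<in>S. blk h (\<iota> i) (F i) x) \<partial>LM) = (\<Sum>y\<in>PiE S (\<lambda>i. {..<2^\<iota> i}). (\<Prod>i\<in>S. F i (y i)) / (\<Prod>i\<in>S. 2 ^ \<iota> i))"
  proof (rule integral_leaves[OF S \<iota>])
    show "(\<lambda>x. \<Prod>i\<in>S. blk h (\<iota> i) (F i) x) \<in> borel_measurable LM"
      using \<iota>(2) by (intro borel_measurable_prod) auto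
  qed (auto intro!: prod.cong blk_eq)
  also have "\<dots> = (\<Prod>i\<in>S. leaf_avg (\<iota> i) (F i))"
    unfolding leaf_avg_def prod_dividef sum_divide_distrib[symmetric] using S by (subst prod_sum_PiE) auto
  finally show ?thesis .
qed

lemma inner_L_blk_same: "1 \<le> n \<Longrightarrow> inner_L (blk h n F) (blk h n G) = leaf_avg n (\<lambda>y. F y * G y)"
proof -
  assume n: "1 \<le> n"
  have "inner_L (blk h n F) (blk h n G) = (\<integral>x. blk h n (\<lambda>y. F y * G y) x \<partial>LM)"
    unfolding inner_L_def
  proof (rule integral_cong_AE)
    show "AE x in LM. blk h n F x * blk h n G x = blk h n (\<lambda>y. F y * G y) x"
      using AE_leaf_event[OF n] by eventually_elim (auto simp: blk_eq)
  qed (use n in auto)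
  also have "\<dots> = leaf_avg n (\<lambda>y. F y * G y)"
    using integral_prod_blk[of "{n}" "\<lambda>i. i" "\<lambda>_ y. F y * G y"] n by simp
  finally show ?thesis .
qed

lemma inner_L_blk_diff: "1 \<le> n \<Longrightarrow> 1 \<le> m \<Longrightarrow> n \<noteq> m \<Longrightarrow> inner_L (blk h n F) (blk h m G) = leaf_avg n F * leaf_avg m G"
  using integral_prod_blk[of "{n,m}" "\<lambda>i. i" "\<lambda>i. if i = n then F else G"] by (auto simp: inner_L_def)

lemma integral_powr_blk_sum:
  assumes S: "finite S" and \<iota>: "inj_on \<iota> S" "\<And>i. i \<in> S \<Longrightarrow> 1 \<le> \<iota> i"
  shows "(\<integral>x. \<bar>\<Sum>i\<in>S. blk h (\<iota> i) (F i) x\<bar> powr p \<partial>LM) =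
    (\<Sum>y\<in>PiE S (\<lambda>i. {..<2^\<iota> i}). \<bar>\<Sum>i\<in>S. F i (y i)\<bar> powr p / (\<Prod>i\<in>S. 2 ^ \<iota> i))"
proof (rule integral_leaves[OF S \<iota>])
  have [measurable]: "(\<lambda>x. \<Sum>i\<in>S. blk h (\<iota> i) (F i) x) \<in> borel_measurable LM"
    using \<iota>(2) by (intro borel_measurable_sum) auto
  show "(\<lambda>x. \<bar>\<Sum>i\<in>S. blk h (\<iota> i) (F i) x\<bar> powr p) \<in> borel_measurable LM" by measurable
  fix x y assume "y \<in> PiE S (\<lambda>i. {..<2^\<iota> i})" "\<And>i. i \<in> S \<Longrightarrow> x \<in> leaf_event h (\<iota> i) (y i)"
  then have "(\<Sum>i\<in>S. blk h (\<iota> i) (F i) x) = (\<Sum>i\<in>S. F i (y i))"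
    by (intro sum.cong) (auto intro!: blk_eq)
  then show "\<bar>\<Sum>i\<in>S. blk h (\<iota> i) (F i) x\<bar> powr p = \<bar>\<Sum>i\<in>S. F i (y i)\<bar> powr p" by simp
qed

text \<open>The product of the kernels acts on a sum of one-block functions summand by summand,
  since the rows of the other factors sum to 1. Jensen's inequality moves the power inside, and the
  column condition says that uniform measure is mapped to uniform measure.\<close>

lemma kernel_contraction:
  assumes p: "1 \<le> p" and S: "finite S" and \<iota>: "inj_on \<iota> S" "\<And>i. i \<in> S \<Longrightarrow> 1 \<le> \<iota> i"
    and \<kappa>: "inj_on \<kappa> S" "\<And>i. i \<in> S \<Longrightarrow> 1 \<le> \<kappa> i"
    and nonneg: "\<And>i u v. i \<in> S \<Longrightarrow> u < 2 ^ \<iota> i \<Longrightarrow> v < 2 ^ \<kappa> i \<Longrightarrow> 0 \<le> K i u v"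
    and row: "\<And>i u. i \<in> S \<Longrightarrow> u < 2 ^ \<iota> i \<Longrightarrow> (\<Sum>v<2^\<kappa> i. K i u v) = 1"
    and col: "\<And>i v. i \<in> S \<Longrightarrow> v < 2 ^ \<kappa> i \<Longrightarrow> (\<Sum>u<2^\<iota> i. K i u v) / 2 ^ \<iota> i = 1 / 2 ^ \<kappa> i"
  shows "Lp_norm p (\<lambda>x. \<Sum>i\<in>S. blk h (\<iota> i) (\<lambda>u. \<Sum>v<2^\<kappa> i. K i u v * F i v) x)
    \<le> Lp_norm p (\<lambda>x. \<Sum>i\<in>S. blk h (\<kappa> i) (F i) x)"
proof -
  define U where "U = PiE S (\<lambda>i. {..<(2::nat)^\<iota> i})"
  define W where "W = PiE S (\<lambda>i. {..<(2::nat)^\<kappa> i})"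
  have fin: "finite U" "finite W" using S by (auto simp: U_def W_def intro!: finite_PiE)
  define k where "k u w = (\<Prod>i\<in>S. K i (u i) (w i))" for u w
  have k_nonneg: "0 \<le> k u w" if "u \<in> U" "w \<in> W" for u w
    unfolding k_def using that nonneg by (intro prod_nonneg) (auto simp: U_def W_def PiE_iff)
  have k_row: "(\<Sum>w\<in>W. k u w) = 1" if "u \<in> U" for u
  proof -
    have "(\<Sum>w\<in>W. k u w) = (\<Prod>i\<in>S. \<Sum>v<2^\<kappa> i. K i (u i) v)"
      unfolding k_def W_def using S by (subst prod_sum_PiE) auto
    also have "\<dots> = 1" using that row by (intro prod.neutral) (auto simp: U_def PiE_iff)
    finally show ?thesis .
  qed
  have k_col: "(\<Sum>u\<in>U. k u w / (\<Prod>i\<in>S. 2 ^ \<iota> i)) = 1 / (\<Prod>i\<in>S. 2 ^ \<kappa> i)" if "w \<in> W" for w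
  proof -
    have "(\<Sum>u\<in>U. k u w / (\<Prod>i\<in>S. 2 ^ \<iota> i)) = (\<Prod>i\<in>S. \<Sum>u<2^\<iota> i. K i u (w i)) / (\<Prod>i\<in>S. 2 ^ \<iota> i)"
      unfolding k_def U_def sum_divide_distrib[symmetric] using S by (subst prod_sum_PiE) auto
    also have "\<dots> = (\<Prod>i\<in>S. (\<Sum>u<2^\<iota> i. K i u (w i)) / 2 ^ \<iota> i)" by (simp add: prod_dividef)
    also have "\<dots> = (\<Prod>i\<in>S. 1 / 2 ^ \<kappa> i)" using that col by (intro prod.cong) (auto simp: W_def PiE_iff)
    finally show ?thesis by (simp add: prod_dividef)
  qed
  have mean: "(\<Sum>i\<in>S. \<Sum>v<2^\<kappa> i. K i (u i) v * F i v) = (\<Sum>w\<in>W. k u w *\<^sub>R (\<Sum>i\<in>S. F i (w i)))" if u: "u \<in> U" for u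
  proof -
    have "(\<Sum>w\<in>W. k u w * F i (w i)) = (\<Sum>v<2^\<kappa> i. K i (u i) v * F i v)" if i: "i \<in> S" for i
    proof -
      \<comment> \<open>Attaching F i to coordinate i makes the sum a product of coordinate sums,
        and all factors but the one for i equal 1.\<close>
      have "(\<Sum>w\<in>W. k u w * F i (w i)) = (\<Sum>w\<in>W. \<Prod>j\<in>S. K j (u j) (w j) * (if j = i then F i (w j) else 1))"
        unfolding k_def prod.distrib using S i by (intro sum.cong refl) (simp add: prod.delta)
      also have "\<dots> = (\<Prod>j\<in>S. \<Sum>v<2^\<kappa> j. K j (u j) v * (if j = i then F i v else 1))"
        unfolding W_def using S by (subst prod_sum_PiE) auto
      also have "\<dots> = (\<Prod>j\<in>S. if j = i then \<Sum>v<2^\<kappa> i. K i (u i) v * F i v else 1)"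
        using row u by (intro prod.cong refl) (auto simp: U_def PiE_iff)
      also have "\<dots> = (\<Sum>v<2^\<kappa> i. K i (u i) v * F i v)" using S i by (simp add: prod.delta)
      finally show ?thesis .
    qed
    then have "(\<Sum>i\<in>S. \<Sum>v<2^\<kappa> i. K i (u i) v * F i v) = (\<Sum>i\<in>S. \<Sum>w\<in>W. k u w * F i (w i))" by simp
    then show ?thesis by (subst (asm) sum.swap) (simp add: sum_distrib_left)
  qed
  have W: "W \<noteq> {}" unfolding W_def by (auto simp: PiE_eq_empty_iff lessThan_empty_iff bot_nat_def)
  have "(\<integral>x. \<bar>\<Sum>i\<in>S. blk h (\<iota> i) (\<lambda>u. \<Sum>v<2^\<kappa> i. K i u v * F i v) x\<bar> powr p \<partial>LM)
     = (\<Sum>u\<in>U. \<bar>\<Sum>i\<in>S. \<Sum>v<2^\<kappa> i. K i (u i) v * F i v\<bar> powr p / (\<Prod>i\<in>S. 2 ^ \<iota> i))"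
    unfolding U_def by (rule integral_powr_blk_sum[OF S \<iota>])
  also have "\<dots> \<le> (\<Sum>u\<in>U. (\<Sum>w\<in>W. k u w * \<bar>\<Sum>i\<in>S. F i (w i)\<bar> powr p) / (\<Prod>i\<in>S. 2 ^ \<iota> i))"
  proof (intro sum_mono divide_right_mono)
    fix u assume u: "u \<in> U"
    show "\<bar>\<Sum>i\<in>S. \<Sum>v<2^\<kappa> i. K i (u i) v * F i v\<bar> powr p \<le> (\<Sum>w\<in>W. k u w * \<bar>\<Sum>i\<in>S. F i (w i)\<bar> powr p)"
      unfolding mean[OF u] using k_row[OF u] k_nonneg[OF u]
      by (intro convex_on_sum[OF fin(2) W convex_on_abs_powr[OF p]]) auto
  qed (auto intro!: prod_nonneg)
  also have "\<dots> = (\<Sum>w\<in>W. (\<Sum>u\<in>U. k u w / (\<Prod>i\<in>S. 2 ^ \<iota> i)) * \<bar>\<Sum>i\<in>S. F i (w i)\<bar> powr p)"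
    unfolding sum_divide_distrib sum_distrib_right by (subst sum.swap) simp
  also have "\<dots> = (\<Sum>w\<in>W. \<bar>\<Sum>i\<in>S. F i (w i)\<bar> powr p / (\<Prod>i\<in>S. 2 ^ \<kappa> i))"
    using k_col by (intro sum.cong refl) simp
  also have "\<dots> = (\<integral>x. \<bar>\<Sum>i\<in>S. blk h (\<kappa> i) (F i) x\<bar> powr p \<partial>LM)"
    unfolding W_def by (rule integral_powr_blk_sum[symmetric, OF S \<kappa>])
  finally show ?thesis
    unfolding Lp_norm_def using p by (intro powr_mono2) auto
qed

end

section \<open>The closed span and its operators\<close>

locale haar_copies_Lp = haar_copies +
  fixes p :: real
  assumes p: "1 < p"
begin

abbreviation "V \<equiv> R_space p h"
abbreviation "nrm \<equiv> Lp_norm p"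

lemma p1: "1 \<le> p"
  using p by simp

lemma V_in_Lp: "f \<in> V \<Longrightarrow> in_Lp p f"
  by (simp add: R_space_def)

lemma V_measurable: "f \<in> V \<Longrightarrow> f \<in> borel_measurable LM"
  using V_in_Lp in_Lp_measurable by blast

lemma V_approx_comb:
  "f \<in> V \<Longrightarrow> e > 0 \<Longrightarrow> \<exists>F c. finite F \<and> F \<subseteq> D_omega \<and> nrm (\<lambda>x. f x - (\<Sum>(n, I)\<in>F. c (n, I) * h n I x)) < e"
  by (simp add: R_space_def)

lemma comb_in_Lp:
  assumes "finite F" "F \<subseteq> D_omega"
  shows "in_Lp p (\<lambda>x. \<Sum>(n, I)\<in>F. c (n, I) * h n I x)"
proof -
  have "in_Lp p (\<lambda>x. c (n, I) * h n I x)" if "(n, I) \<in> F" for n I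
  proof -
    have n: "1 \<le> n" and I: "I \<in> nodes n" using assms(2) that by (auto simp: D_omega_eq)
    have "AE x in LM. \<bar>h n I x\<bar> \<le> 1"
      using AE_leaf_event[OF n]
    proof eventually_elim
      case (elim x)
      then obtain j where "h n I x = leaf_haar n I j" using I by (auto simp: leaf_event_def)
      then show ?case by (simp add: leaf_haar_def)
    qed
    then show ?thesis using h_measurable[OF n I] by (intro in_Lp_scale[OF p1] in_Lp_bounded[OF p1, of _ 1]) auto
  qed
  then show ?thesis unfolding split_beta by (intro in_Lp_sum[OF p1 assms(1)]) auto
qed

lemma V_closed:
  assumes f: "in_Lp p f" and ap: "\<And>e. e > 0 \<Longrightarrow> \<exists>g\<in>V. nrm (\<lambda>x. f x - g x) < e"
  shows "f \<in> V"
  unfolding R_space_def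
proof (intro CollectI conjI f allI impI)
  fix e :: real assume "e > 0"
  then obtain g where g: "g \<in> V" "nrm (\<lambda>x. f x - g x) < e / 2" using ap[of "e/2"] by auto
  have "e / 2 > 0" using \<open>e > 0\<close> by simp
  then obtain F c where F: "finite F" "F \<subseteq> D_omega" "nrm (\<lambda>x. g x - (\<Sum>(n, I)\<in>F. c (n, I) * h n I x)) < e / 2"
    using V_approx_comb[OF g(1)] by blast
  have "in_Lp p (\<lambda>x. \<Sum>(n, I)\<in>F. c (n, I) * h n I x)" by (rule comb_in_Lp[OF F(1,2)])
  from Lp_norm_dist_triangle[OF p1 f V_in_Lp[OF g(1)] this]
  have "nrm (\<lambda>x. f x - (\<Sum>(n, I)\<in>F. c (n, I) * h n I x)) < e" using g F by linarith
  then show "\<exists>F c. finite F \<and> F \<subseteq> D_omega \<and> nrm (\<lambda>x. f x - (\<Sum>(n, I)\<in>F. c (n, I) * h n I x)) < e"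
    using F by blast
qed

lemma V_AE_cong:
  assumes "f \<in> V" "g \<in> borel_measurable LM" "AE x in LM. f x = g x"
  shows "g \<in> V"
proof (rule V_closed)
  show "in_Lp p g" using in_Lp_cong[OF assms(3) V_in_Lp[OF assms(1)] assms(2)] .
  fix e :: real assume "e > 0"
  have "nrm (\<lambda>x. g x - f x) = nrm (\<lambda>x. 0)"
    using assms V_measurable[OF assms(1)] by (intro Lp_norm_cong) auto
  then show "\<exists>f\<in>V. nrm (\<lambda>x. g x - f x) < e" 
    using \<open>e > 0\<close> by (intro bexI[OF _ assms(1)]) (simp add: Lp_norm_zero)
qed

lemma V_finite_comb:
  assumes "finite F" "F \<subseteq> D_omega"
  shows "(\<lambda>x. \<Sum>(n, I)\<in>F. c (n, I) * h n I x) \<in> V"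
  unfolding R_space_def
proof (intro CollectI conjI allI impI)
  show "in_Lp p (\<lambda>x. \<Sum>(n, I)\<in>F. c (n, I) * h n I x)" by (rule comb_in_Lp[OF assms])
  fix e :: real assume "e > 0"
  then show "\<exists>F' c'. finite F' \<and> F' \<subseteq> D_omega \<and> nrm (\<lambda>x. (\<Sum>(n, I)\<in>F. c (n, I) * h n I x) - (\<Sum>(n, I)\<in>F'. c' (n, I) * h n I x)) < e"
    using assms by (intro exI[of _ F] exI[of _ c]) (simp add: Lp_norm_zero)
qed

lemma h_in_V: "1 \<le> n \<Longrightarrow> I \<in> nodes n \<Longrightarrow> h n I \<in> V"
  using V_finite_comb[of "{(n, I)}" "\<lambda>_. 1"] by (simp add: D_omega_eq)

lemma V_lin:
  assumes f: "f \<in> V" and g: "g \<in> V"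
  shows "(\<lambda>x. a * f x + b * g x) \<in> V"
proof (rule V_closed)
  show in_Lp: "in_Lp p (\<lambda>x. a * f x + b * g x)" by (rule in_Lp_lin[OF p1 V_in_Lp[OF f] V_in_Lp[OF g]])
  fix e :: real assume e: "e > 0"
  define d where "d = e / (\<bar>a\<bar> + \<bar>b\<bar> + 1)"
  have d: "d > 0" "(\<bar>a\<bar> + \<bar>b\<bar>) * d < e" using e by (auto simp: d_def field_simps add_pos_nonneg)
  obtain F c where F: "finite F" "F \<subseteq> D_omega" "nrm (\<lambda>x. f x - (\<Sum>(n, I)\<in>F. c (n, I) * h n I x)) < d"
    using V_approx_comb[OF f d(1)] by blast
  obtain G c' where G: "finite G" "G \<subseteq> D_omega" "nrm (\<lambda>x. g x - (\<Sum>(n, I)\<in>G. c' (n, I) * h n I x)) < d"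
    using V_approx_comb[OF g d(1)] by blast
  let ?s = "\<lambda>x. \<Sum>(n, I)\<in>F. c (n, I) * h n I x" and ?t = "\<lambda>x. \<Sum>(n, I)\<in>G. c' (n, I) * h n I x"
  define c'' where "c'' i = (if i \<in> F then a * c i else 0) + (if i \<in> G then b * c' i else 0)" for i
  have "(\<lambda>x. \<Sum>(n, I)\<in>F \<union> G. c'' (n, I) * h n I x) \<in> V"
    using F G by (intro V_finite_comb) auto
  also have "(\<lambda>x. \<Sum>(n, I)\<in>F \<union> G. c'' (n, I) * h n I x) = (\<lambda>x. a * ?s x + b * ?t x)"
  proof
    fix x
    have 1: "(\<Sum>i\<in>F \<union> G. (if i \<in> F then a * c i else 0) * h (fst i) (snd i) x) = (\<Sum>i\<in>F. a * c i * h (fst i) (snd i) x)"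
      using F G by (intro sum.mono_neutral_cong_right) auto
    have 2: "(\<Sum>i\<in>F \<union> G. (if i \<in> G then b * c' i else 0) * h (fst i) (snd i) x) = (\<Sum>i\<in>G. b * c' i * h (fst i) (snd i) x)"
      using F G by (intro sum.mono_neutral_cong_right) auto
    show "(\<Sum>(n, I)\<in>F \<union> G. c'' (n, I) * h n I x) = a * ?s x + b * ?t x"
      unfolding split_beta c''_def prod.collapse distrib_right sum.distrib 1 2 by (simp add: sum_distrib_left mult.assoc)
  qed
  finally have V: "(\<lambda>x. a * ?s x + b * ?t x) \<in> V" .
  have s: "?s \<in> V" "?t \<in> V" using F G V_finite_comb by auto
  note L = in_Lp_diff[OF p1 V_in_Lp[OF f] V_in_Lp[OF s(1)]] in_Lp_diff[OF p1 V_in_Lp[OF g] V_in_Lp[OF s(2)]]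
  have "nrm (\<lambda>x. (a * f x + b * g x) - (a * ?s x + b * ?t x)) = nrm (\<lambda>x. a * (f x - ?s x) + b * (g x - ?t x))"
    by (simp add: algebra_simps)
  also have "\<dots> \<le> nrm (\<lambda>x. a * (f x - ?s x)) + nrm (\<lambda>x. b * (g x - ?t x))"
    by (rule Lp_norm_triangle[OF p1 in_Lp_scale[OF p1 L(1)] in_Lp_scale[OF p1 L(2)]])
  also have "\<dots> = \<bar>a\<bar> * nrm (\<lambda>x. f x - ?s x) + \<bar>b\<bar> * nrm (\<lambda>x. g x - ?t x)"
    using Lp_norm_scale[OF p1 L(1)] Lp_norm_scale[OF p1 L(2)] by simp
  also have "\<dots> \<le> \<bar>a\<bar> * d + \<bar>b\<bar> * d" using F G by (intro add_mono mult_left_mono) auto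
  also have "\<dots> < e" using d by (simp add: algebra_simps)
  finally show "\<exists>k\<in>V. nrm (\<lambda>x. (a * f x + b * g x) - k x) < e" by (rule bexI[OF _ V])
qed

lemma V_scale: "f \<in> V \<Longrightarrow> (\<lambda>x. a * f x) \<in> V"
  using V_lin[of f f a 0] by simp

lemma V_diff: "f \<in> V \<Longrightarrow> g \<in> V \<Longrightarrow> (\<lambda>x. f x - g x) \<in> V"
  using V_lin[of f g 1 "-1"] by simp

lemma V_zero: "(\<lambda>x. 0) \<in> V"
  using V_finite_comb[of "{}"] by simp

lemma V_sum: "finite S \<Longrightarrow> (\<And>i. i \<in> S \<Longrightarrow> f i \<in> V) \<Longrightarrow> (\<lambda>x. \<Sum>i\<in>S. f i x) \<in> V"
proof (induction S rule: finite_induct)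
  case (insert a S)
  then show ?case using V_lin[of "f a" "\<lambda>x. \<Sum>i\<in>S. f i x" 1 1] by simp
qed (simp add: V_zero)

lemma nrm_diff_triangle:
  assumes "f \<in> V" "g \<in> V" "k \<in> V"
  shows "nrm (\<lambda>x. f x - k x) \<le> nrm (\<lambda>x. f x - g x) + nrm (\<lambda>x. g x - k x)"
  using assms by (intro Lp_norm_dist_triangle[OF p1] V_in_Lp)

lemma nrm_le_diff: "f \<in> V \<Longrightarrow> g \<in> V \<Longrightarrow> nrm f \<le> nrm (\<lambda>x. f x - g x) + nrm g"
  using nrm_diff_triangle[OF _ _ V_zero] by simp

lemma h_AE_blk:
  assumes "1 \<le> n" "I \<in> nodes n"
  shows "AE x in LM. h n I x = blk h n (leaf_haar n I) x"
  using AE_leaf_event[OF assms(1)]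
proof eventually_elim
  case (elim x)
  then obtain j where "j < 2 ^ n" "x \<in> leaf_event h n j" by blast
  then show ?case using assms(2) blk_eq[of x n j "leaf_haar n I"] by (simp add: leaf_event_def)
qed

lemma blk_sum: "blk h n (\<lambda>y. \<Sum>i\<in>S. c i * F i y) x = (\<Sum>i\<in>S. c i * blk h n (F i) x)"
  unfolding blk_def sum_distrib_right sum_distrib_left by (subst sum.swap) (simp add: mult.assoc)

lemma blk_cong: "(\<And>y. y < 2 ^ n \<Longrightarrow> F y = G y) \<Longrightarrow> blk h n F x = blk h n G x"
  unfolding blk_def by (intro sum.cong) auto

lemma blk_scale: "blk h n (\<lambda>y. c * F y) x = c * blk h n F x"
  unfolding blk_def sum_distrib_left by (simp only: mult.assoc)

lemma blk_haar_in_V: "1 \<le> n \<Longrightarrow> I \<in> nodes n \<Longrightarrow> blk h n (leaf_haar n I) \<in> V"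
  using V_AE_cong[OF h_in_V _ h_AE_blk] by simp

lemma blk_expansion:
  assumes "leaf_avg n F = 0"
  shows "blk h n F x = (\<Sum>I\<in>nodes n. leaf_avg n (\<lambda>z. leaf_haar n I z * F z) / node_len I * blk h n (leaf_haar n I) x)"
  unfolding blk_sum[symmetric] by (intro blk_cong leaf_haar_expansion assms)

lemma blk_in_V:
  assumes "1 \<le> n" "leaf_avg n F = 0"
  shows "blk h n F \<in> V"
proof -
  have "(\<lambda>x. \<Sum>I\<in>nodes n. leaf_avg n (\<lambda>z. leaf_haar n I z * F z) / node_len I * blk h n (leaf_haar n I) x) \<in> V"
    using assms(1) by (intro V_sum V_scale blk_haar_in_V) auto
  then show ?thesis unfolding blk_expansion[OF assms(2), abs_def] .
qed

section \<open>Finite block sums as a dense subspace\<close>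

definition simple_fun :: "nat set \<Rightarrow> (nat \<Rightarrow> nat \<Rightarrow> real) \<Rightarrow> bool" where
  "simple_fun S F \<longleftrightarrow> finite S \<and> (\<forall>n\<in>S. 1 \<le> n \<and> leaf_avg n (F n) = 0)"

definition blks :: "nat set \<Rightarrow> (nat \<Rightarrow> nat \<Rightarrow> real) \<Rightarrow> real \<Rightarrow> real" where
  "blks S F x = (\<Sum>n\<in>S. blk h n (F n) x)"

lemma blks_in_V: "simple_fun S F \<Longrightarrow> blks S F \<in> V"
  unfolding blks_def[abs_def] simple_fun_def by (intro V_sum blk_in_V) auto

text \<open>A finite Haar combination is grouped by blocks. The resulting sum agrees with it almost
  everywhere and, unlike it, is a function of the leaves at every point.\<close>

lemma V_approx:
  assumes f: "f \<in> V" and e: "e > 0"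
  obtains S F where "simple_fun S F" "nrm (\<lambda>x. f x - blks S F x) < e"
proof -
  obtain A c where A: "finite A" "A \<subseteq> D_omega" "nrm (\<lambda>x. f x - (\<Sum>(n, I)\<in>A. c (n, I) * h n I x)) < e"
    using V_approx_comb[OF f e] by blast
  define S where "S = fst ` A"
  define F where "F n y = (\<Sum>I\<in>A `` {n}. c (n, I) * leaf_haar n I y)" for n y
  have finA: "finite (A `` {n})" for n using A(1) by (rule finite_Image)
  have AD: "1 \<le> n" "I \<in> nodes n" if "(n, I) \<in> A" for n I using A(2) that by (auto simp: D_omega_eq)
  have sf: "simple_fun S F"
    unfolding simple_fun_def S_def
  proof (intro conjI ballI)
    fix n assume "n \<in> fst ` A"
    then show "1 \<le> n" using AD by force
    have "leaf_avg n (F n) = (\<Sum>I\<in>A `` {n}. c (n, I) * leaf_avg n (leaf_haar n I))"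
      unfolding F_def[abs_def] by (simp add: leaf_avg_sum leaf_avg_mult)
    also have "\<dots> = 0" using AD leaf_avg_haar_node(2) by (intro sum.neutral) auto
    finally show "leaf_avg n (F n) = 0" .
  qed (use A in simp)
  have all: "AE x in LM. \<forall>i\<in>A. h (fst i) (snd i) x = blk h (fst i) (leaf_haar (fst i) (snd i)) x"
    using A(1) h_AE_blk[OF AD] by (intro AE_finite_allI) auto
  have eq: "AE x in LM. (\<Sum>(n, I)\<in>A. c (n, I) * h n I x) = blks S F x"
    using all
  proof eventually_elim
    case (elim x)
    have "A = Sigma S (\<lambda>n. A `` {n})" by (force simp: S_def)
    then have "(\<Sum>(n, I)\<in>A. c (n, I) * h n I x) = (\<Sum>(n, I)\<in>Sigma S (\<lambda>n. A `` {n}). c (n, I) * h n I x)" by simp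
    also have "\<dots> = (\<Sum>n\<in>S. \<Sum>I\<in>A `` {n}. c (n, I) * h n I x)"
      using A(1) finA by (subst sum.Sigma) (auto simp: S_def)
    also have "\<dots> = (\<Sum>n\<in>S. \<Sum>I\<in>A `` {n}. c (n, I) * blk h n (leaf_haar n I) x)"
      using elim by (intro sum.cong refl) force
    also have "\<dots> = blks S F x"
      unfolding blks_def F_def[abs_def] blk_sum ..
    finally show ?case .
  qed
  note m = V_measurable[OF f] V_measurable[OF V_finite_comb[OF A(1,2), of c]] V_measurable[OF blks_in_V[OF sf]]
  have "nrm (\<lambda>x. f x - blks S F x) = nrm (\<lambda>x. f x - (\<Sum>(n, I)\<in>A. c (n, I) * h n I x))"
    using m eq by (intro Lp_norm_cong) auto
  then show thesis using that[OF sf] A(3) by simp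
qed

section \<open>Operators that are linear up to null sets\<close>

lemma op_in_V: "bounded_op_on p V T C \<Longrightarrow> f \<in> V \<Longrightarrow> T f \<in> V"
  by (simp add: bounded_op_on_def)

lemma op_norm: "bounded_op_on p V T C \<Longrightarrow> f \<in> V \<Longrightarrow> nrm (T f) \<le> C * nrm f"
  by (simp add: bounded_op_on_def)

lemma op_lin: "bounded_op_on p V T C \<Longrightarrow> f \<in> V \<Longrightarrow> g \<in> V \<Longrightarrow> AE x in LM. T (\<lambda>y. a * f y + b * g y) x = a * T f x + b * T g x"
  by (simp add: bounded_op_on_def)

lemma op_diff:
  assumes T: "bounded_op_on p V T C" and f: "f \<in> V" and g: "g \<in> V"
  shows "AE x in LM. T (\<lambda>y. f y - g y) x = T f x - T g x"
    and "nrm (\<lambda>x. T f x - T g x) \<le> C * nrm (\<lambda>x. f x - g x)"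
proof -
  show ae: "AE x in LM. T (\<lambda>y. f y - g y) x = T f x - T g x"
    using op_lin[OF T f g, of 1 "-1"] by simp
  have "nrm (\<lambda>x. T f x - T g x) = nrm (T (\<lambda>y. f y - g y))"
    using ae V_measurable op_in_V[OF T] f g V_diff[OF f g] by (intro Lp_norm_cong) auto
  then show "nrm (\<lambda>x. T f x - T g x) \<le> C * nrm (\<lambda>x. f x - g x)"
    using op_norm[OF T V_diff[OF f g]] by simp
qed

lemma nrm_zero_AE: "f \<in> V \<Longrightarrow> g \<in> V \<Longrightarrow> nrm (\<lambda>x. f x - g x) \<le> 0 \<Longrightarrow> AE x in LM. f x = g x"
  using Lp_norm_eq_0_AE[OF p V_in_Lp[OF V_diff]] by fastforce

lemma AE_nrm_zero: "f \<in> V \<Longrightarrow> g \<in> V \<Longrightarrow> AE x in LM. f x = g x \<Longrightarrow> nrm (\<lambda>x. f x - g x) = 0"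
proof -
  assume "f \<in> V" "g \<in> V" "AE x in LM. f x = g x"
  then have "nrm (\<lambda>x. f x - g x) = nrm (\<lambda>x. 0)"
    using V_measurable by (intro Lp_norm_cong) auto
  then show ?thesis by (simp add: Lp_norm_zero)
qed

text \<open>Linearity and boundedness bound the difference of the images by the norm of f - g, so T
  acts on classes although it is given on functions.\<close>

lemma op_AE_cong:
  assumes T: "bounded_op_on p V T C" and "f \<in> V" "g \<in> V" "AE x in LM. f x = g x"
  shows "AE x in LM. T f x = T g x"
  using op_diff(2)[OF T assms(2,3)] AE_nrm_zero[OF assms(2-4)] op_in_V[OF T] assms
  by (intro nrm_zero_AE) auto

lemma op_sum:
  assumes T: "bounded_op_on p V T C" and "finite S" "\<And>i. i \<in> S \<Longrightarrow> f i \<in> V"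
  shows "AE x in LM. T (\<lambda>y. \<Sum>i\<in>S. c i * f i y) x = (\<Sum>i\<in>S. c i * T (f i) x)"
  using assms(2,3)
proof (induction S rule: finite_induct)
  case empty
  have "AE x in LM. T (\<lambda>y. 0) x = 0"
    using op_lin[OF T V_zero V_zero, of 0 0] by simp
  then show ?case by simp
next
  case (insert a S)
  have V: "f a \<in> V" "(\<lambda>y. \<Sum>i\<in>S. c i * f i y) \<in> V" using insert by (auto intro!: V_sum V_scale)
  have "AE x in LM. T (\<lambda>y. \<Sum>i\<in>S. c i * f i y) x = (\<Sum>i\<in>S. c i * T (f i) x)" using insert by auto
  with op_lin[OF T V, of "c a" 1] show ?case
    by eventually_elim (use insert in simp)
qed

text \<open>The space contains a function of positive norm, so a negative constant would produce a
  negative norm.\<close>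

lemma op_const_nonneg:
  assumes T: "bounded_op_on p V T C"
  shows "0 \<le> C"
proof (rule ccontr)
  assume C: "\<not> 0 \<le> C"
  have V: "h 1 (0, 1) \<in> V" by (rule h_in_V) (auto simp: nodes_def)
  have "nrm (h 1 (0, 1)) \<noteq> 0"
  proof
    assume "nrm (h 1 (0, 1)) = 0"
    then have z: "AE x in LM. h 1 (0, 1) x = 0" using Lp_norm_eq_0_AE[OF p V_in_Lp[OF V]] by simp
    have "AE x in LM. \<exists>j<2^1. x \<in> leaf_event h 1 j" by (rule AE_leaf_event) simp
    with z have "AE x in LM. False"
    proof eventually_elim
      case (elim x)
      then obtain j where j: "j < 2" "x \<in> leaf_event h 1 j" by auto
      have "h 1 (0, 1) x = leaf_haar 1 (0, 1) j" using j by (auto simp: leaf_event_def nodes_def)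
      moreover have "leaf_haar 1 (0, 1) j \<noteq> 0" using j by (auto simp: leaf_haar_def leaf_node_def leaf_bit_def)
      ultimately show ?case using elim by simp
    qed
    then show False using LM.AE_False by simp
  qed
  then have "C * nrm (h 1 (0, 1)) < 0" using C Lp_norm_nonneg[of p "h 1 (0, 1)"] by (intro mult_neg_pos) auto
  then show False using op_norm[OF T V] Lp_norm_nonneg[of p "T (h 1 (0, 1))"] by linarith
qed

lemma op_compose:
  assumes T: "bounded_op_on p V T C" and A: "bounded_op_on p V A D"
  shows "bounded_op_on p V (\<lambda>f. A (T f)) (D * C)"
  unfolding bounded_op_on_def
proof (intro conjI ballI allI)
  fix f assume f: "f \<in> V"
  show "A (T f) \<in> V" using f op_in_V[OF T] op_in_V[OF A] by blast
  have "nrm (A (T f)) \<le> D * nrm (T f)" using op_norm[OF A] op_in_V[OF T f] by blast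
  also have "\<dots> \<le> D * (C * nrm f)" using op_norm[OF T f] op_const_nonneg[OF A] by (intro mult_left_mono)
  finally show "nrm (A (T f)) \<le> D * C * nrm f" by (simp add: mult.assoc)
  fix g a b assume g: "g \<in> V"
  have "AE x in LM. A (T (\<lambda>y. a * f y + b * g y)) x = A (\<lambda>y. a * T f y + b * T g y) x"
    using op_in_V[OF T] f g V_lin by (intro op_AE_cong[OF A] op_lin[OF T]) auto
  then show "AE x in LM. A (T (\<lambda>y. a * f y + b * g y)) x = a * A (T f) x + b * A (T g) x"
    using op_lin[OF A op_in_V[OF T f] op_in_V[OF T g], of a b] by eventually_elim simp
qed

lemma V_complete:
  assumes "\<And>k. f k \<in> V" "\<And>e. e > 0 \<Longrightarrow> \<exists>K. \<forall>k\<ge>K. \<forall>j\<ge>K. nrm (\<lambda>x. f k x - f j x) < e"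
  shows "\<exists>g\<in>V. (\<lambda>k. nrm (\<lambda>x. f k x - g x)) \<longlonglongrightarrow> 0"
proof -
  obtain g where g: "in_Lp p g" "(\<lambda>k. nrm (\<lambda>x. f k x - g x)) \<longlonglongrightarrow> 0"
    using Lp_complete[OF p V_in_Lp[OF assms(1)] assms(2)] by blast
  have "g \<in> V"
  proof (rule V_closed[OF g(1)])
    fix e :: real assume "e > 0"
    then have "eventually (\<lambda>k. nrm (\<lambda>x. f k x - g x) < e) sequentially" using order_tendstoD(2)[OF g(2)] by blast
    then obtain k where "nrm (\<lambda>x. f k x - g x) < e" by (auto simp: eventually_sequentially)
    then show "\<exists>g'\<in>V. nrm (\<lambda>x. g x - g' x) < e" using assms(1) by (metis Lp_norm_minus_commute)
  qed
  then show ?thesis using g by blast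
qed

lemma nrm_lim_unique:
  assumes "\<And>k. f k \<in> V" "g \<in> V" "g' \<in> V" "(\<lambda>k. nrm (\<lambda>x. f k x - g x)) \<longlonglongrightarrow> 0" "(\<lambda>k. nrm (\<lambda>x. f k x - g' x)) \<longlonglongrightarrow> 0"
  shows "AE x in LM. g x = g' x"
proof (rule nrm_zero_AE[OF assms(2,3)])
  have "(\<lambda>k. nrm (\<lambda>x. f k x - g x) + nrm (\<lambda>x. f k x - g' x)) \<longlonglongrightarrow> 0 + 0"
    by (intro tendsto_add assms)
  moreover have "nrm (\<lambda>x. g x - g' x) \<le> nrm (\<lambda>x. f k x - g x) + nrm (\<lambda>x. f k x - g' x)" for k
    using nrm_diff_triangle[OF assms(2) assms(1) assms(3), of k] Lp_norm_minus_commute[of p g "f k"] by simp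
  ultimately show "nrm (\<lambda>x. g x - g' x) \<le> 0"
    by (intro LIMSEQ_le_const[where X = "\<lambda>k. nrm (\<lambda>x. f k x - g x) + nrm (\<lambda>x. f k x - g' x)"]) auto
qed

lemma nrm_lim_le:
  assumes "\<And>k. f k \<in> V" "g \<in> V" "(\<lambda>k. nrm (\<lambda>x. f k x - g x)) \<longlonglongrightarrow> 0" "\<And>k. k \<ge> K \<Longrightarrow> nrm (f k) \<le> b"
  shows "nrm g \<le> b"
proof -
  have "(\<lambda>k. nrm (\<lambda>x. f k x - g x) + b) \<longlonglongrightarrow> 0 + b" by (intro tendsto_intros assms)
  moreover have "nrm g \<le> nrm (\<lambda>x. f k x - g x) + b" if "k \<ge> K" for k
    using nrm_le_diff[OF assms(2) assms(1), of k] assms(4)[OF that] Lp_norm_minus_commute[of p g "f k"] by simp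
  ultimately have "nrm g \<le> 0 + b"
    by (intro LIMSEQ_le_const[where X = "\<lambda>k. nrm (\<lambda>x. f k x - g x) + b"]) auto
  then show ?thesis by simp
qed

text \<open>On block sums the sequence is eventually constant; contractivity and density make it a
  Cauchy sequence at every function of the space.\<close>

lemma limit_operator:
  assumes V: "\<And>M f. f \<in> V \<Longrightarrow> S M f \<in> V"
    and lin: "\<And>M f g a b x. f \<in> V \<Longrightarrow> g \<in> V \<Longrightarrow> S M (\<lambda>y. a * f y + b * g y) x = a * S M f x + b * S M g x"
    and bd: "\<And>M f. f \<in> V \<Longrightarrow> nrm (S M f) \<le> nrm f"
    and const: "\<And>A F. simple_fun A F \<Longrightarrow> \<exists>K. \<forall>M\<ge>K. S M (blks A F) = S K (blks A F)"
  obtains L where "bounded_op_on p V L 1" "\<And>f. f \<in> V \<Longrightarrow> (\<lambda>M. nrm (\<lambda>x. S M f x - L f x)) \<longlonglongrightarrow> 0"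
proof -
  have diff: "nrm (\<lambda>x. S M f x - S M g x) \<le> nrm (\<lambda>x. f x - g x)" if "f \<in> V" "g \<in> V" for M f g
  proof -
    have "(\<lambda>x. S M f x - S M g x) = S M (\<lambda>x. f x - g x)"
      using lin[OF that, of M 1 "-1"] by (simp add: fun_eq_iff)
    then show ?thesis using bd[OF V_diff[OF that]] by simp
  qed
  have "\<exists>g\<in>V. (\<lambda>M. nrm (\<lambda>x. S M f x - g x)) \<longlonglongrightarrow> 0" if f: "f \<in> V" for f
  proof (rule V_complete)
    fix e :: real assume e: "e > 0"
    obtain A F where A: "simple_fun A F" "nrm (\<lambda>x. f x - blks A F x) < e / 2"
      using V_approx[OF f, of "e/2"] e by auto
    obtain K where K: "\<And>M. M \<ge> K \<Longrightarrow> S M (blks A F) = S K (blks A F)" using const[OF A(1)] by blast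
    have b: "blks A F \<in> V" using A blks_in_V by blast
    have "nrm (\<lambda>x. S k f x - S j f x) < e" if "k \<ge> K" "j \<ge> K" for k j
    proof -
      have "nrm (\<lambda>x. S k f x - S j f x) \<le> nrm (\<lambda>x. S k f x - S k (blks A F) x) + nrm (\<lambda>x. S k (blks A F) x - S j f x)"
        using V f b by (intro nrm_diff_triangle) auto
      also have "S k (blks A F) = S j (blks A F)" using K that by metis
      also have "nrm (\<lambda>x. S k f x - S j (blks A F) x) \<le> nrm (\<lambda>x. f x - blks A F x)"
        using diff[OF f b, of k] K that by metis
      also have "nrm (\<lambda>x. S j (blks A F) x - S j f x) \<le> nrm (\<lambda>x. f x - blks A F x)"
        using diff[OF f b, of j] by (metis Lp_norm_minus_commute)
      finally show ?thesis using A by simp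
    qed
    then show "\<exists>K. \<forall>k\<ge>K. \<forall>j\<ge>K. nrm (\<lambda>x. S k f x - S j f x) < e" by blast
  qed (use V f in auto)
  then obtain L where L: "\<And>f. f \<in> V \<Longrightarrow> L f \<in> V" "\<And>f. f \<in> V \<Longrightarrow> (\<lambda>M. nrm (\<lambda>x. S M f x - L f x)) \<longlonglongrightarrow> 0"
    by metis
  have "bounded_op_on p V L 1"
    unfolding bounded_op_on_def
  proof (intro conjI ballI allI)
    fix f assume f: "f \<in> V"
    show "L f \<in> V" using L f by blast
    show "nrm (L f) \<le> 1 * nrm f"
      using nrm_lim_le[OF V[OF f] L(1)[OF f] L(2)[OF f], of 0 "nrm f"] bd[OF f] by simp
    fix g a b assume g: "g \<in> V"
    have fg: "(\<lambda>y. a * f y + b * g y) \<in> V" using V_lin f g by blast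
    have Lfg: "(\<lambda>y. a * L f y + b * L g y) \<in> V" using V_lin L f g by blast
    have "(\<lambda>M. nrm (\<lambda>x. S M (\<lambda>y. a * f y + b * g y) x - (a * L f x + b * L g x))) \<longlonglongrightarrow> 0"
    proof (rule tendsto_sandwich[OF _ _ tendsto_const])
      show "(\<lambda>M. \<bar>a\<bar> * nrm (\<lambda>x. S M f x - L f x) + \<bar>b\<bar> * nrm (\<lambda>x. S M g x - L g x)) \<longlonglongrightarrow> 0"
        using tendsto_add[OF tendsto_mult_right_zero[OF L(2)[OF f], of "\<bar>a\<bar>"] tendsto_mult_right_zero[OF L(2)[OF g], of "\<bar>b\<bar>"]] by simp
      show "eventually (\<lambda>M. nrm (\<lambda>x. S M (\<lambda>y. a * f y + b * g y) x - (a * L f x + b * L g x)) \<le>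
          \<bar>a\<bar> * nrm (\<lambda>x. S M f x - L f x) + \<bar>b\<bar> * nrm (\<lambda>x. S M g x - L g x)) sequentially"
      proof (intro always_eventually allI)
        fix M
        note Lf = V_in_Lp[OF V_diff[OF V[OF f] L(1)[OF f]], of M] and Lg = V_in_Lp[OF V_diff[OF V[OF g] L(1)[OF g]], of M]
        have "nrm (\<lambda>x. S M (\<lambda>y. a * f y + b * g y) x - (a * L f x + b * L g x)) = nrm (\<lambda>x. a * (S M f x - L f x) + b * (S M g x - L g x))"
          unfolding lin[OF f g] by (simp add: algebra_simps)
        also have "\<dots> \<le> nrm (\<lambda>x. a * (S M f x - L f x)) + nrm (\<lambda>x. b * (S M g x - L g x))"
          by (rule Lp_norm_triangle[OF p1 in_Lp_scale[OF p1 Lf] in_Lp_scale[OF p1 Lg]])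
        also have "\<dots> = \<bar>a\<bar> * nrm (\<lambda>x. S M f x - L f x) + \<bar>b\<bar> * nrm (\<lambda>x. S M g x - L g x)"
          using Lp_norm_scale[OF p1 Lf] Lp_norm_scale[OF p1 Lg] by simp
        finally show "nrm (\<lambda>x. S M (\<lambda>y. a * f y + b * g y) x - (a * L f x + b * L g x)) \<le>
          \<bar>a\<bar> * nrm (\<lambda>x. S M f x - L f x) + \<bar>b\<bar> * nrm (\<lambda>x. S M g x - L g x)" .
      qed
    qed (auto simp: Lp_norm_nonneg)
    then show "AE x in LM. L (\<lambda>y. a * f y + b * g y) x = a * L f x + b * L g x"
      by (intro nrm_lim_unique[OF V[OF fg] L(1)[OF fg] Lfg L(2)[OF fg]])
  qed
  then show thesis using that L by blast
qed

text \<open>Surjectivity comes from a Neumann iteration. Injectivity and the norm of the inverse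
  come from the lower bound (|c| - \<eta>) |f| \<le> |U f|, and injectivity makes the chosen
  preimages linear up to null sets.\<close>

lemma near_scalar_inverse:
  assumes U: "bounded_op_on p V U D" and near: "\<And>f. f \<in> V \<Longrightarrow> nrm (\<lambda>x. U f x - c * f x) \<le> \<eta> * nrm f"
    and \<eta>: "0 \<le> \<eta>" "\<eta> < \<bar>c\<bar>"
  obtains W where "bounded_op_on p V W (1 / (\<bar>c\<bar> - \<eta>))" "\<And>f. f \<in> V \<Longrightarrow> AE x in LM. W (U f) x = f x"
proof -
  have c0: "c \<noteq> 0" using \<eta> by auto
  have lower: "(\<bar>c\<bar> - \<eta>) * nrm f \<le> nrm (U f)" if f: "f \<in> V" for f
  proof -
    have "nrm (\<lambda>x. c * f x) \<le> nrm (\<lambda>x. c * f x - U f x) + nrm (U f)"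
      by (rule nrm_le_diff[OF V_scale[OF f] op_in_V[OF U f]])
    then have "\<bar>c\<bar> * nrm f \<le> \<eta> * nrm f + nrm (U f)"
      using near[OF f] Lp_norm_scale[OF p1 V_in_Lp[OF f], of c] Lp_norm_minus_commute[of p "\<lambda>x. c * f x" "U f"] by simp
    then show ?thesis by (simp add: algebra_simps)
  qed
  have surj: "\<exists>g\<in>V. AE x in LM. U g x = f x" if f: "f \<in> V" for f
  proof -
    define \<theta> where "\<theta> = \<eta> / \<bar>c\<bar>"
    have \<theta>: "0 \<le> \<theta>" "\<theta> < 1" using \<eta> by (auto simp: \<theta>_def)
    \<comment> \<open>Each step adds the residual divided by c; what is left of the residual is
      smaller by the factor \<eta> / |c|.\<close>
    define g where "g = rec_nat (\<lambda>x. 0) (\<lambda>_ g x. 1 * g x + (1 / c) * (f x - U g x))"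
    have g0: "g 0 = (\<lambda>x. 0)" and gS: "g (Suc k) = (\<lambda>x. 1 * g k x + (1 / c) * (f x - U (g k) x))" for k
      by (simp_all add: g_def)
    have gV: "g k \<in> V" for k
    proof (induction k)
      case (Suc k)
      have "(\<lambda>x. f x - U (g k) x) \<in> V" using Suc f op_in_V[OF U] by (intro V_diff) auto
      then show ?case unfolding gS by (intro V_lin Suc)
    qed (simp add: g0 V_zero)
    define r where "r k = (\<lambda>x. f x - U (g k) x)" for k
    have rV: "r k \<in> V" for k unfolding r_def using gV f op_in_V[OF U] by (intro V_diff) auto
    have rS: "nrm (r (Suc k)) \<le> \<theta> * nrm (r k)" for k
    proof -
      have ae: "AE x in LM. r (Suc k) x = (- 1 / c) * (U (r k) x - c * r k x)"
        using op_lin[OF U gV rV, of 1 k "1 / c" k]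
      proof eventually_elim
        case (elim x)
        have "U (g (Suc k)) x = 1 * U (g k) x + (1 / c) * U (r k) x"
          using elim by (simp add: gS r_def)
        then show ?case using c0 by (simp add: r_def field_simps)
      qed
      have d: "(\<lambda>x. U (r k) x - c * r k x) \<in> V" using rV op_in_V[OF U] by (intro V_diff V_scale) auto
      have "nrm (r (Suc k)) = nrm (\<lambda>x. (- 1 / c) * (U (r k) x - c * r k x))"
        using ae V_measurable[OF rV] V_measurable[OF V_scale[OF d]] by (intro Lp_norm_cong)
      also have "\<dots> = \<bar>- 1 / c\<bar> * nrm (\<lambda>x. U (r k) x - c * r k x)"
        by (rule Lp_norm_scale[OF p1 V_in_Lp[OF d]])
      also have "\<dots> \<le> \<bar>- 1 / c\<bar> * (\<eta> * nrm (r k))" using near[OF rV] by (intro mult_left_mono) auto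
      finally show ?thesis by (simp add: \<theta>_def abs_divide)
    qed
    have rk: "nrm (r k) \<le> \<theta> ^ k * nrm (r 0)" for k
    proof (induction k)
      case (Suc k)
      have "nrm (r (Suc k)) \<le> \<theta> * (\<theta> ^ k * nrm (r 0))"
        using rS[of k] Suc \<theta> by (meson mult_left_mono order_trans)
      then show ?case by (simp add: mult.assoc)
    qed simp
    \<comment> \<open>The sum of the geometric series of increments, so that the bounds in
      \<open>step\<close> telescope.\<close>
    define b where "b = nrm (r 0) / (\<bar>c\<bar> * (1 - \<theta>))"
    have b0: "0 \<le> b" using \<theta> Lp_norm_nonneg[of p "r 0"] by (simp add: b_def)
    have step: "nrm (\<lambda>x. g (Suc k) x - g k x) \<le> b * (\<theta> ^ k - \<theta> ^ Suc k)" for k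
    proof -
      have "nrm (\<lambda>x. g (Suc k) x - g k x) = nrm (\<lambda>x. (1 / c) * r k x)" by (simp add: gS r_def)
      also have "\<dots> = nrm (r k) / \<bar>c\<bar>" using Lp_norm_scale[OF p1 V_in_Lp[OF rV], of "1 / c" k] by simp
      also have "\<dots> \<le> (\<theta> ^ k * nrm (r 0)) / \<bar>c\<bar>" using rk by (intro divide_right_mono) auto
      also have "\<dots> = b * (\<theta> ^ k - \<theta> ^ Suc k)" using \<theta> c0 by (simp add: b_def field_simps)
      finally show ?thesis .
    qed
    have dist: "nrm (\<lambda>x. g (k + j) x - g k x) \<le> b * (\<theta> ^ k - \<theta> ^ (k + j))" for k j
    proof (induction j)
      case (Suc j)
      have "nrm (\<lambda>x. g (k + Suc j) x - g k x) \<le> nrm (\<lambda>x. g (Suc (k + j)) x - g (k + j) x) + nrm (\<lambda>x. g (k + j) x - g k x)"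
        using nrm_diff_triangle[OF gV gV gV, of "k + Suc j" k "k + j"] by simp
      also have "\<dots> \<le> b * (\<theta> ^ (k + j) - \<theta> ^ Suc (k + j)) + b * (\<theta> ^ k - \<theta> ^ (k + j))"
        using step[of "k + j"] Suc by simp
      finally show ?case by (simp add: algebra_simps)
    qed (simp add: Lp_norm_zero)
    have dist': "nrm (\<lambda>x. g k x - g j x) \<le> b * \<theta> ^ K" if "k \<ge> K" "j \<ge> K" for k j K
    proof -
      have *: "nrm (\<lambda>x. g k x - g j x) \<le> b * \<theta> ^ K" if "K \<le> j" "j \<le> k" for j k
      proof -
        have "nrm (\<lambda>x. g (j + (k - j)) x - g j x) \<le> b * (\<theta> ^ j - \<theta> ^ (j + (k - j)))" by (rule dist)
        also have "\<dots> \<le> b * \<theta> ^ K"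
        proof (rule mult_left_mono[OF _ b0])
          have "\<theta> ^ j \<le> \<theta> ^ K" using \<theta> that by (intro power_decreasing) auto
          moreover have "0 \<le> \<theta> ^ (j + (k - j))" using \<theta> by simp
          ultimately show "\<theta> ^ j - \<theta> ^ (j + (k - j)) \<le> \<theta> ^ K" by linarith
        qed
        finally show ?thesis using that by simp
      qed
      show ?thesis
      proof (cases "j \<le> k")
        case False
        then show ?thesis using *[of k j] that Lp_norm_minus_commute[of p "g k" "g j"] by simp
      qed (use * that in simp)
    qed
    have "(\<lambda>K. b * \<theta> ^ K) \<longlonglongrightarrow> b * 0" using \<theta> by (intro tendsto_intros LIMSEQ_power_zero) auto
    then have small: "\<exists>K. b * \<theta> ^ K < e" if "e > 0" for e
      using order_tendstoD(2)[of "\<lambda>K. b * \<theta> ^ K" "b * 0" sequentially e] that by (auto simp: eventually_sequentially)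
    have "\<exists>g'\<in>V. (\<lambda>k. nrm (\<lambda>x. g k x - g' x)) \<longlonglongrightarrow> 0"
    proof (rule V_complete[OF gV])
      fix e :: real assume "e > 0"
      then obtain K where "b * \<theta> ^ K < e" using small by blast
      then show "\<exists>K. \<forall>k\<ge>K. \<forall>j\<ge>K. nrm (\<lambda>x. g k x - g j x) < e" using dist' by (meson le_less_trans)
    qed
    then obtain g' where g': "g' \<in> V" "(\<lambda>k. nrm (\<lambda>x. g k x - g' x)) \<longlonglongrightarrow> 0" by blast
    have "(\<lambda>k. nrm (\<lambda>x. U (g k) x - U g' x)) \<longlonglongrightarrow> 0"
    proof (rule tendsto_sandwich[OF _ _ tendsto_const])
      show "(\<lambda>k. D * nrm (\<lambda>x. g k x - g' x)) \<longlonglongrightarrow> 0" using tendsto_mult_right_zero[OF g'(2)] .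
    qed (use op_diff(2)[OF U gV g'(1)] in \<open>auto simp: Lp_norm_nonneg\<close>)
    moreover have "(\<lambda>k. nrm (\<lambda>x. U (g k) x - f x)) \<longlonglongrightarrow> 0"
    proof (rule tendsto_sandwich[OF _ _ tendsto_const])
      show "(\<lambda>k. \<theta> ^ k * nrm (r 0)) \<longlonglongrightarrow> 0"
        using \<theta> by (intro tendsto_mult_left_zero LIMSEQ_power_zero) auto
    qed (use rk in \<open>auto simp: Lp_norm_nonneg r_def Lp_norm_minus_commute[of p f]\<close>)
    ultimately have "AE x in LM. U g' x = f x"
      using op_in_V[OF U] gV g'(1) f by (intro nrm_lim_unique[of "\<lambda>k. U (g k)"]) auto
    then show ?thesis using g' by blast
  qed
  obtain W where W: "\<And>f. f \<in> V \<Longrightarrow> W f \<in> V" "\<And>f. f \<in> V \<Longrightarrow> AE x in LM. U (W f) x = f x"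
    using surj by metis
  have inj: "AE x in LM. f x = g x" if f: "f \<in> V" and g: "g \<in> V" and eq: "AE x in LM. U f x = U g x" for f g
  proof (rule nrm_zero_AE[OF f g])
    have "(\<bar>c\<bar> - \<eta>) * nrm (\<lambda>x. f x - g x) \<le> nrm (U (\<lambda>x. f x - g x))" by (rule lower[OF V_diff[OF f g]])
    also have "\<dots> = nrm (\<lambda>x. U f x - U g x)"
      using op_diff(1)[OF U f g] V_measurable op_in_V[OF U] f g V_diff[OF f g] by (intro Lp_norm_cong) auto
    also have "\<dots> = 0" using AE_nrm_zero[OF op_in_V[OF U f] op_in_V[OF U g] eq] .
    finally show "nrm (\<lambda>x. f x - g x) \<le> 0" using \<eta> by (simp add: mult_le_0_iff)
  qed
  have "bounded_op_on p V W (1 / (\<bar>c\<bar> - \<eta>))"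
    unfolding bounded_op_on_def
  proof (intro conjI ballI allI)
    fix f assume f: "f \<in> V"
    show "W f \<in> V" using W f by blast
    have "nrm (U (W f)) = nrm f"
      using W(2)[OF f] V_measurable op_in_V[OF U] W(1) f by (intro Lp_norm_cong) auto
    then show "nrm (W f) \<le> 1 / (\<bar>c\<bar> - \<eta>) * nrm f"
      using lower[OF W(1)[OF f]] \<eta> by (simp add: field_simps)
    fix g a b assume g: "g \<in> V"
    have fg: "(\<lambda>y. a * f y + b * g y) \<in> V" by (rule V_lin[OF f g])
    show "AE x in LM. W (\<lambda>y. a * f y + b * g y) x = a * W f x + b * W g x"
    proof (rule inj[OF W(1)[OF fg] V_lin[OF W(1)[OF f] W(1)[OF g]]])
      show "AE x in LM. U (W (\<lambda>y. a * f y + b * g y)) x = U (\<lambda>y. a * W f y + b * W g y) x"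
        using W(2)[OF fg] W(2)[OF f] W(2)[OF g] op_lin[OF U W(1)[OF f] W(1)[OF g], of a b]
        by eventually_elim simp
    qed
  qed
  moreover have "AE x in LM. W (U f) x = f x" if f: "f \<in> V" for f
    using inj[OF W(1)[OF op_in_V[OF U f]] f W(2)[OF op_in_V[OF U f]]] .
  ultimately show thesis using that by blast
qed

end

section \<open>Transfer between blocks\<close>

context haar_copies_Lp
begin

text \<open>A block function pairs with g only through these finitely many integrals, which reduces
  linearity of the pairing to finite sums.\<close>

definition leaf_fun :: "nat \<Rightarrow> nat \<Rightarrow> (real \<Rightarrow> real) \<Rightarrow> real" where
  "leaf_fun n j g = (\<integral>x. g x * indicator (leaf_event h n j) x \<partial>LM)"

lemma integrable_leaf_fun:
  assumes "1 \<le> n" "g \<in> V"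
  shows "integrable LM (\<lambda>x. g x * indicator (leaf_event h n j) x)"
  using leaf_event_sets[OF assms(1)] integral_abs_le_Lp_norm(1)[OF p V_in_Lp[OF assms(2)]]
  by (rule integrable_real_mult_indicator)

lemma leaf_fun_lin:
  assumes "1 \<le> n" "f \<in> V" "g \<in> V"
  shows "leaf_fun n j (\<lambda>x. a * f x + b * g x) = a * leaf_fun n j f + b * leaf_fun n j g"
  using integrable_leaf_fun[OF assms(1,2), of j] integrable_leaf_fun[OF assms(1,3), of j]
  by (simp add: leaf_fun_def distrib_right mult.assoc)

lemma inner_L_blk:
  assumes n: "1 \<le> n" and g: "g \<in> V"
  shows "inner_L (blk h n F) g = (\<Sum>j<2^n. F j * leaf_fun n j g)"
proof -
  have "inner_L (blk h n F) g = (\<integral>x. (\<Sum>j<2^n. F j * (g x * indicator (leaf_event h n j) x)) \<partial>LM)"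
    unfolding inner_L_def blk_def sum_distrib_right by (simp only: mult_ac)
  also have "\<dots> = (\<Sum>j<2^n. F j * leaf_fun n j g)"
    unfolding leaf_fun_def using integrable_leaf_fun[OF n g] by (subst Bochner_Integration.integral_sum) auto
  finally show ?thesis .
qed

lemma inner_L_blk_sum_left:
  assumes "1 \<le> n" "g \<in> V"
  shows "inner_L (blk h n (\<lambda>y. \<Sum>i\<in>S. c i * F i y)) g = (\<Sum>i\<in>S. c i * inner_L (blk h n (F i)) g)"
  unfolding inner_L_blk[OF assms] sum_distrib_left sum_distrib_right by (subst sum.swap) (simp add: mult.assoc)

lemma inner_L_blk_lin:
  assumes "1 \<le> n" "f \<in> V" "g \<in> V"
  shows "inner_L (blk h n F) (\<lambda>x. a * f x + b * g x) = a * inner_L (blk h n F) f + b * inner_L (blk h n F) g"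
  unfolding inner_L_blk[OF assms(1) V_lin[OF assms(2,3)]] inner_L_blk[OF assms(1,2)] inner_L_blk[OF assms(1,3)] leaf_fun_lin[OF assms]
  by (simp add: sum_distrib_left sum.distrib algebra_simps)

lemma inner_L_blk_sum_right:
  assumes n: "1 \<le> n" and "finite S" "\<And>i. i \<in> S \<Longrightarrow> f i \<in> V"
  shows "inner_L (blk h n F) (\<lambda>x. \<Sum>i\<in>S. c i * f i x) = (\<Sum>i\<in>S. c i * inner_L (blk h n F) (f i))"
  using assms(2,3)
proof (induction S rule: finite_induct)
  case (insert a S)
  have "f a \<in> V" "(\<lambda>x. \<Sum>i\<in>S. c i * f i x) \<in> V" using insert by (auto intro!: V_sum V_scale)
  from inner_L_blk_lin[OF n this, of F "c a" 1] insert show ?case by simp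
qed (simp add: inner_L_def)

lemma inner_L_AE_cong:
  assumes "AE x in LM. u x = u' x" "AE x in LM. f x = f' x"
    "u \<in> borel_measurable LM" "u' \<in> borel_measurable LM" "f \<in> borel_measurable LM" "f' \<in> borel_measurable LM"
  shows "inner_L u f = inner_L u' f'"
  unfolding inner_L_def
proof (rule integral_cong_AE)
  show "AE x in LM. u x * f x = u' x * f' x" using assms(1,2) by eventually_elim simp
qed (use assms in auto)

lemma AE_blk_abs_le:
  assumes n: "1 \<le> n" and F: "\<And>y. y < 2 ^ n \<Longrightarrow> \<bar>F y\<bar> \<le> b"
  shows "AE x in LM. \<bar>blk h n F x\<bar> \<le> b"
  using AE_leaf_event[OF n] by eventually_elim (use F blk_eq in auto)

lemma inner_L_blk_le:
  assumes n: "1 \<le> n" and F: "\<And>y. y < 2 ^ n \<Longrightarrow> \<bar>F y\<bar> \<le> 1" and g: "g \<in> V"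
  shows "\<bar>inner_L (blk h n F) g\<bar> \<le> nrm g"
proof -
  define q where "q = p / (p - 1)"
  have q: "1 \<le> q" using p by (simp add: q_def field_simps)
  note ae = AE_blk_abs_le[OF n F]
  have "\<bar>inner_L (blk h n F) g\<bar> \<le> Lp_norm q (blk h n F) * nrm g"
    using n by (intro Holder_inner_L[OF p q_def V_in_Lp[OF g]] in_Lp_bounded[OF q _ ae]) auto
  also have "\<dots> \<le> 1 * nrm g"
    using n by (intro mult_right_mono Lp_norm_bounded[OF q _ ae] Lp_norm_nonneg) auto
  finally show ?thesis by simp
qed

lemma nrm_blk_le_1:
  assumes "1 \<le> n" "\<And>y. y < 2 ^ n \<Longrightarrow> \<bar>F y\<bar> \<le> 1"
  shows "nrm (blk h n F) \<le> 1"
  using assms by (intro Lp_norm_bounded[OF p1 _ AE_blk_abs_le]) auto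

text \<open>Different blocks are independent and each F m has mean zero, so only block n of the sum
  contributes.\<close>

lemma inner_L_blk_blks:
  assumes n: "1 \<le> n" and S: "simple_fun S F"
  shows "inner_L (blk h n G) (blks S F) = (if n \<in> S then leaf_avg n (\<lambda>y. G y * F n y) else 0)"
proof -
  have fin: "finite S" and SF: "\<And>m. m \<in> S \<Longrightarrow> 1 \<le> m \<and> leaf_avg m (F m) = 0" using S by (auto simp: simple_fun_def)
  have "inner_L (blk h n G) (blks S F) = (\<Sum>m\<in>S. inner_L (blk h n G) (blk h m (F m)))"
    using inner_L_blk_sum_right[OF n fin, of "\<lambda>m. blk h m (F m)" G "\<lambda>_. 1"] blk_in_V SF by (simp add: blks_def[abs_def])
  also have "\<dots> = (\<Sum>m\<in>S. if m = n then leaf_avg n (\<lambda>y. G y * F n y) else 0)"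
    using SF n by (intro sum.cong refl) (auto simp: inner_L_blk_same inner_L_blk_diff)
  also have "\<dots> = (if n \<in> S then leaf_avg n (\<lambda>y. G y * F n y) else 0)" using fin by simp
  finally show ?thesis .
qed

text \<open>A conditional expectation written as a kernel: the identity on the blocks that are kept
  and uniform averaging, which annihilates mean zero functions, on the others.\<close>

lemma nrm_drop_blocks:
  assumes S: "simple_fun S F" and S': "S' \<subseteq> S"
  shows "nrm (blks S' F) \<le> nrm (blks S F)"
proof -
  have fin: "finite S" and SF: "\<And>m. m \<in> S \<Longrightarrow> 1 \<le> m \<and> leaf_avg m (F m) = 0" using S by (auto simp: simple_fun_def)
  define K :: "nat \<Rightarrow> nat \<Rightarrow> nat \<Rightarrow> real" where "K i u v = (if i \<in> S' then if u = v then 1 else 0 else 1 / 2 ^ i)" for i u v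
  have "nrm (\<lambda>x. \<Sum>i\<in>S. blk h i (\<lambda>u. \<Sum>v<2^i. K i u v * F i v) x) \<le> nrm (\<lambda>x. \<Sum>i\<in>S. blk h i (F i) x)"
  proof (rule kernel_contraction[OF p1 fin])
    fix i u :: nat assume "u < 2 ^ i"
    then show "(\<Sum>v<2^i. K i u v) = 1" by (cases "i \<in> S'") (simp_all add: K_def)
  next
    fix i v :: nat assume "v < 2 ^ i"
    then show "(\<Sum>u<2^i. K i u v) / 2 ^ i = 1 / 2 ^ i" by (cases "i \<in> S'") (simp_all add: K_def)
  qed (use SF in \<open>auto simp: K_def\<close>)
  also have "(\<lambda>x. \<Sum>i\<in>S. blk h i (\<lambda>u. \<Sum>v<2^i. K i u v * F i v) x) = blks S' F"
  proof
    fix x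
    have "(\<Sum>i\<in>S. blk h i (\<lambda>u. \<Sum>v<2^i. K i u v * F i v) x) = (\<Sum>i\<in>S. if i \<in> S' then blk h i (F i) x else 0)"
    proof (intro sum.cong refl)
      fix i assume i: "i \<in> S"
      show "blk h i (\<lambda>u. \<Sum>v<2^i. K i u v * F i v) x = (if i \<in> S' then blk h i (F i) x else 0)"
      proof (cases "i \<in> S'")
        case True
        have "(\<Sum>v<2^i. K i u v * F i v) = F i u" if "u < 2 ^ i" for u
        proof -
          have "(\<Sum>v<2^i. K i u v * F i v) = (\<Sum>v<2^i. if v = u then F i v else 0)"
            using True by (intro sum.cong) (auto simp: K_def)
          then show ?thesis using that by simp
        qed
        then show ?thesis using True blk_cong[of i "\<lambda>u. \<Sum>v<2^i. K i u v * F i v" "F i" x] by simp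
      next
        case False
        have "(\<Sum>v<2^i. K i u v * F i v) = leaf_avg i (F i)" for u
          using False by (simp add: K_def leaf_avg_def sum_divide_distrib)
        then show ?thesis using False SF[OF i] by (simp add: blk_def)
      qed
    qed
    also have "\<dots> = (\<Sum>i\<in>S'. blk h i (F i) x)"
      using S' fin by (simp add: sum.If_cases Int_absorb1)
    finally show "(\<Sum>i\<in>S. blk h i (\<lambda>u. \<Sum>v<2^i. K i u v * F i v) x) = blks S' F x" by (simp add: blks_def)
  qed
  finally show ?thesis by (simp add: blks_def[abs_def])
qed

end

text \<open>A common frame for both directions: block \<open>\<mu> n\<close> is analysed by pairing
  with U and rebuilt in block \<open>\<nu> n\<close> by W. The coefficient form is meaningful on the
  whole space, while \<open>rep\<close> identifies it with a doubly stochastic kernel on mean zero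
  functions and so gives the norm bound.\<close>

locale block_transfer = haar_copies_Lp +
  fixes \<mu> \<nu> :: "nat \<Rightarrow> nat" and U W :: "nat \<Rightarrow> nat \<times> nat \<Rightarrow> nat \<Rightarrow> real" and K :: "nat \<Rightarrow> nat \<Rightarrow> nat \<Rightarrow> real"
  assumes \<mu>: "\<And>n. 1 \<le> n \<Longrightarrow> n \<le> \<mu> n" "inj_on \<mu> {1..}"
    and \<nu>: "\<And>n. 1 \<le> n \<Longrightarrow> 1 \<le> \<nu> n" "inj_on \<nu> {1..}"
    and W0: "\<And>n I. 1 \<le> n \<Longrightarrow> I \<in> nodes n \<Longrightarrow> leaf_avg (\<nu> n) (W n I) = 0"
    and U1: "\<And>n I y. 1 \<le> n \<Longrightarrow> I \<in> nodes n \<Longrightarrow> y < 2 ^ \<mu> n \<Longrightarrow> \<bar>U n I y\<bar> \<le> 1"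
    and W1: "\<And>n I y. 1 \<le> n \<Longrightarrow> I \<in> nodes n \<Longrightarrow> y < 2 ^ \<nu> n \<Longrightarrow> \<bar>W n I y\<bar> \<le> 1"
    and K0: "\<And>n u v. 1 \<le> n \<Longrightarrow> u < 2 ^ \<nu> n \<Longrightarrow> v < 2 ^ \<mu> n \<Longrightarrow> 0 \<le> K n u v"
    and Krow: "\<And>n u. 1 \<le> n \<Longrightarrow> u < 2 ^ \<nu> n \<Longrightarrow> (\<Sum>v<2^\<mu> n. K n u v) = 1"
    and Kcol: "\<And>n v. 1 \<le> n \<Longrightarrow> v < 2 ^ \<mu> n \<Longrightarrow> (\<Sum>u<2^\<nu> n. K n u v) / 2 ^ \<nu> n = 1 / 2 ^ \<mu> n"
    and rep: "\<And>n F u. 1 \<le> n \<Longrightarrow> leaf_avg (\<mu> n) F = 0 \<Longrightarrow> u < 2 ^ \<nu> n \<Longrightarrow>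
      (\<Sum>I\<in>nodes n. leaf_avg (\<mu> n) (\<lambda>y. U n I y * F y) / node_len I * W n I u) = (\<Sum>v<2^\<mu> n. K n u v * F v)"
begin

definition trunc :: "nat \<Rightarrow> (real \<Rightarrow> real) \<Rightarrow> real \<Rightarrow> real" where
  "trunc M f x = (\<Sum>n=1..M. \<Sum>I\<in>nodes n. inner_L (blk h (\<mu> n) (U n I)) f / node_len I * blk h (\<nu> n) (W n I) x)"

lemma \<mu>1: "1 \<le> n \<Longrightarrow> 1 \<le> \<mu> n"
  using \<mu>(1) order_trans by blast

lemma trunc_in_V: "trunc M f \<in> V"
  unfolding trunc_def[abs_def] using \<nu>(1) W0 by (intro V_sum V_scale blk_in_V) auto

lemma trunc_lin:
  assumes "f \<in> V" "g \<in> V"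
  shows "trunc M (\<lambda>y. a * f y + b * g y) x = a * trunc M f x + b * trunc M g x"
proof -
  have "trunc M (\<lambda>y. a * f y + b * g y) x = (\<Sum>n=1..M. \<Sum>I\<in>nodes n. (a * inner_L (blk h (\<mu> n) (U n I)) f + b * inner_L (blk h (\<mu> n) (U n I)) g) / node_len I * blk h (\<nu> n) (W n I) x)"
    unfolding trunc_def by (intro sum.cong refl) (simp add: inner_L_blk_lin[OF \<mu>1 assms])
  then show ?thesis
    by (simp add: trunc_def sum_distrib_left sum.distrib add_divide_distrib distrib_right mult.assoc)
qed

lemma trunc_blks:
  assumes S: "simple_fun S F"
  shows "trunc M (blks S F) x = (\<Sum>n\<in>{n\<in>{1..M}. \<mu> n \<in> S}. blk h (\<nu> n) (\<lambda>u. \<Sum>v<2^\<mu> n. K n u v * F (\<mu> n) v) x)"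
proof -
  have SF: "\<And>m. m \<in> S \<Longrightarrow> 1 \<le> m \<and> leaf_avg m (F m) = 0" using S by (auto simp: simple_fun_def)
  have "trunc M (blks S F) x = (\<Sum>n=1..M. if \<mu> n \<in> S then blk h (\<nu> n) (\<lambda>u. \<Sum>v<2^\<mu> n. K n u v * F (\<mu> n) v) x else 0)"
    unfolding trunc_def
  proof (intro sum.cong refl)
    fix n assume "n \<in> {1..M}"
    then have n: "1 \<le> n" by simp
    show "(\<Sum>I\<in>nodes n. inner_L (blk h (\<mu> n) (U n I)) (blks S F) / node_len I * blk h (\<nu> n) (W n I) x) =
      (if \<mu> n \<in> S then blk h (\<nu> n) (\<lambda>u. \<Sum>v<2^\<mu> n. K n u v * F (\<mu> n) v) x else 0)"
      unfolding inner_L_blk_blks[OF \<mu>1[OF n] S]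
    proof (cases "\<mu> n \<in> S")
      case True
      have "(\<Sum>I\<in>nodes n. leaf_avg (\<mu> n) (\<lambda>y. U n I y * F (\<mu> n) y) / node_len I * blk h (\<nu> n) (W n I) x)
        = blk h (\<nu> n) (\<lambda>u. \<Sum>I\<in>nodes n. leaf_avg (\<mu> n) (\<lambda>y. U n I y * F (\<mu> n) y) / node_len I * W n I u) x"
        by (rule blk_sum[symmetric])
      also have "\<dots> = blk h (\<nu> n) (\<lambda>u. \<Sum>v<2^\<mu> n. K n u v * F (\<mu> n) v) x"
        using SF[OF True] rep[OF n] by (intro blk_cong) auto
      finally show "(\<Sum>I\<in>nodes n. (if \<mu> n \<in> S then leaf_avg (\<mu> n) (\<lambda>y. U n I y * F (\<mu> n) y) else 0) / node_len I * blk h (\<nu> n) (W n I) x) =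
      (if \<mu> n \<in> S then blk h (\<nu> n) (\<lambda>u. \<Sum>v<2^\<mu> n. K n u v * F (\<mu> n) v) x else 0)" using True by simp
    qed simp
  qed
  then show ?thesis by (simp only: sum.inter_filter[OF finite_atLeastAtMost])
qed

text \<open>Blocks of S that are not \<open>\<mu> n\<close> for some n \<le> M are dropped, which
  does not increase the norm; the kernels act on the remaining ones.\<close>

lemma trunc_blks_norm:
  assumes S: "simple_fun S F"
  shows "nrm (trunc M (blks S F)) \<le> nrm (blks S F)"
proof -
  define A where "A = {n\<in>{1..M}. \<mu> n \<in> S}"
  have inj: "inj_on \<mu> A" "inj_on \<nu> A" using \<mu>(2) \<nu>(2) by (auto simp: A_def intro: inj_on_subset)
  have "nrm (trunc M (blks S F)) = nrm (\<lambda>x. \<Sum>n\<in>A. blk h (\<nu> n) (\<lambda>u. \<Sum>v<2^\<mu> n. K n u v * F (\<mu> n) v) x)"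
    unfolding trunc_blks[OF S, abs_def] A_def ..
  also have "\<dots> \<le> nrm (\<lambda>x. \<Sum>n\<in>A. blk h (\<mu> n) (F (\<mu> n)) x)"
    using inj \<mu>1 \<nu>(1) K0 Krow Kcol by (intro kernel_contraction[OF p1]) (auto simp: A_def)
  also have "(\<lambda>x. \<Sum>n\<in>A. blk h (\<mu> n) (F (\<mu> n)) x) = blks (\<mu> ` A) F"
    by (simp add: blks_def fun_eq_iff sum.reindex[OF inj(1)])
  also have "nrm \<dots> \<le> nrm (blks S F)" by (rule nrm_drop_blocks[OF S]) (auto simp: A_def)
  finally show ?thesis .
qed

text \<open>A bound that grows with M. It provides the continuity by which \<open>trunc_norm\<close>
  extends the contraction from block sums to the whole space.\<close>

lemma trunc_crude:
  assumes f: "f \<in> V"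
  shows "nrm (trunc M f) \<le> (\<Sum>n=1..M. \<Sum>I\<in>nodes n. 1 / node_len I) * nrm f"
proof -
  have inL: "in_Lp p (blk h (\<nu> n) (W n I))" if "n \<in> {1..M}" "I \<in> nodes n" for n I
    using that \<nu>(1) W0 by (intro V_in_Lp blk_in_V) auto
  have tm: "nrm (\<lambda>x. inner_L (blk h (\<mu> n) (U n I)) f / node_len I * blk h (\<nu> n) (W n I) x) \<le> 1 / node_len I * nrm f"
    if n: "n \<in> {1..M}" and I: "I \<in> nodes n" for n I
  proof -
    have "\<bar>inner_L (blk h (\<mu> n) (U n I)) f\<bar> \<le> nrm f" using n I \<mu>1 U1 by (intro inner_L_blk_le f) auto
    moreover have "nrm (blk h (\<nu> n) (W n I)) \<le> 1" using n I \<nu>(1) W1 by (intro nrm_blk_le_1) auto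
    ultimately have "\<bar>inner_L (blk h (\<mu> n) (U n I)) f\<bar> / node_len I * nrm (blk h (\<nu> n) (W n I)) \<le> nrm f / node_len I * 1"
      using node_len_pos[of I] Lp_norm_nonneg by (intro mult_mono divide_right_mono) auto
    then show ?thesis using Lp_norm_scale[OF p1 inL[OF n I], of "inner_L (blk h (\<mu> n) (U n I)) f / node_len I"]
      by (simp add: abs_divide)
  qed
  have "nrm (trunc M f) \<le> (\<Sum>n=1..M. nrm (\<lambda>x. \<Sum>I\<in>nodes n. inner_L (blk h (\<mu> n) (U n I)) f / node_len I * blk h (\<nu> n) (W n I) x))"
    unfolding trunc_def[abs_def] using inL by (intro Lp_norm_sum[OF p1] in_Lp_sum[OF p1] in_Lp_scale[OF p1]) auto
  also have "\<dots> \<le> (\<Sum>n=1..M. \<Sum>I\<in>nodes n. nrm (\<lambda>x. inner_L (blk h (\<mu> n) (U n I)) f / node_len I * blk h (\<nu> n) (W n I) x))"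
    using inL by (intro sum_mono Lp_norm_sum[OF p1] in_Lp_scale[OF p1]) auto
  also have "\<dots> \<le> (\<Sum>n=1..M. \<Sum>I\<in>nodes n. 1 / node_len I * nrm f)"
    using tm by (intro sum_mono) auto
  finally show ?thesis by (simp add: sum_distrib_right)
qed

lemma trunc_norm:
  assumes f: "f \<in> V"
  shows "nrm (trunc M f) \<le> nrm f"
proof (rule field_le_epsilon)
  fix e :: real assume e: "e > 0"
  define D where "D = (\<Sum>n=1..M. \<Sum>I\<in>nodes n. 1 / node_len I)"
  have D: "0 \<le> D" unfolding D_def by (intro sum_nonneg) (auto simp: node_len_def)
  obtain S F where S: "simple_fun S F" "nrm (\<lambda>x. f x - blks S F x) < e / (D + 1)"
    using V_approx[OF f, of "e / (D + 1)"] e D by auto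
  have s: "blks S F \<in> V" using blks_in_V S by blast
  define d where "d = nrm (\<lambda>x. f x - blks S F x)"
  have "nrm (trunc M f) \<le> nrm (\<lambda>x. trunc M f x - trunc M (blks S F) x) + nrm (trunc M (blks S F))"
    by (intro nrm_le_diff trunc_in_V)
  also have "(\<lambda>x. trunc M f x - trunc M (blks S F) x) = trunc M (\<lambda>x. f x - blks S F x)"
    using trunc_lin[OF f s, of M 1 "-1"] by (simp add: fun_eq_iff)
  also have "nrm (trunc M (\<lambda>x. f x - blks S F x)) \<le> D * d"
    using trunc_crude[OF V_diff[OF f s], of M] by (simp add: D_def d_def)
  also have "nrm (trunc M (blks S F)) \<le> nrm (blks S F)" by (rule trunc_blks_norm[OF S(1)])
  also have "nrm (blks S F) \<le> d + nrm f"
    using nrm_le_diff[OF s f] by (simp add: d_def Lp_norm_minus_commute[of p f])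
  finally have "nrm (trunc M f) \<le> nrm f + (D + 1) * d" by (simp add: algebra_simps)
  also have "(D + 1) * d \<le> e" using S(2) D by (simp add: d_def field_simps)
  finally show "nrm (trunc M f) \<le> nrm f + e" by simp
qed

lemma transfer_operator:
  obtains L where "bounded_op_on p V L 1" "\<And>f. f \<in> V \<Longrightarrow> (\<lambda>M. nrm (\<lambda>x. trunc M f x - L f x)) \<longlonglongrightarrow> 0"
proof (rule limit_operator[of trunc])
  fix A F assume A: "simple_fun A F"
  then have "finite A" by (simp add: simple_fun_def)
  then obtain k where k: "\<And>a. a \<in> A \<Longrightarrow> a \<le> k" by (meson finite_nat_set_iff_bounded_le)
  have "trunc M (blks A F) = trunc k (blks A F)" if "M \<ge> k" for M
  proof -
    \<comment> \<open>Since n \<le> \<open>\<mu> n\<close>, only indices n \<le> k can be sent into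
      A.\<close>
    have "{n \<in> {1..M}. \<mu> n \<in> A} = {n \<in> {1..k}. \<mu> n \<in> A}"
      using that k \<mu>(1) by (force intro: order_trans)
    then show ?thesis unfolding trunc_blks[OF A, abs_def] by simp
  qed
  then show "\<exists>K. \<forall>M\<ge>K. trunc M (blks A F) = trunc K (blks A F)" by blast
qed (use trunc_in_V trunc_lin trunc_norm that in auto)

end

section \<open>Interaction of blocks\<close>

text \<open>The image of the Haar function of I under the path kernel, see
  \<open>wave_fun_ker\<close>. Nodes count from 1 and paths from 0, hence the subtraction.\<close>

definition wave_fun :: "(nat \<Rightarrow> nat \<Rightarrow> real) \<Rightarrow> nat \<times> nat \<Rightarrow> nat \<Rightarrow> real" where
  "wave_fun w I y = ker w (fst I) y (snd I - 1) * w (fst I) y"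

lemma abs_wave_fun_le_1:
  assumes "\<And>i. \<bar>w i y\<bar> \<le> 1"
  shows "\<bar>wave_fun w I y\<bar> \<le> 1"
proof -
  have "0 \<le> ker w (fst I) y (snd I - 1) \<and> ker w (fst I) y (snd I - 1) \<le> 1"
    using assms by (intro ker_bounds)
  then show ?thesis unfolding wave_fun_def abs_mult using assms[of "fst I"] by (intro mult_le_one) auto
qed

lemma comb_mean_zero:
  assumes "A \<subseteq> nodes n"
  shows "leaf_avg n (\<lambda>y. \<Sum>J\<in>A. u J * leaf_haar n J y) = 0"
  using assms by (auto simp: leaf_avg_sum leaf_avg_mult leaf_avg_haar_node intro!: sum.neutral)

context haar_copies_Lp
begin

abbreviation hb :: "nat \<Rightarrow> nat \<times> nat \<Rightarrow> real \<Rightarrow> real" where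
  "hb n I \<equiv> blk h n (leaf_haar n I)"

definition haar_matrix :: "((real \<Rightarrow> real) \<Rightarrow> real \<Rightarrow> real) \<Rightarrow> nat \<Rightarrow> nat \<times> nat \<Rightarrow> nat \<times> nat \<Rightarrow> real" where
  "haar_matrix T n J K = inner_L (hb n J) (T (hb n K))"

lemma haar_matrix_bilinear:
  assumes T: "bounded_op_on p V T C" and n: "1 \<le> n" and A: "A \<subseteq> nodes n" and B: "B \<subseteq> nodes n"
  shows "inner_L (blk h n (\<lambda>y. \<Sum>J\<in>A. u J * leaf_haar n J y)) (T (blk h n (\<lambda>y. \<Sum>K\<in>B. v K * leaf_haar n K y)))
    = (\<Sum>J\<in>A. \<Sum>K\<in>B. u J * v K * haar_matrix T n J K)"
proof -
  have fin: "finite A" "finite B" using A B finite_subset[OF _ finite_nodes] by auto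
  have hbV: "hb n K \<in> V" if "K \<in> B" for K using that B blk_haar_in_V[OF n] by blast
  let ?v = "blk h n (\<lambda>y. \<Sum>K\<in>B. v K * leaf_haar n K y)"
  have vV: "?v \<in> V" by (rule blk_in_V[OF n comb_mean_zero[OF B]])
  have v: "?v = (\<lambda>x. \<Sum>K\<in>B. v K * hb n K x)" by (simp add: blk_sum fun_eq_iff)
  have V': "(\<lambda>x. \<Sum>K\<in>B. v K * T (hb n K) x) \<in> V" using fin hbV op_in_V[OF T] by (intro V_sum V_scale) auto
  have "inner_L (blk h n (\<lambda>y. \<Sum>J\<in>A. u J * leaf_haar n J y)) (T ?v) = (\<Sum>J\<in>A. u J * inner_L (hb n J) (T ?v))"
    by (rule inner_L_blk_sum_left[OF n op_in_V[OF T vV]])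
  also have "\<dots> = (\<Sum>J\<in>A. u J * (\<Sum>K\<in>B. v K * haar_matrix T n J K))"
  proof (intro sum.cong refl arg_cong2[where f = "(*)"])
    fix J
    have "inner_L (hb n J) (T ?v) = inner_L (hb n J) (\<lambda>x. \<Sum>K\<in>B. v K * T (hb n K) x)"
      using op_sum[where f = "hb n" and c = v, OF T fin(2) hbV] V_measurable[OF op_in_V[OF T vV]] V_measurable[OF V'] n
      unfolding v by (intro inner_L_AE_cong) auto
    also have "\<dots> = (\<Sum>K\<in>B. v K * haar_matrix T n J K)"
      unfolding haar_matrix_def using hbV op_in_V[OF T] by (intro inner_L_blk_sum_right[OF n fin(2)]) auto
    finally show "inner_L (hb n J) (T ?v) = (\<Sum>K\<in>B. v K * haar_matrix T n J K)" .
  qed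
  finally show ?thesis by (simp add: sum_distrib_left mult.assoc)
qed

text \<open>At each leaf at most one term is nonzero, so the r-th power of the combination is at
  most the indicator of the union of the nodes.\<close>

lemma Lp_norm_disjoint_comb:
  assumes r: "1 \<le> r" and n: "1 \<le> n" and A: "disjoint_nodes n A" and u: "\<And>J. \<bar>u J\<bar> \<le> 1"
  shows "in_Lp r (blk h n (\<lambda>y. \<Sum>J\<in>A. u J * leaf_haar n J y))"
    and "Lp_norm r (blk h n (\<lambda>y. \<Sum>J\<in>A. u J * leaf_haar n J y)) \<le> (\<Sum>J\<in>A. node_len J) powr (1 / r)"
proof -
  define F where "F = (\<lambda>y. \<Sum>J\<in>A. u J * leaf_haar n J y)"
  have F1: "\<bar>F y\<bar> \<le> 1" if "y < 2 ^ n" for y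
    unfolding F_def by (rule sum_leaf_haar_abs_le(1)[OF A that u]) simp
  show "in_Lp r (blk h n (\<lambda>y. \<Sum>J\<in>A. u J * leaf_haar n J y))"
    unfolding F_def[symmetric] using n by (intro in_Lp_bounded[OF r _ AE_blk_abs_le[OF n F1]]) auto
  have "(\<integral>x. \<bar>blk h n F x\<bar> powr r \<partial>LM) = (\<integral>x. blk h n (\<lambda>y. \<bar>F y\<bar> powr r) x \<partial>LM)"
  proof (rule integral_cong_AE)
    show "AE x in LM. \<bar>blk h n F x\<bar> powr r = blk h n (\<lambda>y. \<bar>F y\<bar> powr r) x"
      using AE_leaf_event[OF n] by eventually_elim (auto simp: blk_eq)
    have [measurable]: "blk h n F \<in> borel_measurable LM" using n by simp
    show "(\<lambda>x. \<bar>blk h n F x\<bar> powr r) \<in> borel_measurable LM" by measurable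
  qed (use n in auto)
  also have "\<dots> = leaf_avg n (\<lambda>y. \<bar>F y\<bar> powr r)"
    using integral_prod_blk[of "{n}" "\<lambda>i. i" "\<lambda>_ y. \<bar>F y\<bar> powr r"] n by simp
  also have "\<dots> \<le> leaf_avg n (\<lambda>y. \<Sum>J\<in>A. 1 * \<bar>leaf_haar n J y\<bar>)"
  proof (rule leaf_avg_mono)
    fix y :: nat assume y: "y < 2 ^ n"
    show "\<bar>F y\<bar> powr r \<le> (\<Sum>J\<in>A. 1 * \<bar>leaf_haar n J y\<bar>)"
    proof (cases "\<exists>K\<in>A. leaf_node n (fst K) y = K")
      case True
      then obtain K where K: "K \<in> A" "leaf_node n (fst K) y = K" by blast
      have "(\<Sum>J\<in>A. 1 * \<bar>leaf_haar n J y\<bar>) = 1 * \<bar>leaf_haar n K y\<bar>"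
        by (rule sum_disjoint_nodes[OF A y K]) (simp add: leaf_haar_def)
      also have "\<dots> = 1" using K by (simp add: leaf_haar_def)
      finally show ?thesis using F1[OF y] r by (simp add: powr_le1)
    next
      case False
      then have "F y = 0" by (auto simp: F_def leaf_haar_def intro!: sum.neutral)
      then show ?thesis by (simp add: sum_nonneg)
    qed
  qed
  also have "\<dots> = (\<Sum>J\<in>A. 1 * node_len J)"
    using A by (intro sum_node_len_eq[symmetric]) (simp add: disjoint_nodes_def)
  finally show "Lp_norm r (blk h n (\<lambda>y. \<Sum>J\<in>A. u J * leaf_haar n J y)) \<le> (\<Sum>J\<in>A. node_len J) powr (1 / r)"
    unfolding F_def[symmetric] Lp_norm_def using r by (intro powr_mono2) auto
qed

lemma haar_block_matrix:
  assumes T: "bounded_op_on p V T C" and n: "1 \<le> n" and \<delta>: "0 < \<delta>"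
    and diag: "\<And>J. J \<in> nodes n \<Longrightarrow> \<delta> \<le> \<bar>inner_L (h n J) (T (h n J)) / dy_len J\<bar>"
  shows "haar_block n (haar_matrix T n) C \<delta> p (p / (p - 1))"
proof
  define q where "q = p / (p - 1)"
  show "1 < p" "1 < p / (p - 1)" "1 / p + 1 / (p / (p - 1)) = 1" using p by (auto simp: field_simps)
  show "0 \<le> C" by (rule op_const_nonneg[OF T])
  show "0 < \<delta>" by (rule \<delta>)
  fix J assume J: "J \<in> nodes n"
  note V = h_in_V[OF n J] blk_haar_in_V[OF n J]
  have "inner_L (h n J) (T (h n J)) = haar_matrix T n J J"
    unfolding haar_matrix_def using op_AE_cong[OF T V h_AE_blk[OF n J]] h_AE_blk[OF n J] V_measurable op_in_V[OF T] V
    by (intro inner_L_AE_cong) auto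
  then have "\<delta> \<le> \<bar>haar_matrix T n J J\<bar> / node_len J"
    using diag[OF J] by (simp add: dy_len_eq_node_len abs_divide)
  then show "\<delta> * node_len J \<le> \<bar>haar_matrix T n J J\<bar>"
    using node_len_pos[of J] by (simp add: pos_le_divide_eq)
next
  fix A B and u v :: "nat \<times> nat \<Rightarrow> real"
  assume A: "disjoint_nodes n A" and B: "disjoint_nodes n B" and uv: "\<And>J. \<bar>u J\<bar> \<le> 1" "\<And>J. \<bar>v J\<bar> \<le> 1"
  define q where "q = p / (p - 1)"
  have q: "1 \<le> q" using p by (simp add: q_def field_simps)
  let ?u = "blk h n (\<lambda>y. \<Sum>J\<in>A. u J * leaf_haar n J y)" and ?v = "blk h n (\<lambda>y. \<Sum>K\<in>B. v K * leaf_haar n K y)"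
  have AB: "A \<subseteq> nodes n" "B \<subseteq> nodes n" using A B by (auto simp: disjoint_nodes_def)
  have vV: "?v \<in> V" by (rule blk_in_V[OF n comb_mean_zero[OF AB(2)]])
  have "\<bar>inner_L ?u (T ?v)\<bar> \<le> Lp_norm q ?u * nrm (T ?v)"
    by (rule Holder_inner_L[OF p q_def V_in_Lp[OF op_in_V[OF T vV]] Lp_norm_disjoint_comb(1)[OF q n A uv(1)]])
  also have "\<dots> \<le> (\<Sum>J\<in>A. node_len J) powr (1 / q) * (C * (\<Sum>K\<in>B. node_len K) powr (1 / p))"
  proof (intro mult_mono Lp_norm_disjoint_comb(2)[OF q n A uv(1)] Lp_norm_nonneg)
    have "nrm (T ?v) \<le> C * nrm ?v" by (rule op_norm[OF T vV])
    also have "\<dots> \<le> C * (\<Sum>K\<in>B. node_len K) powr (1 / p)"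
      by (intro mult_left_mono Lp_norm_disjoint_comb(2)[OF p1 n B uv(2)] op_const_nonneg[OF T])
    finally show "nrm (T ?v) \<le> C * (\<Sum>K\<in>B. node_len K) powr (1 / p)" .
  qed simp
  finally show "\<bar>\<Sum>J\<in>A. \<Sum>K\<in>B. u J * v K * haar_matrix T n J K\<bar>
      \<le> C * (\<Sum>J\<in>A. node_len J) powr (1 / (p / (p - 1))) * (\<Sum>K\<in>B. node_len K) powr (1 / p)"
    unfolding haar_matrix_bilinear[OF T n AB] q_def by (simp add: mult_ac)
qed

lemma good_block_facts:
  assumes T: "bounded_op_on p V T C" and N: "1 \<le> N" and g: "good_block n \<eta> c N (haar_matrix T N) w \<beta>"
  shows "I \<in> nodes n \<Longrightarrow> leaf_avg N (wave_fun w I) = 0"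
    and "y < 2 ^ N \<Longrightarrow> \<bar>wave_fun w I y\<bar> \<le> 1"
    and "y < 2 ^ N \<Longrightarrow> \<bar>w i y\<bar> \<le> 1"
    and "I \<in> nodes n \<Longrightarrow> I' \<in> nodes n \<Longrightarrow>
      \<bar>inner_L (blk h N (wave_fun w I)) (T (blk h N (wave_fun w I'))) - (if I = I' then c * node_len I else 0)\<bar> \<le> \<eta>"
proof -
  have w: "\<bar>w i y\<bar> \<le> 1" if "y < 2 ^ N" for i y using g that by (auto simp: good_block_def)
  then show "y < 2 ^ N \<Longrightarrow> \<bar>w i y\<bar> \<le> 1" .
  have \<beta>: "wave_fun w I y = (\<Sum>J\<in>nodes N. \<beta> I J * leaf_haar N J y)" if "I \<in> nodes n" "y < 2 ^ N" for I y
    using g that by (auto simp: good_block_def wave_fun_def)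
  show "leaf_avg N (wave_fun w I) = 0" if "I \<in> nodes n" for I
    using leaf_avg_cong[of N "wave_fun w I", OF \<beta>[OF that]] comb_mean_zero[of "nodes N" N "\<beta> I"] by simp
  show "\<bar>wave_fun w I y\<bar> \<le> 1" if "y < 2 ^ N" for y
    using w[OF that] by (rule abs_wave_fun_le_1)
  assume I: "I \<in> nodes n" "I' \<in> nodes n"
  have "blk h N (wave_fun w I) = blk h N (\<lambda>y. \<Sum>J\<in>nodes N. \<beta> I J * leaf_haar N J y)" if "I \<in> nodes n" for I
    using blk_cong[of N "wave_fun w I", OF \<beta>[OF that]] by (simp add: fun_eq_iff)
  then have "inner_L (blk h N (wave_fun w I)) (T (blk h N (wave_fun w I'))) = (\<Sum>J\<in>nodes N. \<Sum>K\<in>nodes N. \<beta> I J * \<beta> I' K * haar_matrix T N J K)"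
    using haar_matrix_bilinear[OF T N order_refl order_refl, of "\<beta> I" "\<beta> I'"] I by simp
  then show "\<bar>inner_L (blk h N (wave_fun w I)) (T (blk h N (wave_fun w I'))) - (if I = I' then c * node_len I else 0)\<bar> \<le> \<eta>"
    using g I unfolding good_block_def by simp
qed

text \<open>Decay along rows: g is within e of a sum over finitely many blocks, and every later
  block is orthogonal to that sum.\<close>

lemma inner_L_blk_vanish:
  assumes g: "g \<in> V" and e: "e > 0"
  shows "\<exists>M. \<forall>N\<ge>M. \<forall>G. 1 \<le> N \<longrightarrow> (\<forall>y<2^N. \<bar>G y\<bar> \<le> 1) \<longrightarrow> \<bar>inner_L (blk h N G) g\<bar> < e"
proof -
  obtain S F where S: "simple_fun S F" "nrm (\<lambda>x. g x - blks S F x) < e" using V_approx[OF g e] .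
  then have "finite S" by (simp add: simple_fun_def)
  then obtain k where k: "\<And>a. a \<in> S \<Longrightarrow> a \<le> k" by (meson finite_nat_set_iff_bounded_le)
  have s: "blks S F \<in> V" using blks_in_V S by blast
  have "\<bar>inner_L (blk h N G) g\<bar> < e" if N: "N \<ge> Suc k" and G: "\<And>y. y < 2 ^ N \<Longrightarrow> \<bar>G y\<bar> \<le> 1" for N G
  proof -
    have N1: "1 \<le> N" using N by simp
    have "inner_L (blk h N G) (blks S F) = 0" using inner_L_blk_blks[OF N1 S(1)] k N by fastforce
    then have "inner_L (blk h N G) g = inner_L (blk h N G) (\<lambda>x. g x - blks S F x)"
      using inner_L_blk_lin[OF N1 g s, of G 1 "-1"] by simp
    then show ?thesis using inner_L_blk_le[of N G, OF N1 G V_diff[OF g s]] S(2) by simp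
  qed
  then show ?thesis by (intro exI[of _ "Suc k"]) blast
qed

text \<open>Independent mean zero summands bounded by 1 have a sum of \<open>L\<^sub>1\<close>-norm at most \<open>sqrt k\<close>, and the
  sum is bounded by \<open>k\<close>; interpolating gives an \<open>L\<^sub>p\<close>-norm of smaller order than \<open>k\<close>.\<close>
lemma nrm_sum_blocks_le:
  assumes \<iota>: "inj_on \<iota> {..<k}" "\<And>i. i < k \<Longrightarrow> 1 \<le> \<iota> i" and k: "0 < k"
    and F1: "\<And>i y. i < k \<Longrightarrow> y < 2 ^ \<iota> i \<Longrightarrow> \<bar>F i y\<bar> \<le> 1" and F0: "\<And>i. i < k \<Longrightarrow> leaf_avg (\<iota> i) (F i) = 0"
  shows "nrm (\<lambda>x. \<Sum>i<k. blk h (\<iota> i) (F i) x) \<le> real k * real k powr (- 1 / (2 * p))"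
proof -
  define S where "S x = (\<Sum>i<k. blk h (\<iota> i) (F i) x)" for x
  have meas [measurable]: "blk h (\<iota> i) (F i) \<in> borel_measurable LM" if "i < k" for i using \<iota>(2)[OF that] by simp
  have Sm [measurable]: "S \<in> borel_measurable LM" unfolding S_def by measurable
  have ae: "AE x in LM. \<forall>i\<in>{..<k}. \<bar>blk h (\<iota> i) (F i) x\<bar> \<le> 1"
    using \<iota>(2) F1 by (intro AE_finite_allI AE_blk_abs_le) auto
  then have Sk: "AE x in LM. \<bar>S x\<bar> \<le> real k"
  proof eventually_elim
    case (elim x)
    have "\<bar>S x\<bar> \<le> (\<Sum>i<k. \<bar>blk h (\<iota> i) (F i) x\<bar>)" unfolding S_def by (rule sum_abs)
    also have "\<dots> \<le> (\<Sum>i<k. 1)" using elim by (intro sum_mono) auto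
    finally show ?case by simp
  qed
  have int2: "integrable LM (\<lambda>x. blk h (\<iota> i) (F i) x * blk h (\<iota> j) (F j) x)" if "i < k" "j < k" for i j
  proof (rule LM.integrable_const_bound[where B = 1])
    show "AE x in LM. norm (blk h (\<iota> i) (F i) x * blk h (\<iota> j) (F j) x) \<le> 1"
      using ae by eventually_elim (use that in \<open>auto simp: abs_mult intro!: mult_le_one\<close>)
  qed (use that meas in auto)
  have S2: "(S x)\<^sup>2 = (\<Sum>i<k. \<Sum>j<k. blk h (\<iota> i) (F i) x * blk h (\<iota> j) (F j) x)" for x
    by (simp add: S_def power2_eq_square sum_product)
  have intS2: "integrable LM (\<lambda>x. (S x)\<^sup>2)" unfolding S2 using int2 by (intro Bochner_Integration.integrable_sum) auto
  have intS: "integrable LM (\<lambda>x. \<bar>S x\<bar>)"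
    using Sk by (intro LM.integrable_const_bound[where B = "real k"]) auto
  have "(\<integral>x. (S x)\<^sup>2 \<partial>LM) = (\<Sum>i<k. \<Sum>j<k. inner_L (blk h (\<iota> i) (F i)) (blk h (\<iota> j) (F j)))"
    unfolding S2 inner_L_def using int2 by (subst Bochner_Integration.integral_sum; (intro Bochner_Integration.integrable_sum)?) (auto intro!: sum.cong)
  also have "\<dots> = (\<Sum>i<k. \<Sum>j<k. if j = i then leaf_avg (\<iota> i) (\<lambda>y. F i y * F i y) else 0)"
  proof (intro sum.cong refl)
    fix i j assume ij: "i \<in> {..<k}" "j \<in> {..<k}"
    show "inner_L (blk h (\<iota> i) (F i)) (blk h (\<iota> j) (F j)) = (if j = i then leaf_avg (\<iota> i) (\<lambda>y. F i y * F i y) else 0)"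
    proof (cases "j = i")
      case False
      then have "\<iota> i \<noteq> \<iota> j" using \<iota>(1) ij by (auto dest: inj_onD)
      then show ?thesis using False ij \<iota>(2) F0 inner_L_blk_diff[of "\<iota> i" "\<iota> j" "F i" "F j"] by simp
    qed (use inner_L_blk_same \<iota>(2) ij in simp)
  qed
  also have "\<dots> = (\<Sum>i<k. leaf_avg (\<iota> i) (\<lambda>y. F i y * F i y))" by simp
  also have "\<dots> \<le> (\<Sum>i<k. 1)"
  proof (intro sum_mono)
    fix i assume i: "i \<in> {..<k}"
    have "leaf_avg (\<iota> i) (\<lambda>y. F i y * F i y) \<le> leaf_avg (\<iota> i) (\<lambda>y. 1)"
    proof (rule leaf_avg_mono)
      fix y :: nat assume "y < 2 ^ \<iota> i"
      then have "\<bar>F i y\<bar> * \<bar>F i y\<bar> \<le> 1" using F1 i by (intro mult_le_one) auto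
      then show "F i y * F i y \<le> 1" by (simp flip: abs_mult)
    qed
    then show "leaf_avg (\<iota> i) (\<lambda>y. F i y * F i y) \<le> 1" by simp
  qed
  finally have ES2: "(\<integral>x. (S x)\<^sup>2 \<partial>LM) \<le> real k" by simp
  \<comment> \<open>With r the square root of k, the inequality 2 |S| r \<le> r^2 + S^2 does the
    work of Cauchy-Schwarz.\<close>
  define r where "r = sqrt (real k)"
  have r: "r > 0" "r * r = real k" using k by (auto simp: r_def)
  have "(\<integral>x. \<bar>S x\<bar> \<partial>LM) \<le> (\<integral>x. (r + (S x)\<^sup>2 / r) / 2 \<partial>LM)"
  proof (rule integral_mono[OF intS])
    fix x
    have "0 \<le> (r - \<bar>S x\<bar>)\<^sup>2" by simp
    then have "2 * \<bar>S x\<bar> * r \<le> r * r + (S x)\<^sup>2" unfolding power2_eq_square by (simp add: algebra_simps)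
    then show "\<bar>S x\<bar> \<le> (r + (S x)\<^sup>2 / r) / 2" using r(1) by (simp add: field_simps)
  qed (use intS2 in auto)
  also have "\<dots> = (r + (\<integral>x. (S x)\<^sup>2 \<partial>LM) / r) / 2" using intS2 LM.prob_space by simp
  also have "\<dots> \<le> (r + real k / r) / 2" using ES2 r by (intro divide_right_mono add_left_mono) auto
  also have "\<dots> = r" using r by (simp add: field_simps)
  finally have ES: "(\<integral>x. \<bar>S x\<bar> \<partial>LM) \<le> r" .
  have pt: "AE x in LM. \<bar>S x\<bar> powr p \<le> real k powr (p - 1) * \<bar>S x\<bar>"
    using Sk
  proof eventually_elim
    case (elim x)
    show ?case
    proof (cases "S x = 0")
      case False
      have "\<bar>S x\<bar> powr p = \<bar>S x\<bar> powr (p - 1) * \<bar>S x\<bar>" using False by (simp add: powr_diff)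
      also have "\<dots> \<le> real k powr (p - 1) * \<bar>S x\<bar>" using elim p by (intro mult_right_mono powr_mono2) auto
      finally show ?thesis .
    qed simp
  qed
  have "(\<integral>x. \<bar>S x\<bar> powr p \<partial>LM) \<le> (\<integral>x. real k powr (p - 1) * \<bar>S x\<bar> \<partial>LM)"
    using intS pt by (intro integral_mono_AE' integrable_mult_right) auto
  also have "\<dots> = real k powr (p - 1) * (\<integral>x. \<bar>S x\<bar> \<partial>LM)" by simp
  also have "\<dots> \<le> real k powr (p - 1) * real k powr (1/2)"
    using ES k by (intro mult_left_mono) (auto simp: r_def powr_half_sqrt)
  also have "\<dots> = (real k * real k powr (- 1 / (2 * p))) powr p"
  proof -
    have "(real k * real k powr (- 1 / (2 * p))) powr p = real k powr p * real k powr (- 1 / 2)"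
      using k p by (simp add: powr_mult powr_powr)
    also have "\<dots> = real k powr (p - 1) * real k powr (1/2)" using k by (simp flip: powr_add)
    finally show ?thesis by simp
  qed
  finally show ?thesis unfolding S_def[symmetric] by (intro Lp_norm_leI[OF p1]) auto
qed

text \<open>Decay along columns. Otherwise infinitely many blocks would pair to at least e, and the
  sum of k of them with suitable signs to at least k e. But by \<open>nrm_sum_blocks_le\<close> the
  norm of that sum is of smaller order than k. The argument avoids the adjoint of T.\<close>

lemma inner_L_op_blk_vanish:
  assumes T: "bounded_op_on p V T C" and n: "1 \<le> n" and u: "\<And>y. y < 2 ^ n \<Longrightarrow> \<bar>u y\<bar> \<le> 1" and e: "e > 0"
  shows "\<exists>M. \<forall>N\<ge>M. \<forall>G. 1 \<le> N \<longrightarrow> (\<forall>y<2^N. \<bar>G y\<bar> \<le> 1) \<longrightarrow> leaf_avg N G = 0 \<longrightarrow> \<bar>inner_L (blk h n u) (T (blk h N G))\<bar> < e"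
proof (rule ccontr)
  assume "\<not> ?thesis"
  then have "\<forall>M. \<exists>N G. N \<ge> M \<and> 1 \<le> N \<and> (\<forall>y<2^N. \<bar>G y\<bar> \<le> 1) \<and> leaf_avg N G = 0 \<and> e \<le> \<bar>inner_L (blk h n u) (T (blk h N G))\<bar>"
    by (simp add: not_less)
  then obtain N0 G0 where NG: "\<And>M. N0 M \<ge> M" "\<And>M. 1 \<le> N0 M" "\<And>M y. y < 2 ^ N0 M \<Longrightarrow> \<bar>G0 M y\<bar> \<le> 1"
    "\<And>M. leaf_avg (N0 M) (G0 M) = 0" "\<And>M. e \<le> \<bar>inner_L (blk h n u) (T (blk h (N0 M) (G0 M)))\<bar>"
    by metis
  \<comment> \<open>Each search starts beyond the block found before, so that the block numbers
    increase strictly.\<close>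
  define m where "m = rec_nat 0 (\<lambda>_ k. Suc (N0 k))"
  have m: "m (Suc i) = Suc (N0 (m i))" for i by (simp add: m_def)
  define \<iota> where "\<iota> i = N0 (m i)" for i
  have \<iota>S: "\<iota> i < \<iota> (Suc i)" for i unfolding \<iota>_def m using NG(1)[of "Suc (N0 (m i))"] by simp
  then have "strict_mono \<iota>" by (simp add: strict_mono_Suc_iff)
  then have inj: "inj_on \<iota> A" for A by (rule strict_mono_imp_inj_on)
  define s where "s i = sgn (inner_L (blk h n u) (T (blk h (\<iota> i) (G0 (m i)))))" for i
  define F where "F i y = s i * G0 (m i) y" for i y
  have \<iota>1: "1 \<le> \<iota> i" for i using NG(2) by (simp add: \<iota>_def)
  have F1: "\<bar>F i y\<bar> \<le> 1" if "y < 2 ^ \<iota> i" for i y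
    unfolding F_def abs_mult using NG(3)[of y "m i"] that by (intro mult_le_one) (auto simp: s_def \<iota>_def sgn_if)
  have F0: "leaf_avg (\<iota> i) (F i) = 0" for i
    unfolding F_def[abs_def] using NG(4) by (simp add: leaf_avg_mult \<iota>_def)
  have bV: "blk h (\<iota> i) (G0 (m i)) \<in> V" for i using \<iota>1 NG(4) by (intro blk_in_V) (auto simp: \<iota>_def)
  have ge: "e \<le> C * real k powr (- 1 / (2 * p))" if k: "0 < k" for k
  proof -
    let ?S = "\<lambda>x. \<Sum>i<k. s i * blk h (\<iota> i) (G0 (m i)) x"
    have SV: "?S \<in> V" using bV by (intro V_sum V_scale) auto
    have S'V: "(\<lambda>x. \<Sum>i<k. s i * T (blk h (\<iota> i) (G0 (m i))) x) \<in> V" using bV op_in_V[OF T] by (intro V_sum V_scale) auto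
    have "real k * e = (\<Sum>i<k. e)" by simp
    also have "\<dots> \<le> (\<Sum>i<k. s i * inner_L (blk h n u) (T (blk h (\<iota> i) (G0 (m i)))))"
      using NG(5) by (intro sum_mono) (simp add: s_def \<iota>_def abs_sgn[symmetric] mult.commute)
    also have "\<dots> = inner_L (blk h n u) (\<lambda>x. \<Sum>i<k. s i * T (blk h (\<iota> i) (G0 (m i))) x)"
      using bV op_in_V[OF T] by (intro inner_L_blk_sum_right[OF n, symmetric]) auto
    also have "\<dots> = inner_L (blk h n u) (T ?S)"
      using op_sum[where f = "\<lambda>i. blk h (\<iota> i) (G0 (m i))" and c = s and S = "{..<k}", OF T _ bV] V_measurable[OF op_in_V[OF T SV]] V_measurable[OF S'V] n
      by (intro inner_L_AE_cong) auto
    also have "\<dots> \<le> nrm (T ?S)"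
      using inner_L_blk_le[of n u, OF n u op_in_V[OF T SV]] by linarith
    also have "\<dots> \<le> C * nrm ?S" by (rule op_norm[OF T SV])
    also have "?S = (\<lambda>x. \<Sum>i<k. blk h (\<iota> i) (F i) x)" by (simp add: F_def[abs_def] blk_scale)
    also have "C * nrm \<dots> \<le> C * (real k * real k powr (- 1 / (2 * p)))"
      using k \<iota>1 F1 F0 by (intro mult_left_mono nrm_sum_blocks_le inj op_const_nonneg[OF T]) auto
    finally have "real k * e \<le> real k * (C * real k powr (- 1 / (2 * p)))" by (simp add: mult_ac)
    then show ?thesis using k by simp
  qed
  have "(\<lambda>k. C * real k powr (- 1 / (2 * p))) \<longlonglongrightarrow> C * 0"
    using p by (intro tendsto_intros tendsto_neg_powr filterlim_real_sequentially) (auto simp: divide_neg_pos)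
  then have "eventually (\<lambda>k. C * real k powr (- 1 / (2 * p)) < e) sequentially"
    using e by (intro order_tendstoD(2)[of _ "C * 0"]) auto
  then obtain K where "\<And>k. k \<ge> K \<Longrightarrow> C * real k powr (- 1 / (2 * p)) < e" by (auto simp: eventually_sequentially)
  then have "C * real (Suc K) powr (- 1 / (2 * p)) < e" by (meson le_SucI order_refl)
  then show False using ge[of "Suc K"] by simp
qed

text \<open>One scalar has to serve all blocks, since A T B must be close to a multiple of the
  identity. The scalars found for growing depth and accuracy stay in a compact set; along a
  convergent subsequence they may be replaced by the limit.\<close>

lemma exists_limit_scalar:
  assumes T: "bounded_op_on p V T C" and \<delta>: "0 < \<delta>"
    and diag: "\<And>n J. 1 \<le> n \<Longrightarrow> J \<in> nodes n \<Longrightarrow> \<delta> \<le> \<bar>inner_L (h n J) (T (h n J)) / dy_len J\<bar>"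
  obtains c where "\<delta> / 2 \<le> \<bar>c\<bar>" "\<And>n \<eta> M. 0 < \<eta> \<Longrightarrow> \<exists>N\<ge>M. \<exists>w \<beta>. good_block n \<eta> c N (haar_matrix T N) w \<beta>"
proof -
  define q where "q = p / (p - 1)"
  have q: "1 < q" using p by (simp add: q_def field_simps)
  have "\<exists>N c w \<beta>. N \<ge> m \<and> \<delta> / 2 \<le> \<bar>c\<bar> \<and> \<bar>c\<bar> \<le> C \<and> good_block (Suc m) (1 / real (Suc m)) c N (haar_matrix T N) w \<beta>" for m
  proof -
    have "0 < Suc m" "0 < 1 / real (Suc m)" by simp_all
    from haar_block_good[OF p q this, of C \<delta>]
    obtain N0 where N0: "\<And>N t. N \<ge> N0 \<Longrightarrow> haar_block N t C \<delta> p q \<Longrightarrow> \<exists>c w \<beta>. \<delta> / 2 \<le> \<bar>c\<bar> \<and> \<bar>c\<bar> \<le> C \<and> good_block (Suc m) (1 / real (Suc m)) c N t w \<beta>"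
      by blast
    define N where "N = N0 + m + 1"
    have "haar_block N (haar_matrix T N) C \<delta> p q"
      unfolding q_def using diag by (intro haar_block_matrix[OF T _ \<delta>]) (auto simp: N_def)
    from N0[OF _ this] show ?thesis by (intro exI[of _ N]) (auto simp: N_def)
  qed
  then obtain N c w \<beta> where *: "\<And>m. N m \<ge> m" "\<And>m. \<delta> / 2 \<le> \<bar>c m\<bar>" "\<And>m. \<bar>c m\<bar> \<le> C"
    "\<And>m. good_block (Suc m) (1 / real (Suc m)) (c m) (N m) (haar_matrix T (N m)) (w m) (\<beta> m)"
    by metis
  have "bounded (range c)" using *(3) by (auto simp: bounded_iff)
  then obtain l r where r: "strict_mono r" and lim: "(c \<circ> r) \<longlonglongrightarrow> l"
    using bounded_imp_convergent_subsequence by blast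
  have "(\<lambda>i. \<bar>(c \<circ> r) i\<bar>) \<longlonglongrightarrow> \<bar>l\<bar>" by (rule tendsto_rabs[OF lim])
  then have "\<delta> / 2 \<le> \<bar>l\<bar>" using *(2) by (intro LIMSEQ_le_const) auto
  moreover have "\<exists>K\<ge>M. \<exists>w \<beta>. good_block n \<eta> l K (haar_matrix T K) w \<beta>" if \<eta>: "0 < \<eta>" for n \<eta> M
  proof -
    have "eventually (\<lambda>i. \<bar>(c \<circ> r) i - l\<bar> < \<eta> / 2) sequentially"
      using tendstoD[OF lim, of "\<eta> / 2"] \<eta> by (simp add: dist_real_def)
    moreover have "eventually (\<lambda>i. 1 / real (Suc i) < \<eta> / 2) sequentially"
      using order_tendstoD(2)[OF LIMSEQ_inverse_real_of_nat, of "\<eta>/2"] \<eta> by (simp add: inverse_eq_divide)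
    ultimately have "eventually (\<lambda>i. \<bar>(c \<circ> r) i - l\<bar> < \<eta> / 2 \<and> 1 / real (Suc i) < \<eta> / 2 \<and> i \<ge> max n M) sequentially"
      using eventually_ge_at_top[of "max n M"] by eventually_elim auto
    then obtain i where i: "\<bar>c (r i) - l\<bar> < \<eta> / 2" "1 / real (Suc i) < \<eta> / 2" "i \<ge> n" "i \<ge> M"
      by (auto simp: eventually_sequentially)
    have ri: "i \<le> r i" using r by (simp add: seq_suble)
    then have "1 / real (Suc (r i)) \<le> 1 / real (Suc i)" by (intro divide_left_mono) auto
    then have "1 / real (Suc (r i)) + \<bar>l - c (r i)\<bar> \<le> \<eta>" using i by (simp add: abs_minus_commute)
    moreover have "n \<le> Suc (r i)" using i ri by simp
    ultimately have "good_block n \<eta> l (N (r i)) (haar_matrix T (N (r i))) (w (r i)) (\<beta> (r i))"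
      using good_block_weaken[OF *(4)] by blast
    moreover have "N (r i) \<ge> M" using *(1)[of "r i"] ri i by simp
    ultimately show ?thesis by blast
  qed
  ultimately show thesis using that by blast
qed

end

section \<open>The factorisation\<close>

lemma wave_fun_ker:
  assumes "I \<in> nodes n"
  shows "wave_fun w I u = (\<Sum>v<2^n. ker w n u v * leaf_haar n I v)"
proof -
  obtain k a where I: "I = (k, Suc a)" "k < n" "a < 2 ^ k"
    using assms unfolding nodes_def by (auto simp: Suc_le_eq) (metis Suc_pred Suc_le_lessD)
  then show ?thesis using ker_haar[of k n a w u] by (simp add: wave_fun_def)
qed

lemma card_nodes_le: "card (nodes n) \<le> 2 ^ n"
proof -
  have "card (nodes n) = (\<Sum>k<n. 2 ^ k)" by (simp add: nodes_def)
  also have "\<dots> \<le> 2 ^ n" by (induction n) auto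
  finally show ?thesis .
qed

text \<open>The factor 4 ^ n is the number of nodes, at most 2 ^ n, times the largest inverse
  length, at most 2 ^ n.\<close>

lemma sum_inverse_len_le:
  assumes "\<And>I. I \<in> nodes n \<Longrightarrow> x I \<le> e" "0 \<le> e"
  shows "(\<Sum>I\<in>nodes n. x I / node_len I) \<le> 4 ^ n * (e::real)"
proof -
  have "(\<Sum>I\<in>nodes n. x I / node_len I) \<le> (\<Sum>I\<in>nodes n. 2 ^ n * e)"
  proof (intro sum_mono)
    fix I assume I: "I \<in> nodes n"
    have "x I / node_len I = x I * 2 ^ fst I" by (simp add: node_len_def)
    also have "\<dots> \<le> e * 2 ^ fst I" using assms(1)[OF I] by (intro mult_right_mono) auto
    also have "\<dots> \<le> e * 2 ^ n" using nodes_level[OF I] assms(2) by (intro mult_left_mono power_increasing) auto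
    finally show "x I / node_len I \<le> 2 ^ n * e" by (simp add: mult.commute)
  qed
  also have "\<dots> = real (card (nodes n)) * (2 ^ n * e)" by simp
  also have "\<dots> \<le> 2 ^ n * (2 ^ n * e)"
  proof (intro mult_right_mono)
    have "real (card (nodes n)) \<le> real (2 ^ n)" using card_nodes_le by (simp only: of_nat_le_iff)
    then show "real (card (nodes n)) \<le> 2 ^ n" by simp
  qed (use assms(2) in auto)
  also have "\<dots> = 4 ^ n * e" by (simp add: power_mult_distrib[symmetric] mult.assoc[symmetric])
  finally show ?thesis .
qed

text \<open>The origin of the number 64: summation over the nodes of both blocks costs 4 ^ n * 4 ^
  m, a further 2 ^ n * 2 ^ m is spent on summability over the blocks, and 8 ^ (n + m) \<le> 64 ^ max
  n m.\<close>

lemma four_power_decay: "(4::real) ^ n * (4 ^ m * (\<eta> / 64 ^ max n m)) \<le> \<eta> * ((1/2) ^ n * (1/2) ^ m)" if "0 \<le> \<eta>"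
proof -
  have "(4::real) ^ n * 4 ^ m * (2 ^ n * 2 ^ m) = (4 * 2) ^ (n + m)" by (simp only: power_add power_mult_distrib mult_ac)
  also have "\<dots> \<le> (4 * 2) ^ (2 * max n m)" by (intro power_increasing) auto
  also have "\<dots> = 64 ^ max n m" by (simp add: power_mult)
  finally have "(4::real) ^ n * 4 ^ m * (2 ^ n * 2 ^ m) \<le> 64 ^ max n m" .
  then have "\<eta> * ((4::real) ^ n * 4 ^ m * (2 ^ n * 2 ^ m)) \<le> \<eta> * 64 ^ max n m" using that by (rule mult_left_mono)
  then show ?thesis by (simp add: field_simps power_one_over)
qed

lemma sum_half_powers_le: "finite S \<Longrightarrow> (\<And>n. n \<in> S \<Longrightarrow> 1 \<le> n) \<Longrightarrow> (\<Sum>n\<in>S. (1/2::real) ^ n) \<le> 1"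
proof -
  assume S: "finite S" "\<And>n. n \<in> S \<Longrightarrow> 1 \<le> n"
  have *: "(\<Sum>n=1..k. (1/2::real) ^ n) = 1 - (1/2) ^ k" for k by (induction k) auto
  obtain k where "\<And>n. n \<in> S \<Longrightarrow> n \<le> k" using S(1) by (meson finite_nat_set_iff_bounded_le)
  then have "(\<Sum>n\<in>S. (1/2::real) ^ n) \<le> (\<Sum>n=1..k. (1/2) ^ n)" using S(2) by (intro sum_mono2) auto
  then show ?thesis unfolding * by (rule order_trans) simp
qed

lemma leaf_haar_le_1: "\<bar>leaf_haar n I y\<bar> \<le> 1"
  by (simp add: leaf_haar_def)

text \<open>The assumption \<open>mean\<close> is the martingale property needed in
  \<open>ker_column_avg\<close> for the kernels to be doubly stochastic.\<close>

locale wave_blocks = haar_copies_Lp +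
  fixes N :: "nat \<Rightarrow> nat" and w :: "nat \<Rightarrow> nat \<Rightarrow> nat \<Rightarrow> real"
  assumes N: "\<And>n. 1 \<le> n \<Longrightarrow> n \<le> N n" "inj_on N {1..}"
    and w1: "\<And>n i y. 1 \<le> n \<Longrightarrow> y < 2 ^ N n \<Longrightarrow> \<bar>w n i y\<bar> \<le> 1"
    and mean: "\<And>n I. 1 \<le> n \<Longrightarrow> I \<in> nodes n \<Longrightarrow> leaf_avg (N n) (wave_fun (w n) I) = 0"
begin

abbreviation b :: "nat \<Rightarrow> nat \<times> nat \<Rightarrow> real \<Rightarrow> real" where
  "b n I \<equiv> blk h (N n) (wave_fun (w n) I)"

lemma N1: "1 \<le> n \<Longrightarrow> 1 \<le> N n"
  using N(1) order_trans by blast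

lemma ker_col:
  assumes n: "1 \<le> n" and v: "v < 2 ^ n"
  shows "leaf_avg (N n) (\<lambda>u. ker (w n) n u v) = 1 / 2 ^ n"
proof (rule ker_column_avg[OF _ v])
  fix k a :: nat assume "k < n" "a < 2 ^ k"
  then show "leaf_avg (N n) (\<lambda>y. ker (w n) k y a * w n k y) = 0"
    using mean[OF n, of "(k, Suc a)"] by (simp add: wave_fun_def[abs_def] nodes_def)
qed

lemma ker_nonneg: "1 \<le> n \<Longrightarrow> u < 2 ^ N n \<Longrightarrow> 0 \<le> ker (w n) n u v"
  using ker_bounds[of n "w n" u v] w1 by auto

text \<open>The waves are the kernel applied to Haar functions, so expanding F in Haar functions and
  replacing these by waves is the same as applying the kernel to F.\<close>

lemma forward_transfer: "block_transfer h p (\<lambda>n. n) N leaf_haar (\<lambda>n. wave_fun (w n)) (\<lambda>n. ker (w n) n)"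
proof
  fix n u :: nat and F assume n: "1 \<le> n" and F: "leaf_avg n F = 0" and u: "u < 2 ^ N n"
  let ?c = "\<lambda>I. leaf_avg n (\<lambda>y. leaf_haar n I y * F y) / node_len I"
  have "(\<Sum>I\<in>nodes n. ?c I * wave_fun (w n) I u) = (\<Sum>I\<in>nodes n. \<Sum>v<2^n. ker (w n) n u v * (?c I * leaf_haar n I v))"
    by (intro sum.cong refl) (simp add: wave_fun_ker sum_distrib_left mult_ac)
  also have "\<dots> = (\<Sum>v<2^n. ker (w n) n u v * (\<Sum>I\<in>nodes n. ?c I * leaf_haar n I v))"
    by (subst sum.swap) (simp add: sum_distrib_left)
  also have "\<dots> = (\<Sum>v<2^n. ker (w n) n u v * F v)"
    using leaf_haar_expansion[OF _ F] by (intro sum.cong refl) simp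
  finally show "(\<Sum>I\<in>nodes n. ?c I * wave_fun (w n) I u) = (\<Sum>v<2^n. ker (w n) n u v * F v)" .
next
  fix n v assume n: "1 \<le> n" and v: "v < (2::nat) ^ n"
  show "(\<Sum>u<2 ^ N n. ker (w n) n u v) / 2 ^ N n = 1 / 2 ^ n"
    using ker_col[OF n v] by (simp add: leaf_avg_def)
qed (use N N1 mean abs_wave_fun_le_1 w1 leaf_haar_le_1 ker_nonneg ker_row_sum in auto)

text \<open>The kernel is transposed and rescaled by the ratio of the numbers of leaves, so that its
  rows sum to 1 again; the former row sums give the column condition.\<close>

lemma backward_transfer: "block_transfer h p N (\<lambda>n. n) (\<lambda>n. wave_fun (w n)) leaf_haar (\<lambda>n v u. ker (w n) n u v * 2 ^ n / 2 ^ N n)"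
proof
  fix n F v assume n: "1 \<le> n" and F: "leaf_avg (N n) F = 0" and v: "v < (2::nat) ^ n"
  \<comment> \<open>The adjoint of the kernel applied to F. Its Haar coefficients are the wave
    coefficients of F, so the Haar expansion of G is the required sum.\<close>
  define G where "G z = 2 ^ n * leaf_avg (N n) (\<lambda>u. ker (w n) n u z * F u)" for z
  have avg: "leaf_avg n (\<lambda>z. a z * G z) = leaf_avg (N n) (\<lambda>u. (\<Sum>z<2^n. ker (w n) n u z * a z) * F u)" for a
  proof -
    have "leaf_avg n (\<lambda>z. a z * G z) = (\<Sum>z<2^n. leaf_avg (N n) (\<lambda>u. a z * (ker (w n) n u z * F u)))"
      by (simp add: leaf_avg_def[of n] G_def leaf_avg_mult sum_divide_distrib)
    also have "\<dots> = leaf_avg (N n) (\<lambda>u. \<Sum>z<2^n. a z * (ker (w n) n u z * F u))" by (simp add: leaf_avg_sum)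
    also have "\<dots> = leaf_avg (N n) (\<lambda>u. (\<Sum>z<2^n. ker (w n) n u z * a z) * F u)"
      unfolding sum_distrib_right by (simp only: mult_ac)
    finally show ?thesis .
  qed
  have G0: "leaf_avg n G = 0" using avg[of "\<lambda>_. 1"] F by (simp add: ker_row_sum)
  have coef: "leaf_avg (N n) (\<lambda>u. wave_fun (w n) I u * F u) = leaf_avg n (\<lambda>z. leaf_haar n I z * G z)" if "I \<in> nodes n" for I
    using avg[of "leaf_haar n I"] by (simp add: wave_fun_ker[OF that])
  have "(\<Sum>I\<in>nodes n. leaf_avg (N n) (\<lambda>y. wave_fun (w n) I y * F y) / node_len I * leaf_haar n I v) = G v"
    using leaf_haar_expansion[OF v G0] coef by (simp cong: sum.cong)
  also have "G v = (\<Sum>u<2^N n. ker (w n) n u v * 2 ^ n / 2 ^ N n * F u)"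
    by (simp add: G_def leaf_avg_def sum_distrib_left sum_divide_distrib mult_ac)
  finally show "(\<Sum>I\<in>nodes n. leaf_avg (N n) (\<lambda>y. wave_fun (w n) I y * F y) / node_len I * leaf_haar n I v) =
    (\<Sum>u<2^N n. ker (w n) n u v * 2 ^ n / 2 ^ N n * F u)" .
next
  fix n v assume n: "1 \<le> n" and v: "v < (2::nat) ^ n"
  have "(\<Sum>u<2^N n. ker (w n) n u v * 2 ^ n / 2 ^ N n) = 2 ^ n * leaf_avg (N n) (\<lambda>u. ker (w n) n u v)"
    by (simp add: leaf_avg_def sum_distrib_left sum_divide_distrib mult_ac)
  then show "(\<Sum>u<2^N n. ker (w n) n u v * 2 ^ n / 2 ^ N n) = 1" using ker_col[OF n v] by simp
next
  fix n u assume n: "1 \<le> n" and u: "u < (2::nat) ^ N n"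
  have "(\<Sum>v<2^n. ker (w n) n u v * 2 ^ n / 2 ^ N n) = (\<Sum>v<2^n. ker (w n) n u v) * 2 ^ n / 2 ^ N n"
    by (simp add: sum_distrib_right sum_divide_distrib)
  then show "(\<Sum>v<2^n. ker (w n) n u v * 2 ^ n / 2 ^ N n) / 2 ^ n = 1 / 2 ^ N n" by (simp add: ker_row_sum)
next
  fix n I assume "1 \<le> n" "I \<in> nodes n"
  then show "leaf_avg n (leaf_haar n I) = 0" by (simp add: leaf_avg_haar_node)
qed (use N abs_wave_fun_le_1 w1 leaf_haar_le_1 ker_nonneg in auto)

lemma b_in_V: "1 \<le> n \<Longrightarrow> I \<in> nodes n \<Longrightarrow> b n I \<in> V"
  using N1 mean by (intro blk_in_V) auto

text \<open>B replaces Haar functions by waves and A reads off wave coefficients as Haar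
  coefficients. The matrix of A T B is thus given by \<open>entries\<close>, and the operator is
  within \<eta> of c times the identity; its inverse is absorbed into A.\<close>

lemma factor_through_diagonal:
  assumes T: "bounded_op_on p V T C" and \<eta>: "0 < \<eta>" "\<eta> < \<bar>c\<bar>"
    and entries: "\<And>n m I J. 1 \<le> n \<Longrightarrow> 1 \<le> m \<Longrightarrow> I \<in> nodes n \<Longrightarrow> J \<in> nodes m \<Longrightarrow>
      \<bar>inner_L (b m J) (T (b n I)) - (if m = n \<and> J = I then c * node_len I else 0)\<bar> \<le> \<eta> / 64 ^ max n m"
  shows "\<exists>A B. bounded_op_on p V A (1 / (\<bar>c\<bar> - \<eta>)) \<and> bounded_op_on p V B 1 \<and> (\<forall>f\<in>V. AE x in LM. A (T (B f)) x = f x)"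
proof -
  interpret Fw: block_transfer h p "\<lambda>n. n" N leaf_haar "\<lambda>n. wave_fun (w n)" "\<lambda>n. ker (w n) n" by (rule forward_transfer)
  interpret Bw: block_transfer h p N "\<lambda>n. n" "\<lambda>n. wave_fun (w n)" leaf_haar "\<lambda>n v u. ker (w n) n u v * 2 ^ n / 2 ^ N n" by (rule backward_transfer)
  obtain B where B: "bounded_op_on p V B 1" "\<And>f. f \<in> V \<Longrightarrow> (\<lambda>M. nrm (\<lambda>x. Fw.trunc M f x - B f x)) \<longlonglongrightarrow> 0"
    using Fw.transfer_operator by blast
  obtain A where A: "bounded_op_on p V A 1" "\<And>f. f \<in> V \<Longrightarrow> (\<lambda>M. nrm (\<lambda>x. Bw.trunc M f x - A f x)) \<longlonglongrightarrow> 0"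
    using Bw.transfer_operator by blast
  note hbV = blk_haar_in_V
  have Bhb: "AE x in LM. B (hb n I) x = b n I x" if n: "1 \<le> n" and I: "I \<in> nodes n" for n I
  proof -
    have sf: "simple_fun {n} (\<lambda>_. leaf_haar n I)" using n I by (simp add: simple_fun_def leaf_avg_haar_node)
    have hb: "hb n I = blks {n} (\<lambda>_. leaf_haar n I)" by (simp add: blks_def[abs_def])
    have tr: "Fw.trunc M (hb n I) x = b n I x" if M: "M \<ge> n" for M x
    proof -
      have "{m \<in> {1..M}. m \<in> {n}} = {n}" using M n by auto
      then show ?thesis unfolding hb Fw.trunc_blks[OF sf] 
        using wave_fun_ker[OF I, of "w n", abs_def, symmetric] by simp
    qed
    have "(\<lambda>M. nrm (\<lambda>x. b n I x - B (hb n I) x)) \<longlonglongrightarrow> 0"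
      using B(2)[OF hbV[OF n I]]
    proof (rule Lim_transform_eventually)
      show "eventually (\<lambda>M. nrm (\<lambda>x. Fw.trunc M (hb n I) x - B (hb n I) x) = nrm (\<lambda>x. b n I x - B (hb n I) x)) sequentially"
        using eventually_ge_at_top[of n] by eventually_elim (simp add: tr)
    qed
    then have "nrm (\<lambda>x. b n I x - B (hb n I) x) = 0" by (simp add: LIMSEQ_const_iff)
    then have "AE x in LM. b n I x = B (hb n I) x"
      using b_in_V[OF n I] op_in_V[OF B(1) hbV[OF n I]] by (intro nrm_zero_AE) auto
    then show ?thesis by eventually_elim simp
  qed
  define U where "U f = A (T (B f))" for f
  have U: "bounded_op_on p V U (1 * (C * 1))"
    unfolding U_def[abs_def] by (rule op_compose[OF op_compose[OF B(1) T] A(1)])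
  \<comment> \<open>The weight 4 ^ n pays in advance for the nodes and inverse lengths met when a
    block sum is expanded in \<open>near_simple\<close>.\<close>
  have Uhb: "4 ^ n * nrm (\<lambda>x. U (hb n I) x - c * hb n I x) \<le> \<eta> * (1/2) ^ n" if n: "1 \<le> n" and I: "I \<in> nodes n" for n I
  proof -
    note VB = op_in_V[OF B(1) hbV[OF n I]] and Vb = b_in_V[OF n I]
    note VT = op_in_V[OF T Vb]
    have UA: "AE x in LM. U (hb n I) x = A (T (b n I)) x"
      unfolding U_def by (intro op_AE_cong[OF A(1)] op_AE_cong[OF T] op_in_V[OF T] VB Vb Bhb[OF n I])
    define D where "D M x = Bw.trunc M (T (b n I)) x - c * hb n I x" for M x
    have DV: "D M \<in> V" for M unfolding D_def[abs_def] by (intro V_diff Bw.trunc_in_V V_scale hbV[OF n I])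
    have Dle: "nrm (D M) \<le> (\<Sum>m=1..M. 4 ^ m * (\<eta> / 64 ^ max n m))" if M: "M \<ge> n" for M
    proof -
      define y where "y m J = inner_L (b m J) (T (b n I)) - (if m = n \<and> J = I then c * node_len I else 0)" for m J
      have D: "D M x = (\<Sum>m=1..M. \<Sum>J\<in>nodes m. y m J / node_len J * hb m J x)" for x
      proof -
        have "(\<Sum>m=1..M. \<Sum>J\<in>nodes m. (if m = n \<and> J = I then c * node_len I else 0) / node_len J * hb m J x)
          = (\<Sum>m=1..M. if m = n then c * hb n I x else 0)"
        proof (intro sum.cong refl)
          fix m
          show "(\<Sum>J\<in>nodes m. (if m = n \<and> J = I then c * node_len I else 0) / node_len J * hb m J x) = (if m = n then c * hb n I x else 0)"
          proof (cases "m = n")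
            case True
            have "(\<Sum>J\<in>nodes n. (if J = I then c * node_len I else 0) / node_len J * hb n J x) = (\<Sum>J\<in>nodes n. if J = I then c * hb n I x else 0)"
              by (intro sum.cong refl) (auto simp: node_len_def)
            then show ?thesis using True I by simp
          qed simp
        qed
        also have "\<dots> = c * hb n I x" using n M by simp
        finally show ?thesis
          unfolding D_def Bw.trunc_def y_def by (simp add: diff_divide_distrib left_diff_distrib sum_subtractf)
      qed
      have hL: "in_Lp p (hb m J)" if "m \<in> {1..M}" "J \<in> nodes m" for m J
        using that hbV by (intro V_in_Lp) auto
      have tm: "nrm (\<lambda>x. y m J / node_len J * hb m J x) \<le> \<bar>y m J\<bar> / node_len J" if m: "m \<in> {1..M}" and J: "J \<in> nodes m" for m J
      proof -
        have "nrm (\<lambda>x. y m J / node_len J * hb m J x) = \<bar>y m J / node_len J\<bar> * nrm (hb m J)"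
          by (rule Lp_norm_scale[OF p1 hL[OF m J]])
        also have "\<dots> \<le> \<bar>y m J / node_len J\<bar> * 1"
          using m leaf_haar_le_1 by (intro mult_left_mono nrm_blk_le_1) auto
        finally show ?thesis by (simp add: abs_divide)
      qed
      have "nrm (D M) \<le> (\<Sum>m=1..M. nrm (\<lambda>x. \<Sum>J\<in>nodes m. y m J / node_len J * hb m J x))"
        unfolding D[abs_def] using hL by (intro Lp_norm_sum[OF p1] in_Lp_sum[OF p1] in_Lp_scale[OF p1]) auto
      also have "\<dots> \<le> (\<Sum>m=1..M. \<Sum>J\<in>nodes m. nrm (\<lambda>x. y m J / node_len J * hb m J x))"
        using hL by (intro sum_mono Lp_norm_sum[OF p1] in_Lp_scale[OF p1]) auto
      also have "\<dots> \<le> (\<Sum>m=1..M. \<Sum>J\<in>nodes m. \<bar>y m J\<bar> / node_len J)"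
        using tm by (intro sum_mono) auto
      also have "\<dots> \<le> (\<Sum>m=1..M. 4 ^ m * (\<eta> / 64 ^ max n m))"
        using entries[OF n _ I] \<eta> by (intro sum_mono sum_inverse_len_le) (auto simp: y_def)
      finally show ?thesis .
    qed
    have lim: "(\<lambda>M. nrm (\<lambda>x. D M x - (A (T (b n I)) x - c * hb n I x))) \<longlonglongrightarrow> 0"
      using A(2)[OF VT] by (simp add: D_def)
    have "4 ^ n * nrm (D M) \<le> \<eta> * (1/2) ^ n" if M: "M \<ge> n" for M
    proof -
      have "4 ^ n * nrm (D M) \<le> 4 ^ n * (\<Sum>m=1..M. 4 ^ m * (\<eta> / 64 ^ max n m))" using Dle[OF M] by (intro mult_left_mono) auto
      also have "\<dots> \<le> (\<Sum>m=1..M. \<eta> * ((1/2) ^ n * (1/2) ^ m))"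
        unfolding sum_distrib_left using \<eta> by (intro sum_mono four_power_decay) auto
      also have "\<dots> = \<eta> * (1/2) ^ n * (\<Sum>m=1..M. (1/2) ^ m)" by (simp add: sum_distrib_left mult_ac)
      also have "\<dots> \<le> \<eta> * (1/2) ^ n * 1" using \<eta> by (intro mult_left_mono sum_half_powers_le) auto
      finally show ?thesis by simp
    qed
    then have small: "nrm (D M) \<le> \<eta> * (1/2) ^ n / 4 ^ n" if "M \<ge> n" for M
      using that by (simp add: pos_le_divide_eq mult.commute)
    have "nrm (\<lambda>x. A (T (b n I)) x - c * hb n I x) \<le> \<eta> * (1/2) ^ n / 4 ^ n"
      by (rule nrm_lim_le[OF DV V_diff[OF op_in_V[OF A(1) VT] V_scale[OF hbV[OF n I]]] lim small])
    moreover have "nrm (\<lambda>x. U (hb n I) x - c * hb n I x) = nrm (\<lambda>x. A (T (b n I)) x - c * hb n I x)"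
      using UA V_measurable[OF op_in_V[OF U hbV[OF n I]]] V_measurable[OF op_in_V[OF A(1) VT]] V_measurable[OF hbV[OF n I]]
      by (intro Lp_norm_cong) auto
    ultimately show ?thesis by (simp add: pos_le_divide_eq mult.commute)
  qed
  have near_simple: "nrm (\<lambda>x. U (blks S F) x - c * blks S F x) \<le> \<eta> * nrm (blks S F)" if S: "simple_fun S F" for S F
  proof -
    have fin: "finite S" and SF: "\<And>m. m \<in> S \<Longrightarrow> 1 \<le> m \<and> leaf_avg m (F m) = 0" using S by (auto simp: simple_fun_def)
    define s where "s = blks S F"
    have sV: "s \<in> V" using blks_in_V[OF S] by (simp add: s_def)
    define P where "P = Sigma S nodes"
    have finP: "finite P" using fin by (simp add: P_def)
    define a where "a = (\<lambda>(n, I). inner_L (hb n I) s / node_len I)"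
    define g where "g = (\<lambda>(n, I). hb n I)"
    have gV: "g i \<in> V" if "i \<in> P" for i using that SF hbV by (auto simp: P_def g_def)
    have s: "s = (\<lambda>x. \<Sum>i\<in>P. a i * g i x)"
    proof
      fix x
      have "s x = (\<Sum>n\<in>S. \<Sum>I\<in>nodes n. leaf_avg n (\<lambda>z. leaf_haar n I z * F n z) / node_len I * hb n I x)"
        unfolding s_def blks_def using SF blk_expansion by (intro sum.cong refl) auto
      also have "\<dots> = (\<Sum>n\<in>S. \<Sum>I\<in>nodes n. inner_L (hb n I) s / node_len I * hb n I x)"
        unfolding s_def using SF inner_L_blk_blks[OF _ S] by (intro sum.cong refl) auto
      also have "\<dots> = (\<Sum>i\<in>P. a i * g i x)"
        unfolding P_def using fin by (subst sum.Sigma) (auto simp: a_def g_def split_beta)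
      finally show "s x = (\<Sum>i\<in>P. a i * g i x)" .
    qed
    have dV: "(\<lambda>x. U (g i) x - c * g i x) \<in> V" if "i \<in> P" for i
      using gV[OF that] op_in_V[OF U] by (intro V_diff V_scale) auto
    have sumV: "(\<lambda>x. \<Sum>i\<in>P. a i * (U (g i) x - c * g i x)) \<in> V" using dV finP by (intro V_sum V_scale) auto
    have "AE x in LM. U (\<lambda>y. \<Sum>i\<in>P. a i * g i y) x = (\<Sum>i\<in>P. a i * U (g i) x)"
      by (rule op_sum[OF U finP gV])
    then have "AE x in LM. U s x - c * s x = (\<Sum>i\<in>P. a i * (U (g i) x - c * g i x))"
    proof eventually_elim
      case (elim x)
      have "U s x = (\<Sum>i\<in>P. a i * U (g i) x)" using elim unfolding s .
      moreover have "c * s x = (\<Sum>i\<in>P. a i * (c * g i x))" unfolding s by (simp add: sum_distrib_left mult_ac)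
      ultimately show ?case by (simp add: sum_subtractf right_diff_distrib)
    qed
    then have "nrm (\<lambda>x. U s x - c * s x) = nrm (\<lambda>x. \<Sum>i\<in>P. a i * (U (g i) x - c * g i x))"
      using V_measurable[OF op_in_V[OF U sV]] V_measurable[OF sV] V_measurable[OF sumV] by (intro Lp_norm_cong) auto
    also have "\<dots> \<le> (\<Sum>i\<in>P. nrm (\<lambda>x. a i * (U (g i) x - c * g i x)))"
      using V_in_Lp[OF dV] by (intro Lp_norm_sum[OF p1 finP] in_Lp_scale[OF p1]) auto
    also have "\<dots> = (\<Sum>i\<in>P. \<bar>a i\<bar> * nrm (\<lambda>x. U (g i) x - c * g i x))"
      using V_in_Lp[OF dV] by (intro sum.cong refl Lp_norm_scale[OF p1]) auto
    also have "\<dots> = (\<Sum>n\<in>S. \<Sum>I\<in>nodes n. \<bar>inner_L (hb n I) s\<bar> * nrm (\<lambda>x. U (hb n I) x - c * hb n I x) / node_len I)"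
      unfolding P_def using fin by (subst sum.Sigma) (auto simp: a_def g_def split_beta abs_divide)
    also have "\<dots> \<le> (\<Sum>n\<in>S. 4 ^ n * (nrm s * (\<eta> * (1/2) ^ n / 4 ^ n)))"
    proof (intro sum_mono sum_inverse_len_le mult_mono)
      fix n I assume n: "n \<in> S" and I: "I \<in> nodes n"
      then have n1: "1 \<le> n" using SF by simp
      show "\<bar>inner_L (hb n I) s\<bar> \<le> nrm s" by (rule inner_L_blk_le[OF n1 leaf_haar_le_1 sV])
      show "nrm (\<lambda>x. U (hb n I) x - c * hb n I x) \<le> \<eta> * (1/2) ^ n / 4 ^ n"
        using Uhb[OF n1 I] by (simp add: pos_le_divide_eq mult.commute)
    qed (use \<eta> Lp_norm_nonneg in auto)
    also have "\<dots> = \<eta> * nrm s * (\<Sum>n\<in>S. (1/2) ^ n)" by (simp add: sum_distrib_left mult_ac)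
    also have "\<dots> \<le> \<eta> * nrm s * 1" using \<eta> Lp_norm_nonneg fin SF by (intro mult_left_mono sum_half_powers_le) auto
    finally show ?thesis by (simp add: s_def)
  qed
  have near: "nrm (\<lambda>x. U f x - c * f x) \<le> \<eta> * nrm f" if f: "f \<in> V" for f
  proof (rule field_le_epsilon)
    fix e :: real assume e: "e > 0"
    have C: "0 \<le> C" by (rule op_const_nonneg[OF T])
    \<comment> \<open>Replacing f by s changes the three terms by at most C d, |c| d and \<eta> d; k
      exceeds the sum of these factors and is positive.\<close>
    define k where "k = C + \<bar>c\<bar> + \<eta> + 1"
    have k: "k > 0" using C \<eta> by (simp add: k_def)
    obtain S F where S: "simple_fun S F" "nrm (\<lambda>x. f x - blks S F x) < e / k"
      using V_approx[OF f, of "e / k"] e k by auto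
    define s where "s = blks S F"
    define d where "d = nrm (\<lambda>x. f x - s x)"
    have sV: "s \<in> V" using blks_in_V[OF S(1)] by (simp add: s_def)
    have d: "0 \<le> d" "k * d < e" using S(2) k Lp_norm_nonneg by (auto simp: d_def s_def field_simps)
    have V2: "(\<lambda>x. U f x - U s x) \<in> V" "(\<lambda>x. c * (f x - s x)) \<in> V" "(\<lambda>x. U f x - c * f x) \<in> V" "(\<lambda>x. U s x - c * s x) \<in> V"
      using f sV op_in_V[OF U] by (auto intro!: V_diff V_scale)
    have "nrm (\<lambda>x. U f x - c * f x) \<le> nrm (\<lambda>x. (U f x - c * f x) - (U s x - c * s x)) + nrm (\<lambda>x. U s x - c * s x)"
      by (rule nrm_le_diff[OF V2(3,4)])
    also have "(\<lambda>x. (U f x - c * f x) - (U s x - c * s x)) = (\<lambda>x. (U f x - U s x) - c * (f x - s x))"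
      by (simp add: algebra_simps)
    also have "nrm \<dots> \<le> nrm (\<lambda>x. U f x - U s x) + nrm (\<lambda>x. c * (f x - s x))"
      by (rule Lp_norm_diff_triangle[OF p1 V_in_Lp[OF V2(1)] V_in_Lp[OF V2(2)]])
    also have "nrm (\<lambda>x. U f x - U s x) \<le> C * d" using op_diff(2)[OF U f sV] by (simp add: d_def)
    also have "nrm (\<lambda>x. c * (f x - s x)) = \<bar>c\<bar> * d"
      unfolding d_def by (rule Lp_norm_scale[OF p1 V_in_Lp[OF V_diff[OF f sV]]])
    also have "nrm (\<lambda>x. U s x - c * s x) \<le> \<eta> * nrm s" using near_simple[OF S(1)] by (simp add: s_def)
    also have "\<eta> * nrm s \<le> \<eta> * (d + nrm f)"
      using nrm_le_diff[OF sV f] \<eta> by (intro mult_left_mono) (auto simp: d_def Lp_norm_minus_commute[of p f])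
    finally have "nrm (\<lambda>x. U f x - c * f x) \<le> \<eta> * nrm f + (C + \<bar>c\<bar> + \<eta>) * d" by (simp add: algebra_simps)
    also have "(C + \<bar>c\<bar> + \<eta>) * d \<le> k * d" using d by (intro mult_right_mono) (auto simp: k_def)
    finally show "nrm (\<lambda>x. U f x - c * f x) \<le> \<eta> * nrm f + e" using d by simp
  qed
  obtain W where W: "bounded_op_on p V W (1 / (\<bar>c\<bar> - \<eta>))" "\<And>f. f \<in> V \<Longrightarrow> AE x in LM. W (U f) x = f x"
    using near_scalar_inverse[OF U near] \<eta> by (metis less_imp_le)
  have "bounded_op_on p V (\<lambda>f. W (A f)) (1 / (\<bar>c\<bar> - \<eta>) * 1)" by (rule op_compose[OF A(1) W(1)])
  then show ?thesis using B(1) W(2) unfolding U_def by (intro exI[of _ "\<lambda>f. W (A f)"] exI[of _ B]) simp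
qed

end

context haar_copies_Lp
begin

text \<open>Entries between blocks m < n are made small when the later one is chosen, hence the
  accuracy at \<open>max n m\<close>. The thresholds must be known before block n and its wave are,
  so they are uniform over all functions G bounded by 1 with mean zero.\<close>

lemma exists_wave_blocks:
  assumes T: "bounded_op_on p V T C"
    and good: "\<And>n \<eta> M. 0 < \<eta> \<Longrightarrow> \<exists>N\<ge>M. \<exists>w \<beta>. good_block n \<eta> c N (haar_matrix T N) w \<beta>" and \<epsilon>: "\<And>n. 0 < \<epsilon> n"
  obtains N w where "wave_blocks h p N w"
    "\<And>n m I J. 1 \<le> n \<Longrightarrow> 1 \<le> m \<Longrightarrow> I \<in> nodes n \<Longrightarrow> J \<in> nodes m \<Longrightarrow>
      \<bar>inner_L (blk h (N m) (wave_fun (w m) J)) (T (blk h (N n) (wave_fun (w n) I))) - (if m = n \<and> J = I then c * node_len I else 0)\<bar> \<le> \<epsilon> (max n m)"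
proof -
  \<comment> \<open>Blocks start at 1 while the recursion runs over all natural numbers; at n = 0
    the condition is void.\<close>
  define P :: "(nat \<Rightarrow> nat \<times> (nat \<Rightarrow> nat \<Rightarrow> real)) \<Rightarrow> nat \<Rightarrow> nat \<times> (nat \<Rightarrow> nat \<Rightarrow> real) \<Rightarrow> bool" where
    "P f n r \<longleftrightarrow> (1 \<le> n \<longrightarrow> n \<le> fst r \<and> (\<exists>\<beta>. good_block n (\<epsilon> n) c (fst r) (haar_matrix T (fst r)) (snd r) \<beta>) \<and>
      (\<forall>m. 1 \<le> m \<longrightarrow> m < n \<longrightarrow> fst (f m) < fst r \<and>
        (\<forall>I\<in>nodes m. \<forall>G. (\<forall>y<2^fst r. \<bar>G y\<bar> \<le> 1) \<longrightarrow> leaf_avg (fst r) G = 0 \<longrightarrow>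
          \<bar>inner_L (blk h (fst r) G) (T (blk h (fst (f m)) (wave_fun (snd (f m)) I)))\<bar> \<le> \<epsilon> n \<and>
          \<bar>inner_L (blk h (fst (f m)) (wave_fun (snd (f m)) I)) (T (blk h (fst r) G))\<bar> \<le> \<epsilon> n)))" for f n r
  have "\<exists>f. \<forall>n. P f n (f n)"
  proof (rule dependent_wf_choice[of less_than])
    fix f g :: "nat \<Rightarrow> nat \<times> (nat \<Rightarrow> nat \<Rightarrow> real)" and n r
    assume "\<And>z. (z, n) \<in> less_than \<Longrightarrow> f z = g z"
    then have "f m = g m" if "m < n" for m using that by simp
    then show "P f n r = P g n r" unfolding P_def by (simp cong: conj_cong imp_cong)
  next
    fix n and f :: "nat \<Rightarrow> nat \<times> (nat \<Rightarrow> nat \<Rightarrow> real)"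
    assume IH: "\<And>m. (m, n) \<in> less_than \<Longrightarrow> P f m (f m)"
    have ex: "\<exists>M. \<forall>N\<ge>M. \<forall>G. 1 \<le> N \<longrightarrow> (\<forall>y<2^N. \<bar>G y\<bar> \<le> 1) \<longrightarrow> leaf_avg N G = 0 \<longrightarrow>
          \<bar>inner_L (blk h N G) (T (blk h (fst (f (fst i))) (wave_fun (snd (f (fst i))) (snd i))))\<bar> < \<epsilon> n \<and>
          \<bar>inner_L (blk h (fst (f (fst i))) (wave_fun (snd (f (fst i))) (snd i))) (T (blk h N G))\<bar> < \<epsilon> n"
      if i: "i \<in> Sigma {1..<n} nodes" for i
    proof -
      obtain m I where mI: "i = (m, I)" "1 \<le> m" "m < n" "I \<in> nodes m" using i by auto
      have "P f m (f m)" using IH mI by simp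
      then obtain \<beta> where f: "m \<le> fst (f m)" "good_block m (\<epsilon> m) c (fst (f m)) (haar_matrix T (fst (f m))) (snd (f m)) \<beta>"
        using mI unfolding P_def by blast
      have N1: "1 \<le> fst (f m)" using f mI by simp
      note gf = good_block_facts[OF T N1 f(2)]
      have bV: "blk h (fst (f m)) (wave_fun (snd (f m)) I) \<in> V" using gf(1) mI N1 by (intro blk_in_V) auto
      obtain M1 where M1: "\<And>N G. N \<ge> M1 \<Longrightarrow> 1 \<le> N \<Longrightarrow> (\<forall>y<2^N. \<bar>G y\<bar> \<le> 1) \<Longrightarrow> \<bar>inner_L (blk h N G) (T (blk h (fst (f m)) (wave_fun (snd (f m)) I)))\<bar> < \<epsilon> n"
        using inner_L_blk_vanish[OF op_in_V[OF T bV] \<epsilon>[of n]] by blast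
      obtain M2 where M2: "\<And>N G. N \<ge> M2 \<Longrightarrow> 1 \<le> N \<Longrightarrow> (\<forall>y<2^N. \<bar>G y\<bar> \<le> 1) \<Longrightarrow> leaf_avg N G = 0 \<Longrightarrow> \<bar>inner_L (blk h (fst (f m)) (wave_fun (snd (f m)) I)) (T (blk h N G))\<bar> < \<epsilon> n"
        using inner_L_op_blk_vanish[where u = "wave_fun (snd (f m)) I", OF T N1 gf(2) \<epsilon>[of n]] by blast
      show ?thesis unfolding mI(1) fst_conv snd_conv using M1 M2 by (intro exI[of _ "max M1 M2"]) simp
    qed
    then obtain M where M: "\<And>i N G. i \<in> Sigma {1..<n} nodes \<Longrightarrow> N \<ge> M i \<Longrightarrow> 1 \<le> N \<Longrightarrow> (\<forall>y<2^N. \<bar>G y\<bar> \<le> 1) \<Longrightarrow> leaf_avg N G = 0 \<Longrightarrow>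
          \<bar>inner_L (blk h N G) (T (blk h (fst (f (fst i))) (wave_fun (snd (f (fst i))) (snd i))))\<bar> < \<epsilon> n \<and>
          \<bar>inner_L (blk h (fst (f (fst i))) (wave_fun (snd (f (fst i))) (snd i))) (T (blk h N G))\<bar> < \<epsilon> n"
      by metis
    \<comment> \<open>Sums serve as upper bounds: M0 exceeds n, all earlier block numbers and all
      thresholds.\<close>
    define M0 where "M0 = n + 1 + (\<Sum>m<n. fst (f m)) + (\<Sum>i\<in>Sigma {1..<n} nodes. M i)"
    obtain N w \<beta> where N: "N \<ge> M0" "good_block n (\<epsilon> n) c N (haar_matrix T N) w \<beta>" using good[OF \<epsilon>[of n], of M0 n] by blast
    have NM: "N \<ge> M i" if "i \<in> Sigma {1..<n} nodes" for i
      using N(1) member_le_sum[OF that, of M] by (simp add: M0_def)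
    have Nf: "fst (f m) < N" if "m < n" for m
      using N(1) member_le_sum[of m "{..<n}" "\<lambda>m. fst (f m)"] that by (simp add: M0_def)
    have Nn: "n \<le> N" "1 \<le> N" using N(1) by (auto simp: M0_def)
    have "P f n (N, w)"
      unfolding P_def fst_conv snd_conv
    proof (intro impI conjI allI ballI)
      show "\<exists>\<beta>. good_block n (\<epsilon> n) c N (haar_matrix T N) w \<beta>" using N(2) by blast
      fix m assume m: "1 \<le> m" "m < n"
      show "fst (f m) < N" using Nf m by blast
      fix I G assume I: "I \<in> nodes m" and G: "\<forall>y<2^N. \<bar>G y\<bar> \<le> 1" "leaf_avg N G = 0"
      have i: "(m, I) \<in> Sigma {1..<n} nodes" using m I by simp
      show "\<bar>inner_L (blk h N G) (T (blk h (fst (f m)) (wave_fun (snd (f m)) I)))\<bar> \<le> \<epsilon> n"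
        "\<bar>inner_L (blk h (fst (f m)) (wave_fun (snd (f m)) I)) (T (blk h N G))\<bar> \<le> \<epsilon> n"
        using M[OF i NM[OF i] Nn(2) G] by (simp_all add: less_imp_le)
    qed (rule Nn)
    then show "\<exists>r. P f n r" by blast
  qed simp
  then obtain f where f: "\<And>n. P f n (f n)" by blast
  define N where "N n = fst (f n)" for n
  define w where "w n = snd (f n)" for n
  have Nn: "n \<le> N n" if "1 \<le> n" for n using f[of n] that unfolding P_def N_def by blast
  have N1: "1 \<le> N n" if "1 \<le> n" for n using Nn[OF that] that by simp
  have gb: "\<exists>\<beta>. good_block n (\<epsilon> n) c (N n) (haar_matrix T (N n)) (w n) \<beta>" if "1 \<le> n" for n
    using f[of n] that unfolding P_def N_def w_def by blast
  note gf = good_block_facts[OF T N1]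
  have less: "N m < N n" if "1 \<le> m" "m < n" for m n
    using f[of n] that unfolding P_def N_def by (meson le_less_trans less_imp_le)
  have mean: "leaf_avg (N n) (wave_fun (w n) I) = 0" if "1 \<le> n" "I \<in> nodes n" for n I
    using gb[OF that(1)] gf(1)[OF that(1)] that(2) by blast
  have le1: "\<forall>y<2^N n. \<bar>wave_fun (w n) I y\<bar> \<le> 1" if "1 \<le> n" for n I
    using gb[OF that(1)] gf(2)[OF that(1)] by blast
  have wb: "wave_blocks h p N w"
  proof
    show "inj_on N {1..}"
    proof (rule inj_onI)
      fix m n assume mn: "m \<in> {1..}" "n \<in> {1..}" "N m = N n"
      then show "m = n" using less[of m n] less[of n m] by (cases m n rule: linorder_cases) auto
    qed
    fix n i y assume "1 \<le> n" "y < (2::nat) ^ N n"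
    then show "\<bar>w n i y\<bar> \<le> 1" using gb gf(3) by blast
  qed (use Nn mean in auto)
  have cross: "\<bar>inner_L (blk h (N n) (wave_fun (w n) J)) (T (blk h (N m) (wave_fun (w m) I)))\<bar> \<le> \<epsilon> n \<and>
      \<bar>inner_L (blk h (N m) (wave_fun (w m) I)) (T (blk h (N n) (wave_fun (w n) J)))\<bar> \<le> \<epsilon> n"
    if "1 \<le> m" "m < n" "I \<in> nodes m" "J \<in> nodes n" for m n I J
  proof -
    have n1: "1 \<le> n" using that by simp
    show ?thesis using f[of n] n1 that mean[OF n1 that(4)] le1[OF n1, of J] unfolding P_def N_def w_def by blast
  qed
  show thesis
  proof (rule that[OF wb])
    fix n m I J assume nm: "1 \<le> n" "1 \<le> m" and I: "I \<in> nodes n" and J: "J \<in> nodes m"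
    consider "m < n" | "n < m" | "m = n" by linarith
    then show "\<bar>inner_L (blk h (N m) (wave_fun (w m) J)) (T (blk h (N n) (wave_fun (w n) I))) - (if m = n \<and> J = I then c * node_len I else 0)\<bar> \<le> \<epsilon> (max n m)"
    proof cases
      case 1
      then show ?thesis using cross[OF nm(2) 1 J I] by simp
    next
      case 2
      then show ?thesis using cross[OF nm(1) 2 I J] by simp
    next
      case 3
      obtain \<beta> where "good_block n (\<epsilon> n) c (N n) (haar_matrix T (N n)) (w n) \<beta>" using gb[OF nm(1)] by blast
      from gf(4)[OF nm(1) this, of J I] I J show ?thesis unfolding 3 by auto
    qed
  qed
qed

end

theorem mainTheorem10:
  fixes p \<delta> :: real
    and h :: "nat \<Rightarrow> nat \<times> nat \<Rightarrow> real \<Rightarrow> real"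
    and T :: "(real \<Rightarrow> real) \<Rightarrow> (real \<Rightarrow> real)"
  assumes p: "1 < p"
    and fam: "haar_copy_family h"
    and Tbdd: "\<exists>C. bounded_op_on p (R_space p h) T C"
    and \<delta>pos: "0 < \<delta>"
    and diag: "\<forall>(n, I)\<in>D_omega. \<delta> \<le> \<bar>inner_L (h n I) (T (h n I)) / dy_len I\<bar>"
  shows "\<forall>\<epsilon>::real. 0 < \<epsilon> \<and> \<epsilon> < 1 \<longrightarrow>
     (let q = p / (p - 1); ps = max p q in
      \<exists>A B a b. bounded_op_on p (R_space p h) A a \<and> bounded_op_on p (R_space p h) B b \<and>
        (\<forall>f\<in>R_space p h. AE x in LM. A (T (B f)) x = f x) \<and>
        a * b \<le> 2 * (ps - 1) ^ 4 / (\<delta> * (1 - \<epsilon>)) * (ps / 2) powr (3 / 2))"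
proof (intro allI impI)
  fix \<epsilon> :: real assume \<epsilon>: "0 < \<epsilon> \<and> \<epsilon> < 1"
  interpret haar_copies_Lp h p by unfold_locales (use fam p in auto)
  obtain C where T: "bounded_op_on p V T C" using Tbdd by blast
  have diag': "\<delta> \<le> \<bar>inner_L (h n J) (T (h n J)) / dy_len J\<bar>" if "1 \<le> n" "J \<in> nodes n" for n J
    using diag that unfolding D_omega_eq by blast
  obtain c where c: "\<delta> / 2 \<le> \<bar>c\<bar>" "\<And>n \<eta> M. 0 < \<eta> \<Longrightarrow> \<exists>N\<ge>M. \<exists>w \<beta>. good_block n \<eta> c N (haar_matrix T N) w \<beta>"
    using exists_limit_scalar[OF T \<delta>pos diag'] by blast
  \<comment> \<open>Chosen so that |c| - \<eta> \<ge> \<delta> * (1 - \<epsilon>) / 2.\<close>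
  define \<eta> where "\<eta> = \<delta> * \<epsilon> / 2"
  have \<eta>: "0 < \<eta>" "\<eta> < \<bar>c\<bar>"
  proof -
    show "0 < \<eta>" using \<delta>pos \<epsilon> by (simp add: \<eta>_def)
    have "\<delta> * \<epsilon> < \<delta> * 1" using \<delta>pos \<epsilon> by (intro mult_strict_left_mono) auto
    then show "\<eta> < \<bar>c\<bar>" using c(1) by (simp add: \<eta>_def)
  qed
  have e: "0 < \<eta> / 64 ^ n" for n :: nat using \<eta> by simp
  obtain N w where wb: "wave_blocks h p N w" and entries:
    "\<And>n m I J. 1 \<le> n \<Longrightarrow> 1 \<le> m \<Longrightarrow> I \<in> nodes n \<Longrightarrow> J \<in> nodes m \<Longrightarrow>
      \<bar>inner_L (blk h (N m) (wave_fun (w m) J)) (T (blk h (N n) (wave_fun (w n) I))) - (if m = n \<and> J = I then c * node_len I else 0)\<bar> \<le> \<eta> / 64 ^ max n m"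
    using exists_wave_blocks[OF T c(2), where \<epsilon> = "\<lambda>n. \<eta> / 64 ^ n"] e by blast
  obtain A B where AB: "bounded_op_on p V A (1 / (\<bar>c\<bar> - \<eta>))" "bounded_op_on p V B 1" "\<forall>f\<in>V. AE x in LM. A (T (B f)) x = f x"
    using wave_blocks.factor_through_diagonal[OF wb T \<eta> entries] by blast
  \<comment> \<open>One of two conjugate exponents is at least 2, so both factors of the stated
    constant that contain ps are at least 1.\<close>
  define ps where "ps = max p (p / (p - 1))"
  have ps: "2 \<le> ps"
  proof (cases "p \<ge> 2")
    case False
    then have "2 * (p - 1) \<le> p" by simp
    then have "2 \<le> p / (p - 1)" using p by (simp add: pos_le_divide_eq)
    then show ?thesis by (simp add: ps_def)
  qed (simp add: ps_def)
  have d: "0 < \<delta> * (1 - \<epsilon>)" using \<delta>pos \<epsilon> by simp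
  have "1 / (\<bar>c\<bar> - \<eta>) * 1 \<le> 1 / (\<delta> * (1 - \<epsilon>) / 2)"
    using c(1) d \<eta> unfolding mult_1_right by (intro divide_left_mono mult_pos_pos) (auto simp: \<eta>_def field_simps)
  also have "\<dots> = 2 * 1 / (\<delta> * (1 - \<epsilon>)) * 1" by simp
  also have "\<dots> \<le> 2 * (ps - 1) ^ 4 / (\<delta> * (1 - \<epsilon>)) * (ps / 2) powr (3 / 2)"
    using ps d by (intro mult_mono divide_right_mono mult_left_mono one_le_power ge_one_powr_ge_zero) auto
  finally have "1 / (\<bar>c\<bar> - \<eta>) * 1 \<le> 2 * (ps - 1) ^ 4 / (\<delta> * (1 - \<epsilon>)) * (ps / 2) powr (3 / 2)" .
  then show "let q = p / (p - 1); ps = max p q in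
      \<exists>A B a b. bounded_op_on p V A a \<and> bounded_op_on p V B b \<and>
        (\<forall>f\<in>V. AE x in LM. A (T (B f)) x = f x) \<and>
        a * b \<le> 2 * (ps - 1) ^ 4 / (\<delta> * (1 - \<epsilon>)) * (ps / 2) powr (3 / 2)"
    unfolding Let_def ps_def[symmetric] using AB by blast
qed

end
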